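(* Let $\{\omega_k\}_{k\ge 0}=\{(Y_k,X_k)\}_{k\ge0}$ be a sequence of iterates produced by the BCD-GLU, the BCD-GQU or the BCD-GU algorithm (defined in the context) for the cost function $f(Y,X)=\sum_{\ell=1}^{L}\|\mathrm{offdiag}\{(YX)^{S}A^{(\ell)}(YX)\}\|^2$ on $\mathrm{St}(m,n,\mathbb C)\times \mathrm{SL}_m(\mathbb C)$, where $S\in\{T,H\}$ is fixed. Assume that the iterates are bounded, i.e. there is a constant $M_\omega>0$ such that $\|\omega_k\|\le M_\omega$ for all $k\ge1$. If $\omega_*$ is an accumulation point of $\{\omega_k\}_{k\ge1}$, then $\omega_*$ is a stationary point of $f$ on $\mathrm{St}(m,n,\mathbb C)\times \mathrm{SL}_m(\mathbb C)$ (i.e. the Riemannian gradient of $f$ vanishes at $\omega_*$).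
   Context: **Problem.** Let $2\le m\le n$ and $L\ge 1$ be integers and $A^{(1)},\dots,A^{(L)}\in\mathbb C^{n\times n}$. Fix $S\in\{T,H\}$, so that $(\cdot)^{S}$ is either the transpose $(\cdot)^{T}$ or the conjugate transpose $(\cdot)^{H}$. $\mathrm{offdiag}\{W\}$ is $W$ with its diagonal set to zero; $\|\cdot\|$ is the Frobenius norm, and $\|(Y,X)\|^2=\|Y\|^2+\|X\|^2$. $\mathrm{St}(m,n,\mathbb C)=\{Y\in\mathbb C^{n\times m}:Y^HY=I_m\}$, $\mathrm{SL}_m(\mathbb C)=\{X\in\mathbb C^{m\times m}:\det X=1\}$, and $\mathrm{EUT}_m(\mathbb C)$ is the group of upper triangular matrices in $\mathrm{SL}_m(\mathbb C)$. $f$ is as in the claim. **Gradients.** $\nabla h=\partial h/\partial Z^{\Re}+i\,\partial h/\partial Z^{\Im}$ is the Euclidean gradient for the real inner product $\mathrm{Re}\,\mathrm{tr}(Z_1^HZ_2)$. For $\omega=(Y,X)$ put $p=f(\cdot,X)$, $g=f(Y,\cdot)$, both extended to the full matrix spaces by the same formula. Then $\mathrm{grad} f_1(\omega)=\mathrm{grad}\,p(Y)=\nabla p(Y)-\tfrac12Y\big(Y^H\nabla p(Y)+\nabla p(Y)^HY\big)$; $\mathrm{grad} f_2(\omega)=X\Lambda(X)$ with $\Lambda(X)=X^H\nabla g(X)-\frac{\mathrm{tr}(X^H\nabla g(X))}{m}I_m$ (the Riemannian gradient on $\mathrm{SL}_m(\mathbb C)$ for the left-invariant metric $\langle V_1,V_2\rangle_X=\mathrm{Re}\,\mathrm{tr}((X^{-1}V_1)^HX^{-1}V_2)$);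 and $\mathrm{grad} f=(\mathrm{grad} f_1,\mathrm{grad} f_2)$, $\|\mathrm{grad} f\|^2=\|\mathrm{grad} f_1\|^2+\|\mathrm{grad} f_2\|^2$. In the BCD-GU algorithm $X_0\in \mathrm{EUT}_m(\mathbb C)$ (so all $X_k\in\mathrm{EUT}_m(\mathbb C)$), the second block is regarded in the algorithm as living on $\mathrm{EUT}_m(\mathbb C)$, and $\Lambda(X)$ used in the algorithm is instead the orthogonal projection of $X^H\nabla g(X)$ onto the traceless upper triangular matrices. **Elementary functions.** For $i<j$ and $\Psi\in\mathbb C^{2\times2}$, $\mathcal E_{i,j}(\Psi)\in\mathbb C^{m\times m}$ is the identity matrix except that its $(i,i),(i,j),(j,i),(j,j)$ entries are $\Psi_{11},\Psi_{12},\Psi_{21},\Psi_{22}$. For given $g$, $X$, $(i,j)$ and $z=x+iy$, set $h(\Psi)=g(X\mathcal E_{i,j}(\Psi))$, and denote it - $h^{(U)}(x,y)$ when $\Psi=\begin{bmatrix}1 & z \\ 0 & 1\end{bmatrix}$; $h^{(L)}(x,y)$ when $\Psi=\begin{bmatrix}1 & 0 \\ z & 1\end{bmatrix}$; $h^{(D)}(x,y)$ when $\Psi=\begin{bmatrix}z & 0 \\ 0 & 1/z\end{bmatrix}$, $z\ne0$; - $h^{(Q)}(c,s_1,s_2)$ when $\Psi=\begin{bmatrix}c & -(s_1+is_2) \\ s_1-is_2 & c\end{bmatrix}$, $c^2+s_1^2+s_2^2=1$; also $c=\cos\theta$, $s_1=\sin\theta\cos\phi$, $s_2=\sin\theta\sin\phi$.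 $\partial h(I_2)$ is the gradient at the parameter giving $\Psi=I_2$: $(\partial_x,\partial_y)$ at $(0,0)$ for $U,L$ and at $(1,0)$ for $D$; the gradient on the unit sphere at $(1,0,0)$ for $Q$. **Algorithm.** Fix constants $0<\upsilon<\sqrt2/2$, $0<\delta_s<1$, $0<\delta_w<\delta_c<1$, $0<\varsigma_D<1/4$, $0<\varsigma_Q\le1$, and $\varepsilon$ (below). Start at some $\omega_0$. At iteration $k\ge1$: if $\mathrm{grad} f(\omega_{k-1})=0$, then $\omega_k=\omega_{k-1}$. Otherwise choose $t_k\in\{1,2\}$ with $\|\mathrm{grad} f_{t_k}(\omega_{k-1})\|\ge\upsilon\|\mathrm{grad} f(\omega_{k-1})\|$. *If $t_k=1$*: $X_k=X_{k-1}$, and with $p=f(\cdot,X_{k-1})$, $Y_k=\mathrm{Exp}_{Y_{k-1}}(\tau V)$, where $\mathrm{Exp}$ is the Riemannian exponential map of $\mathrm{St}(m,n,\mathbb C)$ with the metric induced from $\mathbb C^{n\times m}$, and the nonzero tangent vector $V\in T_{Y_{k-1}}\mathrm{St}(m,n,\mathbb C)$ and the step $\tau>0$ satisfy $\langle\mathrm{grad}\,p(Y_{k-1}),V\rangle\le-\delta_s\|\mathrm{grad}\,p(Y_{k-1})\|\|V\|$, $\ p(Y_k)\le p(Y_{k-1})+\delta_w\tau\langle\mathrm{grad}\,p(Y_{k-1}),V\rangle$, and $\langle\mathrm{grad}\,p(Y_k),\mathrm D\,\mathrm{Exp}_{Y_{k-1}}(\tau V)[V]\rangle\ge\delta_c\langle\mathrm{grad}\,p(Y_{k-1}),V\rangle$.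 *If $t_k=2$*: $Y_k=Y_{k-1}$. With $g=f(Y_{k-1},\cdot)$ and $X=X_{k-1}$, choose a pair $i<j$ and an elementary function $h$ of an allowed type with $\|\partial h(I_2)\|\ge\varepsilon\|\Lambda(X_{k-1})\|$, and set $X_k=X_{k-1}\mathcal E_{i,j}(\Psi_k^* )$. Allowed types: BCD-GLU: $U,L,D$ with $0<\varepsilon<\sqrt{\frac{2}{3m(m-1)}}$; BCD-GQU: $Q,U,D$ with $0<\varepsilon<\sqrt{\frac{3-\sqrt5}{3m(m-1)}}$; BCD-GU: $U,D$ with $0<\varepsilon<\sqrt{\frac1{m(m-1)}}$. Let $W^{(\ell)}=X^{S}Y_{k-1}^{S}A^{(\ell)}Y_{k-1}X$. The matrix $\Psi_k^*$ is: - Type $U$ or $L$: $(x,y)$ is the minimizer of the quadratic polynomial $h$ over $\mathbb R^2$; if $h$ is constant, $(x,y)=(0,0)$. - Type $D$: $y=0$. Let $\gamma_1=\sum_\ell\sum_{p\ne i,j}(|W^{(\ell)}_{ip}|^2+|W^{(\ell)}_{pi}|^2)$, $\gamma_2=\sum_\ell\sum_{p\ne i,j}(|W^{(\ell)}_{jp}|^2+|W^{(\ell)}_{pj}|^2)$. If $\gamma_1=\gamma_2=0$, $x=1$. Otherwise let $\varpi=\gamma_2/\gamma_1\in[0,+\infty]$: $x=1/2$ if $\varpi<\varsigma_D$; $x=2$ if $\varpi>1/\varsigma_D$; $x=\varpi^{1/4}$ otherwise. - Type $Q$: let $\varrho=1$ and $\mathbf z(W)=[W_{jj}-W_{ii},\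 W_{ij}+W_{ji},\ -i(W_{ij}-W_{ji})]^T$ if $S=H$; $\varrho=-1$ and $\mathbf z(W)=[W_{ij}+W_{ji},\ W_{ii}-W_{jj},\ i(W_{ii}+W_{jj})]^T$ if $S=T$ (the factor $i$ multiplying brackets is the imaginary unit). Let $\Gamma=\frac{\varrho}{2}\sum_\ell\mathrm{Re}(\mathbf z(W^{(\ell)})\mathbf z(W^{(\ell)})^H)\in\mathbb R^{3\times3}$ and $r(\theta,\phi)=[\cos2\theta,-\sin2\theta\cos\phi,-\sin2\theta\sin\phi]^T$; one has $h^{(Q)}(\theta,\phi)-h^{(Q)}(0,0)=-(r^T\Gamma r-\Gamma_{11})$. Let $u$ be a unit eigenvector of $\Gamma$ for its largest eigenvalue with $u_1\ge0$, $v=[\Gamma_{12},\Gamma_{13}]^T$, $w=[u_2,u_3]^T$. If $|\langle v,w\rangle|\ge\varsigma_Q\|v\|\|w\|$, take $(\theta_*,\phi_* )$ with $\theta_*\in[-\pi/4,\pi/4]$ and $r(\theta_*,\phi_* )=u$. Otherwise take $\phi_*$ with $[\cos\phi_*,\sin\phi_*]^T=v/\|v\|$ and $\theta_*\in[-\pi/4,\pi/4]$ maximizing $\theta\mapsto r(\theta,\phi_* )^T\Gamma\, r(\theta,\phi_* )$. $\Psi_k^*$ is the matrix with parameters $(\theta_*,\phi_* )$. *)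

theory Defs
  imports "HOL-Analysis.Analysis"
begin

text \<open>
  An \<open>n \<times> m\<close> complex matrix is a \<open>complex^'m^'n\<close>. Its library norm is the Frobenius norm, its
  library inner product is the real part of the trace form, and the library norm of a pair
  \<open>(Y, X)\<close> is the square root of the sum of the squared norms. The index type \<open>'m\<close> is linearly
  ordered, so that index pairs \<open>i < j\<close> and upper triangular matrices make sense.
\<close>

datatype star_kind = Trans | Herm

definition ctranspose :: "complex^'a^'b \<Rightarrow> complex^'b^'a" where
  "ctranspose M = map_matrix cnj (transpose M)"

definition star :: "star_kind \<Rightarrow> complex^'a^'b \<Rightarrow> complex^'b^'a" where
  "star S M = (case S of Trans \<Rightarrow> transpose M | Herm \<Rightarrow> ctranspose M)"

definition offdiag :: "complex^'m^'m \<Rightarrow> complex^'m^'m" where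
  "offdiag W = (\<chi> i j. if i = j then 0 else W $ i $ j)"

text \<open>The cost function, given by its formula on all pairs of matrices.\<close>

definition cost ::
  "star_kind \<Rightarrow> nat \<Rightarrow> (nat \<Rightarrow> complex^'n^'n) \<Rightarrow> (complex^'m^'n) \<times> (complex^'m^'m) \<Rightarrow> real" where
  "cost S L A = (\<lambda>(Y, X). \<Sum>l=1..L. (norm (offdiag (star S (Y ** X) ** A l ** (Y ** X))))\<^sup>2)"

definition St :: "(complex^'m^'n) set" where
  "St = {Y. ctranspose Y ** Y = mat 1}"

definition SL :: "(complex^'m^'m) set" where
  "SL = {X. det X = 1}"

definition upper_tri :: "complex^'m::{finite,wellorder}^'m::{finite,wellorder} \<Rightarrow> bool" where
  "upper_tri M \<longleftrightarrow> (\<forall>i j. j < i \<longrightarrow> M $ i $ j = 0)"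

definition EUT :: "(complex^'m::{finite,wellorder}^'m::{finite,wellorder}) set" where
  "EUT = {X \<in> SL. upper_tri X}"


section \<open>Gradients\<close>

text \<open>Well defined wherever \<open>h\<close> is differentiable.\<close>

definition nabla :: "('a::real_inner \<Rightarrow> real) \<Rightarrow> 'a \<Rightarrow> 'a" where
  "nabla h z = (THE D. GDERIV h z :> D)"

definition St_grad :: "(complex^'m^'n \<Rightarrow> real) \<Rightarrow> complex^'m^'n \<Rightarrow> complex^'m^'n" where
  "St_grad p Y = nabla p Y -
     (1/2) *\<^sub>R (Y ** (ctranspose Y ** nabla p Y + ctranspose (nabla p Y) ** Y))"

definition SL_Lambda :: "(complex^'m^'m \<Rightarrow> real) \<Rightarrow> complex^'m^'m \<Rightarrow> complex^'m^'m" where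
  "SL_Lambda g X = ctranspose X ** nabla g X -
     mat (trace (ctranspose X ** nabla g X) / of_nat CARD('m))"

definition traceless_upper_tri :: "(complex^'m::{finite,wellorder}^'m::{finite,wellorder}) set" where
  "traceless_upper_tri = {V. upper_tri V \<and> trace V = 0}"

text \<open>The orthogonal projection of \<open>M\<close> onto a finite-dimensional subspace \<open>U\<close>.\<close>

definition orth_proj :: "'a::real_inner set \<Rightarrow> 'a \<Rightarrow> 'a" where
  "orth_proj U M = (THE P. P \<in> U \<and> (\<forall>V\<in>U. orthogonal (M - P) V))"

definition EUT_Lambda ::
  "(complex^'m::{finite,wellorder}^'m::{finite,wellorder} \<Rightarrow> real) \<Rightarrow> complex^'m::{finite,wellorder}^'m::{finite,wellorder} \<Rightarrow> complex^'m::{finite,wellorder}^'m::{finite,wellorder}" where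
  "EUT_Lambda g X = orth_proj traceless_upper_tri (ctranspose X ** nabla g X)"

text \<open>The Riemannian gradient of \<open>f\<close> on \<open>St \<times> SL\<close>, with its two blocks.\<close>

definition riem_grad ::
  "((complex^'m^'n) \<times> (complex^'m^'m) \<Rightarrow> real) \<Rightarrow> (complex^'m^'n) \<times> (complex^'m^'m)
     \<Rightarrow> (complex^'m^'n) \<times> (complex^'m^'m)" where
  "riem_grad f = (\<lambda>(Y, X).
     (St_grad (\<lambda>Z. f (Z, X)) Y, X ** SL_Lambda (\<lambda>Z. f (Y, Z)) X))"

definition stationary_point ::
  "((complex^'m^'n) \<times> (complex^'m^'m) \<Rightarrow> real) \<Rightarrow> (complex^'m^'n) \<times> (complex^'m^'m) \<Rightarrow> bool" where
  "stationary_point f w \<longleftrightarrow> w \<in> St \<times> SL \<and> riem_grad f w = 0"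


section \<open>The exponential map of the Stiefel manifold\<close>

definition St_tangent :: "complex^'m^'n \<Rightarrow> (complex^'m^'n) set" where
  "St_tangent Y = {V. ctranspose Y ** V + ctranspose V ** Y = 0}"

text \<open>
  A geodesic for the metric induced from the ambient matrix space is a curve on the manifold whose
  acceleration is everywhere normal to it. The manifold being compact, geodesics are defined on
  the whole real line.
\<close>

definition St_geodesic :: "(real \<Rightarrow> complex^'m^'n) \<Rightarrow> bool" where
  "St_geodesic c \<longleftrightarrow> (\<forall>t. c t \<in> St) \<and>
     (\<exists>c' c''. \<forall>t. (c has_vector_derivative c' t) (at t) \<and>
                   (c' has_vector_derivative c'' t) (at t) \<and>
                   (\<forall>V\<in>St_tangent (c t). orthogonal (c'' t) V))"

definition St_Exp :: "complex^'m^'n \<Rightarrow> complex^'m^'n \<Rightarrow> complex^'m^'n" where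
  "St_Exp Y V = (THE Z. \<exists>c. St_geodesic c \<and> c 0 = Y \<and> (c has_vector_derivative V) (at 0) \<and> Z = c 1)"

text \<open>
  \<open>D Exp\<^sub>Y(\<tau> V)[V]\<close>: the directional derivative of \<open>Exp\<^sub>Y\<close> at the tangent vector \<open>\<tau> V\<close> in the
  direction \<open>V\<close>.
\<close>

definition St_DExp :: "complex^'m^'n \<Rightarrow> real \<Rightarrow> complex^'m^'n \<Rightarrow> complex^'m^'n" where
  "St_DExp Y \<tau> V = vector_derivative (\<lambda>s. St_Exp Y (s *\<^sub>R V)) (at \<tau>)"


section \<open>Elementary functions\<close>

definition mat2 :: "complex \<Rightarrow> complex \<Rightarrow> complex \<Rightarrow> complex \<Rightarrow> complex^2^2" where
  "mat2 a b c d = vector [vector [a, b], vector [c, d]]"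

definition elem_mat :: "'m \<Rightarrow> 'm \<Rightarrow> complex^2^2 \<Rightarrow> complex^'m^'m" where
  "elem_mat i j \<Psi> = (\<chi> a b.
     if a = i \<and> b = i then \<Psi> $ 1 $ 1
     else if a = i \<and> b = j then \<Psi> $ 1 $ 2
     else if a = j \<and> b = i then \<Psi> $ 2 $ 1
     else if a = j \<and> b = j then \<Psi> $ 2 $ 2
     else if a = b then 1 else 0)"

definition \<Psi>U :: "real \<times> real \<Rightarrow> complex^2^2" where
  "\<Psi>U = (\<lambda>(x, y). mat2 1 (Complex x y) 0 1)"

definition \<Psi>L :: "real \<times> real \<Rightarrow> complex^2^2" where
  "\<Psi>L = (\<lambda>(x, y). mat2 1 0 (Complex x y) 1)"

definition \<Psi>D :: "real \<times> real \<Rightarrow> complex^2^2" where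
  "\<Psi>D = (\<lambda>(x, y). mat2 (Complex x y) 0 0 (1 / Complex x y))"

definition \<Psi>Q :: "real \<times> real \<times> real \<Rightarrow> complex^2^2" where
  "\<Psi>Q = (\<lambda>(c, s1, s2). mat2 (complex_of_real c) (- Complex s1 s2)
                              (Complex s1 (- s2)) (complex_of_real c))"

definition sphere_coords :: "real \<Rightarrow> real \<Rightarrow> real \<times> real \<times> real" where
  "sphere_coords \<theta> \<phi> = (cos \<theta>, sin \<theta> * cos \<phi>, sin \<theta> * sin \<phi>)"

text \<open>
  The gradient at \<open>q\<close> of a function on the unit sphere: the tangential part of the Euclidean
  gradient of a smooth extension \<open>h\<close>.
\<close>

definition sphere_grad :: "('a::real_inner \<Rightarrow> real) \<Rightarrow> 'a \<Rightarrow> 'a" where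
  "sphere_grad h q = nabla h q - (nabla h q \<bullet> q) *\<^sub>R q"

datatype elem_type = TU | TL | TD | TQ

text \<open>The norm of \<open>\<partial>h(I\<^sub>2)\<close>.\<close>

definition elem_grad_norm ::
  "(complex^'m^'m \<Rightarrow> real) \<Rightarrow> complex^'m^'m \<Rightarrow> 'm \<Rightarrow> 'm \<Rightarrow> elem_type \<Rightarrow> real" where
  "elem_grad_norm g X i j ty = (let h = (\<lambda>\<Psi>. g (X ** elem_mat i j \<Psi>)) in
     case ty of
       TU \<Rightarrow> norm (nabla (h \<circ> \<Psi>U) (0, 0))
     | TL \<Rightarrow> norm (nabla (h \<circ> \<Psi>L) (0, 0))
     | TD \<Rightarrow> norm (nabla (h \<circ> \<Psi>D) (1, 0))
     | TQ \<Rightarrow> norm (sphere_grad (h \<circ> \<Psi>Q) (1, 0, 0)))"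


section \<open>Choice of the elementary transformation\<close>

definition quad_argmin :: "(real \<times> real \<Rightarrow> real) \<Rightarrow> real \<times> real \<Rightarrow> bool" where
  "quad_argmin h z \<longleftrightarrow>
     (if h constant_on UNIV then z = (0, 0) else is_arg_min h (\<lambda>_. True) z)"

definition gamma :: "nat \<Rightarrow> (nat \<Rightarrow> complex^'m^'m) \<Rightarrow> 'm \<Rightarrow> 'm \<Rightarrow> 'm \<Rightarrow> real" where
  "gamma L W i j q =
     (\<Sum>l=1..L. \<Sum>p\<in>UNIV - {i, j}. (cmod (W l $ q $ p))\<^sup>2 + (cmod (W l $ p $ q))\<^sup>2)"

text \<open>The second branch is the case \<open>\<gamma>\<^sub>2 / \<gamma>\<^sub>1 = \<infinity>\<close>.\<close>

definition D_scale :: "real \<Rightarrow> real \<Rightarrow> real \<Rightarrow> real" where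
  "D_scale \<sigma>D \<gamma>1 \<gamma>2 =
     (if \<gamma>1 = 0 \<and> \<gamma>2 = 0 then 1
      else if \<gamma>1 = 0 then 2
      else let q = \<gamma>2 / \<gamma>1 in
        if q < \<sigma>D then 1/2 else if q > 1 / \<sigma>D then 2 else root 4 q)"

definition Q_vec :: "star_kind \<Rightarrow> 'm \<Rightarrow> 'm \<Rightarrow> complex^'m^'m \<Rightarrow> complex^3" where
  "Q_vec S i j W = (case S of
     Herm \<Rightarrow> vector [W$j$j - W$i$i, W$i$j + W$j$i, - \<i> * (W$i$j - W$j$i)]
   | Trans \<Rightarrow> vector [W$i$j + W$j$i, W$i$i - W$j$j, \<i> * (W$i$i + W$j$j)])"

definition Q_sign :: "star_kind \<Rightarrow> real" where
  "Q_sign S = (case S of Herm \<Rightarrow> 1 | Trans \<Rightarrow> -1)"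

definition Q_matrix ::
  "star_kind \<Rightarrow> nat \<Rightarrow> (nat \<Rightarrow> complex^'m^'m) \<Rightarrow> 'm \<Rightarrow> 'm \<Rightarrow> real^3^3" where
  "Q_matrix S L W i j = (Q_sign S / 2) *\<^sub>R
     (\<Sum>l=1..L. (\<chi> a b. Re (Q_vec S i j (W l) $ a * cnj (Q_vec S i j (W l) $ b))))"

definition r_vec :: "real \<Rightarrow> real \<Rightarrow> real^3" where
  "r_vec \<theta> \<phi> = vector [cos (2 * \<theta>), - sin (2 * \<theta>) * cos \<phi>, - sin (2 * \<theta>) * sin \<phi>]"

definition eigval :: "real^'a^'a \<Rightarrow> real \<Rightarrow> bool" where
  "eigval G \<mu> \<longleftrightarrow> (\<exists>x. x \<noteq> 0 \<and> G *v x = \<mu> *\<^sub>R x)"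

definition top_unit_eigvec :: "real^'a^'a \<Rightarrow> real^'a \<Rightarrow> bool" where
  "top_unit_eigvec G u \<longleftrightarrow> norm u = 1 \<and>
     (\<exists>\<mu>. eigval G \<mu> \<and> (\<forall>\<nu>. eigval G \<nu> \<longrightarrow> \<nu> \<le> \<mu>) \<and> G *v u = \<mu> *\<^sub>R u)"

definition Q_choice :: "real \<Rightarrow> real^3^3 \<Rightarrow> real \<Rightarrow> real \<Rightarrow> bool" where
  "Q_choice \<sigma>Q G \<theta> \<phi> \<longleftrightarrow> \<theta> \<in> {-pi/4..pi/4} \<and>
     (\<exists>u. top_unit_eigvec G u \<and> u $ 1 \<ge> 0 \<and>
       (let v = (G $ 1 $ 2, G $ 1 $ 3); w = (u $ 2, u $ 3) in
        if \<bar>v \<bullet> w\<bar> \<ge> \<sigma>Q * norm v * norm w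
        then r_vec \<theta> \<phi> = u
        else (cos \<phi>, sin \<phi>) = (1 / norm v) *\<^sub>R v \<and>
             is_arg_max (\<lambda>t. r_vec t \<phi> \<bullet> (G *v r_vec t \<phi>)) (\<lambda>t. t \<in> {-pi/4..pi/4}) \<theta>))"

text \<open>\<open>elem_choice \<dots> ty \<Psi>\<close>: \<open>\<Psi>\<close> is an admissible \<open>\<Psi>\<^sub>k\<^sup>*\<close> for the elementary function of type \<open>ty\<close>.\<close>

definition elem_choice ::
  "star_kind \<Rightarrow> nat \<Rightarrow> (nat \<Rightarrow> complex^'n^'n) \<Rightarrow> real \<Rightarrow> real \<Rightarrow> complex^'m^'n \<Rightarrow> complex^'m^'m
     \<Rightarrow> 'm \<Rightarrow> 'm \<Rightarrow> elem_type \<Rightarrow> complex^2^2 \<Rightarrow> bool" where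
  "elem_choice S L A \<sigma>D \<sigma>Q Y X i j ty \<Psi> =
    (let h = (\<lambda>\<Psi>. cost S L A (Y, X ** elem_mat i j \<Psi>));
         W = (\<lambda>l. star S X ** star S Y ** A l ** Y ** X) in
     case ty of
       TU \<Rightarrow> (\<exists>z. quad_argmin (h \<circ> \<Psi>U) z \<and> \<Psi> = \<Psi>U z)
     | TL \<Rightarrow> (\<exists>z. quad_argmin (h \<circ> \<Psi>L) z \<and> \<Psi> = \<Psi>L z)
     | TD \<Rightarrow> \<Psi> = \<Psi>D (D_scale \<sigma>D (gamma L W i j i) (gamma L W i j j), 0)
     | TQ \<Rightarrow> (\<exists>\<theta> \<phi>. Q_choice \<sigma>Q (Q_matrix S L W i j) \<theta> \<phi> \<and> \<Psi> = \<Psi>Q (sphere_coords \<theta> \<phi>)))"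


section \<open>The algorithms\<close>

datatype variant = GLU | GQU | GU

definition allowed_types :: "variant \<Rightarrow> elem_type set" where
  "allowed_types alg = (case alg of GLU \<Rightarrow> {TU, TL, TD} | GQU \<Rightarrow> {TQ, TU, TD} | GU \<Rightarrow> {TU, TD})"

definition eps_bound :: "variant \<Rightarrow> real \<Rightarrow> real" where
  "eps_bound alg m = (case alg of
     GLU \<Rightarrow> sqrt (2 / (3 * m * (m - 1)))
   | GQU \<Rightarrow> sqrt ((3 - sqrt 5) / (3 * m * (m - 1)))
   | GU \<Rightarrow> sqrt (1 / (m * (m - 1))))"

text \<open>
  The \<open>GU\<close> variant treats the second block as living on \<open>EUT\<close>, so there both \<open>\<Lambda>\<close> and the gradient
  steering the algorithm are those of \<open>EUT\<close>.
\<close>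

definition alg_Lambda ::
  "variant \<Rightarrow> (complex^'m::{finite,wellorder}^'m::{finite,wellorder} \<Rightarrow> real) \<Rightarrow> complex^'m::{finite,wellorder}^'m::{finite,wellorder} \<Rightarrow> complex^'m::{finite,wellorder}^'m::{finite,wellorder}" where
  "alg_Lambda alg g X = (case alg of GU \<Rightarrow> EUT_Lambda g X | _ \<Rightarrow> SL_Lambda g X)"

definition alg_grad ::
  "variant \<Rightarrow> ((complex^'m::{finite,wellorder}^'n) \<times> (complex^'m::{finite,wellorder}^'m::{finite,wellorder}) \<Rightarrow> real) \<Rightarrow> (complex^'m::{finite,wellorder}^'n) \<times> (complex^'m::{finite,wellorder}^'m::{finite,wellorder})
     \<Rightarrow> (complex^'m::{finite,wellorder}^'n) \<times> (complex^'m::{finite,wellorder}^'m::{finite,wellorder})" where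
  "alg_grad alg f = (\<lambda>(Y, X).
     (St_grad (\<lambda>Z. f (Z, X)) Y, X ** alg_Lambda alg (\<lambda>Z. f (Y, Z)) X))"

definition line_search ::
  "real \<Rightarrow> real \<Rightarrow> real \<Rightarrow> (complex^'m^'n \<Rightarrow> real) \<Rightarrow> complex^'m^'n \<Rightarrow> complex^'m^'n \<Rightarrow> bool" where
  "line_search \<delta>s \<delta>w \<delta>c p Y Y' \<longleftrightarrow>
     (\<exists>V \<tau>. V \<in> St_tangent Y \<and> V \<noteq> 0 \<and> \<tau> > 0 \<and> Y' = St_Exp Y (\<tau> *\<^sub>R V) \<and>
        St_grad p Y \<bullet> V \<le> - \<delta>s * norm (St_grad p Y) * norm V \<and>
        p Y' \<le> p Y + \<delta>w * \<tau> * (St_grad p Y \<bullet> V) \<and>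
        St_grad p Y' \<bullet> St_DExp Y \<tau> V \<ge> \<delta>c * (St_grad p Y \<bullet> V))"

definition elem_update ::
  "variant \<Rightarrow> star_kind \<Rightarrow> nat \<Rightarrow> (nat \<Rightarrow> complex^'n^'n) \<Rightarrow> real \<Rightarrow> real \<Rightarrow> real
     \<Rightarrow> complex^'m::{finite,wellorder}^'n \<Rightarrow> complex^'m::{finite,wellorder}^'m::{finite,wellorder} \<Rightarrow> complex^'m::{finite,wellorder}^'m::{finite,wellorder} \<Rightarrow> bool" where
  "elem_update alg S L A \<epsilon> \<sigma>D \<sigma>Q Y X X' \<longleftrightarrow>
     (let g = (\<lambda>Z. cost S L A (Y, Z)) in
      \<exists>i j ty \<Psi>. i < j \<and> ty \<in> allowed_types alg \<and>
        elem_grad_norm g X i j ty \<ge> \<epsilon> * norm (alg_Lambda alg g X) \<and>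
        elem_choice S L A \<sigma>D \<sigma>Q Y X i j ty \<Psi> \<and> X' = X ** elem_mat i j \<Psi>)"

definition bcd_step ::
  "variant \<Rightarrow> star_kind \<Rightarrow> nat \<Rightarrow> (nat \<Rightarrow> complex^'n^'n)
     \<Rightarrow> real \<Rightarrow> real \<Rightarrow> real \<Rightarrow> real \<Rightarrow> real \<Rightarrow> real \<Rightarrow> real
     \<Rightarrow> (complex^'m::{finite,wellorder}^'n) \<times> (complex^'m::{finite,wellorder}^'m::{finite,wellorder})
     \<Rightarrow> (complex^'m::{finite,wellorder}^'n) \<times> (complex^'m::{finite,wellorder}^'m::{finite,wellorder}) \<Rightarrow> bool" where
  "bcd_step alg S L A \<upsilon> \<delta>s \<delta>w \<delta>c \<epsilon> \<sigma>D \<sigma>Q w w' \<longleftrightarrow>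
    (let f = cost S L A; G = alg_grad alg f w; (Y, X) = w; (Y', X') = w' in
     if G = 0 then w' = w
     else
       (norm (fst G) \<ge> \<upsilon> * norm G \<and> X' = X \<and> line_search \<delta>s \<delta>w \<delta>c (\<lambda>Z. f (Z, X)) Y Y') \<or>
       (norm (snd G) \<ge> \<upsilon> * norm G \<and> Y' = Y \<and> elem_update alg S L A \<epsilon> \<sigma>D \<sigma>Q Y X X'))"

definition bcd_start :: "variant \<Rightarrow> ((complex^'m::{finite,wellorder}^'n) \<times> (complex^'m::{finite,wellorder}^'m::{finite,wellorder})) set" where
  "bcd_start alg = St \<times> (case alg of GU \<Rightarrow> EUT | _ \<Rightarrow> SL)"

definition bcd_iterates ::
  "variant \<Rightarrow> star_kind \<Rightarrow> nat \<Rightarrow> (nat \<Rightarrow> complex^'n^'n)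
     \<Rightarrow> real \<Rightarrow> real \<Rightarrow> real \<Rightarrow> real \<Rightarrow> real \<Rightarrow> real \<Rightarrow> real
     \<Rightarrow> (nat \<Rightarrow> (complex^'m::{finite,wellorder}^'n) \<times> (complex^'m::{finite,wellorder}^'m::{finite,wellorder})) \<Rightarrow> bool" where
  "bcd_iterates alg S L A \<upsilon> \<delta>s \<delta>w \<delta>c \<epsilon> \<sigma>D \<sigma>Q \<omega> \<longleftrightarrow> \<omega> 0 \<in> bcd_start alg \<and>
     (\<forall>k\<ge>1. bcd_step alg S L A \<upsilon> \<delta>s \<delta>w \<delta>c \<epsilon> \<sigma>D \<sigma>Q (\<omega> (k - 1)) (\<omega> k))"

definition accumulation_point :: "(nat \<Rightarrow> 'a::topological_space) \<Rightarrow> 'a \<Rightarrow> bool" where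
  "accumulation_point x a \<longleftrightarrow> (\<exists>r. strict_mono r \<and> (x \<circ> r) \<longlonglongrightarrow> a)"

end

theory Submission
  imports Defs
begin

text \<open>
  The cost depends on \<open>Y X\<close> only: it is the quartic form \<open>F(Z) = \<Sum>\<^sub>l \<parallel>B\<^sub>l(Z, Z)\<parallel>\<^sup>2\<close> at \<open>Z = Y X\<close>, with
  \<open>B\<^sub>l\<close> bounded bilinear, so its gradient is Lipschitz on balls. On a bounded set every step therefore
  decreases the cost by at least a constant times the squared norm of the gradient steering the
  algorithm. For a line search this is Zoutendijk's argument along the geodesic, whose velocity has
  constant norm and whose acceleration is quadratic in that norm. For types \<open>U\<close> and \<open>L\<close> it is the
  minimization of a quadratic; for type \<open>D\<close> the elementary function is
  \<open>C + \<gamma>\<^sub>1 |z|\<^sup>2 + \<gamma>\<^sub>2 / |z|\<^sup>2\<close>; for type \<open>Q\<close> it is minus a quadratic form on the sphere, and both choices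
  do at least as well as every rotation of angle at most \<open>\<pi>/4\<close> in the direction \<open>v\<close>. As the cost is
  nonnegative, the gradients tend to \<open>0\<close>, and by continuity the gradient vanishes at an accumulation
  point. For \<open>GU\<close> this only says that the derivative vanishes along upper triangular directions of \<open>X\<close>;
  stationarity in \<open>Y\<close> covers the directions \<open>\<Omega> X\<close> with \<open>\<Omega>\<close> skew-Hermitian, and together these span the
  tangent space of \<open>SL\<close>.
\<close>

section \<open>The cost as a quartic form\<close>

text \<open>\<open>nabla\<close>, \<open>orth_proj\<close> and \<open>St_Exp\<close> are definite
  descriptions, so each has to be identified before anything can be estimated. The burden is
  heaviest for \<open>St_Exp\<close>: geodesics must exist for all times and be unique, and
  \<open>St_Exp\<close> must be known along a whole ray in order to be differentiated there.

  The decrease must also be uniform. Every descent lemma therefore fixes its constant from a radius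
  and the parameters of the algorithm, before the point is given. For the second block three
  quantities have to be linked: an elementary gradient in a few real parameters, which controls the
  decrease; the matrix \<Lambda>, which the selection rule compares with it; and
  \<open>X ** \<Lambda>\<close>, which is the block of the gradient.

  The prescribed update for type \<open>D\<close> is a minimizer clipped to a fixed range, and for
  types \<open>U\<close> and \<open>L\<close> the minimizer is not computed. So the former is
  estimated case by case from the explicit formula, while the latter is compared with a trial step
  whose decrease is known.\<close>

lemma bilinear_matrix_mult:
  "bilinear ((**) :: complex^'b^'a \<Rightarrow> complex^'c^'b \<Rightarrow> complex^'c^'a)"
  unfolding bilinear_def
  by (auto intro!: linearI simp: vec_eq_iff matrix_matrix_mult_def algebra_simps sum.distrib
      scaleR_sum_right)

interpretation matmul: bounded_bilinear
  "(**) :: complex^'b^'a \<Rightarrow> complex^'c^'b \<Rightarrow> complex^'c^'a"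
  using bilinear_matrix_mult bilinear_conv_bounded_bilinear by blast

lemma ctranspose_nth [simp]: "ctranspose M $ i $ j = cnj (M $ j $ i)"
  by (simp add: ctranspose_def map_matrix_def transpose_def)

lemma ctranspose_mult: "ctranspose (M ** N) = ctranspose N ** ctranspose M"
  by (simp add: vec_eq_iff matrix_matrix_mult_def cnj_sum mult.commute)

lemma ctranspose_ctranspose [simp]: "ctranspose (ctranspose M) = M"
  by (simp add: vec_eq_iff)

lemma ctranspose_mat_1 [simp]: "ctranspose (mat 1) = mat 1"
  by (simp add: vec_eq_iff mat_def)

lemma bounded_linear_ctranspose: "bounded_linear (ctranspose :: complex^'a^'b \<Rightarrow> complex^'b^'a)"
  by (rule linear_conv_bounded_linear[THEN iffD1])
     (auto intro!: linearI simp: vec_eq_iff)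

lemma star_nth: "star S M $ i $ j = (case S of Trans \<Rightarrow> M $ j $ i | Herm \<Rightarrow> cnj (M $ j $ i))"
  by (cases S) (simp_all add: star_def transpose_def)

lemma star_mult: "star S (M ** N) = star S N ** star S M"
  by (cases S) (simp_all add: star_def matrix_transpose_mul ctranspose_mult)

lemma bounded_linear_star: "bounded_linear (star S :: complex^'a^'b \<Rightarrow> complex^'b^'a)"
  by (rule linear_conv_bounded_linear[THEN iffD1])
     (auto intro!: linearI simp: vec_eq_iff star_nth split: star_kind.split)

lemma bounded_linear_offdiag: "bounded_linear (offdiag :: complex^'a^'a \<Rightarrow> complex^'a^'a)"
  by (rule linear_conv_bounded_linear[THEN iffD1])
     (auto intro!: linearI simp: vec_eq_iff offdiag_def)

lemmas ctranspose_add = bounded_linear.linear[OF bounded_linear_ctranspose, THEN linear_add]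
lemmas ctranspose_diff = bounded_linear.linear[OF bounded_linear_ctranspose, THEN linear_diff]
lemmas ctranspose_minus = bounded_linear.linear[OF bounded_linear_ctranspose, THEN linear_neg]
lemmas ctranspose_scaleR = bounded_linear.linear[OF bounded_linear_ctranspose, THEN linear_scale]
lemmas star_add = bounded_linear.linear[OF bounded_linear_star, THEN linear_add]
lemmas star_scaleR = bounded_linear.linear[OF bounded_linear_star, THEN linear_scale]
lemmas offdiag_add = bounded_linear.linear[OF bounded_linear_offdiag, THEN linear_add]
lemmas offdiag_scaleR = bounded_linear.linear[OF bounded_linear_offdiag, THEN linear_scale]

section \<open>The real trace form and the Frobenius norm\<close>

lemma inner_matrix: "(M :: complex^'a^'b) \<bullet> N = Re (\<Sum>i\<in>UNIV. \<Sum>j\<in>UNIV. cnj (M $ i $ j) * N $ i $ j)"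
  by (simp add: inner_vec_def inner_complex_def algebra_simps)

lemma inner_ctranspose: "ctranspose M \<bullet> ctranspose N = M \<bullet> N"
  unfolding inner_vec_def
  by (subst sum.swap) (simp add: inner_complex_def)

text \<open>The adjoint of left multiplication for the real trace form. Together with its mirror
  image below it converts the gradient in the product \<open>Y ** X\<close> into the gradients in
  the two factors.\<close>

lemma inner_mult_left: "(M ** N) \<bullet> K = N \<bullet> (ctranspose M ** K)"
proof -
  let ?f = "\<lambda>i j k. cnj (M $ i $ k) * cnj (N $ k $ j) * K $ i $ j"
  have "(\<Sum>i\<in>UNIV. \<Sum>j\<in>UNIV. cnj ((M ** N) $ i $ j) * K $ i $ j)
      = (\<Sum>i\<in>UNIV. \<Sum>j\<in>UNIV. \<Sum>k\<in>UNIV. ?f i j k)"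
    by (simp add: matrix_matrix_mult_def sum_distrib_right)
  also have "\<dots> = (\<Sum>i\<in>UNIV. \<Sum>k\<in>UNIV. \<Sum>j\<in>UNIV. ?f i j k)"
    by (rule sum.cong[OF refl sum.swap])
  also have "\<dots> = (\<Sum>k\<in>UNIV. \<Sum>i\<in>UNIV. \<Sum>j\<in>UNIV. ?f i j k)"
    by (rule sum.swap)
  also have "\<dots> = (\<Sum>k\<in>UNIV. \<Sum>j\<in>UNIV. \<Sum>i\<in>UNIV. ?f i j k)"
    by (rule sum.cong[OF refl sum.swap])
  also have "\<dots> = (\<Sum>k\<in>UNIV. \<Sum>j\<in>UNIV. cnj (N $ k $ j) * (ctranspose M ** K) $ k $ j)"
    by (simp add: matrix_matrix_mult_def sum_distrib_left mult_ac)
  finally show ?thesis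
    unfolding inner_matrix by (rule arg_cong[where f = Re])
qed

lemma inner_mult_right: "(M ** N) \<bullet> K = M \<bullet> (K ** ctranspose N)"
proof -
  have "(M ** N) \<bullet> K = (ctranspose N ** ctranspose M) \<bullet> ctranspose K"
    by (simp only: inner_ctranspose flip: ctranspose_mult)
  also have "\<dots> = ctranspose M \<bullet> ctranspose (K ** ctranspose N)"
    by (simp only: inner_mult_left ctranspose_mult)
  finally show ?thesis by (simp only: inner_ctranspose)
qed

text \<open>Cauchy-Schwarz bounds each entry by a row norm times a column norm, and the squares of
  these bounds sum to a product. The constant 1 keeps the later estimates explicit.\<close>

lemma norm_matrix_mult_le: "norm (M ** (N :: complex^'c^'b)) \<le> norm M * norm N"
proof -
  have F: "norm (K :: complex^'x^'y) ^ 2 = (\<Sum>i\<in>UNIV. \<Sum>k\<in>UNIV. (cmod (K $ i $ k))\<^sup>2)" for K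
    by (simp add: norm_vec_def L2_set_def sum_nonneg)
  have e: "(cmod ((M ** N) $ i $ j))\<^sup>2 \<le> (\<Sum>k\<in>UNIV. (cmod (M $ i $ k))\<^sup>2) * (\<Sum>k\<in>UNIV. (cmod (N $ k $ j))\<^sup>2)" for i j
  proof -
    have "cmod ((M ** N) $ i $ j) \<le> (\<Sum>k\<in>UNIV. \<bar>cmod (M $ i $ k)\<bar> * \<bar>cmod (N $ k $ j)\<bar>)"
      unfolding matrix_matrix_mult_def by (simp add: sum_norm_le norm_mult)
    also have "\<dots> \<le> L2_set (\<lambda>k. cmod (M $ i $ k)) UNIV * L2_set (\<lambda>k. cmod (N $ k $ j)) UNIV"
      by (rule L2_set_mult_ineq)
    finally have "(cmod ((M ** N) $ i $ j))\<^sup>2 \<le>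
        (L2_set (\<lambda>k. cmod (M $ i $ k)) UNIV * L2_set (\<lambda>k. cmod (N $ k $ j)) UNIV)\<^sup>2"
      by (rule power_mono) simp
    then show ?thesis
      by (simp add: L2_set_def power_mult_distrib sum_nonneg)
  qed
  have "norm (M ** N) ^ 2 \<le> (\<Sum>i\<in>UNIV. \<Sum>j\<in>UNIV. (\<Sum>k\<in>UNIV. (cmod (M $ i $ k))\<^sup>2) * (\<Sum>k\<in>UNIV. (cmod (N $ k $ j))\<^sup>2))"
    unfolding F by (intro sum_mono e)
  also have "\<dots> = (\<Sum>i\<in>UNIV. \<Sum>k\<in>UNIV. (cmod (M $ i $ k))\<^sup>2) * (\<Sum>j\<in>UNIV. \<Sum>k\<in>UNIV. (cmod (N $ k $ j))\<^sup>2)"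
    by (simp add: sum_product)
  also have "(\<Sum>j\<in>UNIV. \<Sum>k\<in>UNIV. (cmod (N $ k $ j))\<^sup>2) = norm N ^ 2"
    unfolding F by (rule sum.swap)
  finally have "norm (M ** N) ^ 2 \<le> (norm M * norm N)\<^sup>2"
    by (simp add: F power_mult_distrib)
  then show ?thesis
    by (rule power2_le_imp_le) simp
qed

lemma norm_ctranspose [simp]: "norm (ctranspose M) = norm M"
  by (simp add: norm_eq_sqrt_inner inner_ctranspose)

text \<open>Derivatives are unique, and testing two representing vectors on their difference shows
  that they agree. This resolves the definite description in \<open>nabla\<close>.\<close>

lemma nabla_eqI: "GDERIV h z :> D \<Longrightarrow> nabla h z = D"
  unfolding nabla_def
proof (rule the_equality)
  fix E assume *: "GDERIV h z :> D" "GDERIV h z :> E"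
  then have "(\<lambda>x. x \<bullet> D) = (\<lambda>x. x \<bullet> E)"
    unfolding gderiv_def by (rule has_derivative_unique)
  then have "(E - D) \<bullet> D = (E - D) \<bullet> E" by (rule fun_cong)
  then have "(E - D) \<bullet> (E - D) = 0" by (simp add: inner_diff_right)
  then show "E = D" by simp
qed

text \<open>Polarizes one summand of the cost. For \<open>Herm\<close> it is conjugate-linear in the
  first argument, so bilinearity common to both kinds is over the reals.\<close>

definition cost_form :: "star_kind \<Rightarrow> complex^'n^'n \<Rightarrow> complex^'m^'n \<Rightarrow> complex^'m^'n \<Rightarrow> complex^'m^'m"
  where "cost_form S A Z Z' = offdiag (star S Z ** A ** Z')"

interpretation cost_form: bounded_bilinear
  "cost_form S A :: complex^'m^'n \<Rightarrow> complex^'m^'n \<Rightarrow> complex^'m^'m"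
  apply (rule bilinear_conv_bounded_bilinear[THEN iffD1])
  unfolding bilinear_def
  by (auto intro!: linearI simp: cost_form_def star_add star_scaleR offdiag_add offdiag_scaleR
      matmul.add_left matmul.add_right matmul.scaleR_left matmul.scaleR_right)

definition quartic :: "star_kind \<Rightarrow> nat \<Rightarrow> (nat \<Rightarrow> complex^'n^'n) \<Rightarrow> complex^'m^'n \<Rightarrow> real"
  where "quartic S L A Z = (\<Sum>l=1..L. (norm (cost_form S (A l) Z Z))\<^sup>2)"

lemma cost_eq_quartic: "cost S L A (Y, X) = quartic S L A (Y ** X)"
  by (simp add: cost_def quartic_def cost_form_def)

lemma quartic_nonneg: "0 \<le> quartic S L A Z"
  by (simp add: quartic_def sum_nonneg)

definition quartic_deriv ::
  "star_kind \<Rightarrow> nat \<Rightarrow> (nat \<Rightarrow> complex^'n^'n) \<Rightarrow> complex^'m^'n \<Rightarrow> complex^'m^'n \<Rightarrow> real"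
  where "quartic_deriv S L A Z H =
    (\<Sum>l=1..L. 2 * (cost_form S (A l) Z Z \<bullet> (cost_form S (A l) Z H + cost_form S (A l) H Z)))"

text \<open>The Riesz representative of the derivative, obtained by applying the adjoint of a real
  functional to 1.\<close>

definition quartic_grad ::
  "star_kind \<Rightarrow> nat \<Rightarrow> (nat \<Rightarrow> complex^'n^'n) \<Rightarrow> complex^'m^'n \<Rightarrow> complex^'m^'n"
  where "quartic_grad S L A Z = adjoint (quartic_deriv S L A Z) 1"

lemma linear_quartic_deriv: "linear (quartic_deriv S L A Z)"
  by (rule linearI)
     (simp_all add: quartic_deriv_def cost_form.add_left cost_form.add_right inner_add_right
      cost_form.scaleR_left cost_form.scaleR_right sum.distrib sum_distrib_left algebra_simps)

lemma inner_quartic_grad: "H \<bullet> quartic_grad S L A Z = quartic_deriv S L A Z H"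
  unfolding quartic_grad_def by (simp add: adjoint_works[OF linear_quartic_deriv])

lemma has_derivative_quartic: "(quartic S L A has_derivative quartic_deriv S L A Z) (at Z)"
proof -
  have "((\<lambda>Z. cost_form S (A l) Z Z) has_derivative (\<lambda>H. cost_form S (A l) Z H + cost_form S (A l) H Z)) (at Z)" for l
    by (rule cost_form.FDERIV[OF has_derivative_ident has_derivative_ident])
  from has_derivative_inner[OF this this]
  have "((\<lambda>Z. cost_form S (A l) Z Z \<bullet> cost_form S (A l) Z Z) has_derivative
    (\<lambda>H. 2 * (cost_form S (A l) Z Z \<bullet> (cost_form S (A l) Z H + cost_form S (A l) H Z)))) (at Z)" for l
    by (rule has_derivative_eq_rhs) (auto simp: inner_commute fun_eq_iff)
  then show ?thesis
    unfolding quartic_def[abs_def] quartic_deriv_def[abs_def] power2_norm_eq_inner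
    by (intro has_derivative_sum) auto
qed

text \<open>The derivative is cubic in the point and linear in \<open>H\<close>. Replacing
  \<open>Z\<close> by \<open>Z'\<close> one argument at a time leaves a factor \<open>Z - Z'\<close>
  in each term; the other factors are bounded on the ball.\<close>

lemma quartic_deriv_lipschitz:
  fixes A :: "nat \<Rightarrow> complex^'n^'n"
  assumes "0 \<le> R"
  obtains K where "K > 0" "\<And>Z Z' H :: complex^'m^'n. norm Z \<le> R \<Longrightarrow> norm Z' \<le> R \<Longrightarrow>
    \<bar>quartic_deriv S L A Z H - quartic_deriv S L A Z' H\<bar> \<le> K * norm (Z - Z') * norm H"
proof -
  let ?B = "\<lambda>l. cost_form S (A l) :: complex^'m^'n \<Rightarrow> complex^'m^'n \<Rightarrow> complex^'m^'m"
  have "\<forall>l. \<exists>b>0. \<forall>x y. norm (?B l x y) \<le> norm x * norm y * b"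
    using cost_form.pos_bounded by blast
  then obtain b where b: "\<And>l. b l > 0" "\<And>l x y. norm (?B l x y) \<le> norm x * norm y * b l"
    by metis
  \<comment> \<open>The 12 is 8 + 4: in the splitting below, the first product contributes
    \<open>2 * (2 * 2)\<close> and the second \<open>2 * (1 * 2)\<close>. The added 1 keeps
    \<open>K\<close> positive.\<close>
  define K where "K = (\<Sum>l=1..L. 12 * (b l)\<^sup>2 * R\<^sup>2) + 1"
  have K: "K > 0" unfolding K_def by (intro add_nonneg_pos sum_nonneg) auto
  have "\<bar>quartic_deriv S L A Z H - quartic_deriv S L A Z' H\<bar> \<le> K * norm (Z - Z') * norm H"
    if Z: "norm Z \<le> R" and Z': "norm Z' \<le> R" for Z Z' H :: "complex^'m^'n"
  proof -
    let ?d = "norm (Z - Z')"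
    define T where "T l W = ?B l W H + ?B l H W" for l W
    have T: "norm (T l W) \<le> 2 * b l * norm W * norm H" for l W
      using norm_triangle_le[OF add_mono[OF b(2)[of l W H] b(2)[of l H W]]]
      by (simp add: T_def algebra_simps)
    have summand: "\<bar>2 * (?B l Z Z \<bullet> T l Z) - 2 * (?B l Z' Z' \<bullet> T l Z')\<bar> \<le> 12 * (b l)\<^sup>2 * R\<^sup>2 * ?d * norm H" for l
    proof -
      have 1: "2 * (?B l Z Z \<bullet> T l Z) - 2 * (?B l Z' Z' \<bullet> T l Z') =
        2 * ((?B l (Z - Z') Z + ?B l Z' (Z - Z')) \<bullet> T l Z) + 2 * (?B l Z' Z' \<bullet> T l (Z - Z'))"
        by (simp add: T_def cost_form.diff_left cost_form.diff_right inner_add_left inner_add_right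
            inner_diff_left inner_diff_right algebra_simps)
      have "norm (?B l (Z - Z') Z + ?B l Z' (Z - Z')) \<le> ?d * norm Z * b l + norm Z' * ?d * b l"
        using norm_triangle_le[OF add_mono[OF b(2) b(2)]] by blast
      also have "\<dots> \<le> ?d * R * b l + R * ?d * b l"
        using Z Z' b(1)[of l] by (intro add_mono mult_right_mono mult_left_mono) auto
      finally have 2: "norm (?B l (Z - Z') Z + ?B l Z' (Z - Z')) \<le> 2 * b l * R * ?d" by (simp add: algebra_simps)
      have 3: "norm (T l Z) \<le> 2 * b l * R * norm H"
        using T[of l Z] Z b(1)[of l] by (smt (verit) mult_left_mono mult_right_mono norm_ge_zero)
      have 4: "norm (?B l Z' Z') \<le> R * R * b l"
        using b(2)[of l Z' Z'] Z' b(1)[of l] assms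
        by (smt (verit) mult_mono mult_right_mono norm_ge_zero)
      have "\<bar>(?B l (Z - Z') Z + ?B l Z' (Z - Z')) \<bullet> T l Z\<bar> \<le> (2 * b l * R * ?d) * (2 * b l * R * norm H)"
        by (rule order_trans[OF Cauchy_Schwarz_ineq2 mult_mono[OF 2 3]]) (use assms b(1)[of l] in auto)
      moreover have "\<bar>?B l Z' Z' \<bullet> T l (Z - Z')\<bar> \<le> (R * R * b l) * (2 * b l * ?d * norm H)"
        by (rule order_trans[OF Cauchy_Schwarz_ineq2 mult_mono[OF 4 T]]) (use assms b(1)[of l] in auto)
      ultimately show ?thesis unfolding 1 by (simp add: algebra_simps power2_eq_square abs_le_iff)
    qed
    have "\<bar>quartic_deriv S L A Z H - quartic_deriv S L A Z' H\<bar> =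
      \<bar>\<Sum>l=1..L. 2 * (?B l Z Z \<bullet> T l Z) - 2 * (?B l Z' Z' \<bullet> T l Z')\<bar>"
      by (simp add: quartic_deriv_def T_def sum_subtractf)
    also have "\<dots> \<le> (\<Sum>l=1..L. 12 * (b l)\<^sup>2 * R\<^sup>2 * ?d * norm H)"
      by (intro order_trans[OF sum_abs] sum_mono summand)
    also have "\<dots> \<le> K * ?d * norm H"
      by (simp add: K_def algebra_simps sum_distrib_left sum_distrib_right)
    finally show ?thesis .
  qed
  with K that show ?thesis by blast
qed

text \<open>Mean value theorem on the segment from \<open>Z\<close> to \<open>Z + H\<close>. The
  segment stays in the ball of radius \<open>2 * R\<close>, whose Lipschitz constant controls the
  remainder.\<close>

lemma quartic_taylor:
  fixes A :: "nat \<Rightarrow> complex^'n^'n"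
  assumes "0 \<le> R"
  obtains K where "K > 0" "\<And>Z H :: complex^'m^'n. norm Z \<le> R \<Longrightarrow> norm H \<le> R \<Longrightarrow>
    quartic S L A (Z + H) \<le> quartic S L A Z + quartic_deriv S L A Z H + K * (norm H)\<^sup>2"
proof -
  obtain K where K: "K > 0" "\<And>Z Z' H :: complex^'m^'n. norm Z \<le> 2 * R \<Longrightarrow> norm Z' \<le> 2 * R \<Longrightarrow>
    \<bar>quartic_deriv S L A Z H - quartic_deriv S L A Z' H\<bar> \<le> K * norm (Z - Z') * norm H"
    by (rule quartic_deriv_lipschitz[of "2 * R"]) (use assms in auto)
  show ?thesis
  proof (rule that[OF K(1)])
    fix Z H :: "complex^'m^'n" assume ZH: "norm Z \<le> R" "norm H \<le> R"
    have "((\<lambda>t. quartic S L A (Z + t *\<^sub>R H)) has_derivative (\<lambda>s. quartic_deriv S L A (Z + t *\<^sub>R H) (s *\<^sub>R H))) (at t within {0..1})" for t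
      by (rule has_derivative_compose[OF _ has_derivative_quartic]) (auto intro!: derivative_eq_intros)
    then obtain t where t: "t \<in> {0<..<1}" "quartic S L A (Z + 1 *\<^sub>R H) - quartic S L A (Z + 0 *\<^sub>R H) =
        quartic_deriv S L A (Z + t *\<^sub>R H) ((1 - 0) *\<^sub>R H)"
      using mvt_simple[of 0 1 "\<lambda>t. quartic S L A (Z + t *\<^sub>R H)" "\<lambda>t s. quartic_deriv S L A (Z + t *\<^sub>R H) (s *\<^sub>R H)"]
      by (auto simp del: scaleR_one)
    have tH: "norm (t *\<^sub>R H) \<le> norm H" using t by (simp add: mult_left_le_one_le)
    have "\<bar>quartic_deriv S L A (Z + t *\<^sub>R H) H - quartic_deriv S L A Z H\<bar> \<le> K * norm ((Z + t *\<^sub>R H) - Z) * norm H"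
      using ZH tH norm_triangle_ineq[of Z "t *\<^sub>R H"] assms by (intro K(2)) linarith+
    also have "\<dots> \<le> K * norm H * norm H"
      using K(1) tH by (intro mult_right_mono mult_left_mono) auto
    finally show "quartic S L A (Z + H) \<le> quartic S L A Z + quartic_deriv S L A Z H + K * (norm H)\<^sup>2"
      using t(2) by (simp add: power2_eq_square)
  qed
qed

text \<open>Taking for \<open>H\<close> the difference of two gradients in the Lipschitz bound of
  the derivative bounds the norm of that difference.\<close>

lemma isCont_quartic_grad: "isCont (quartic_grad S L A) (Z :: complex^'m^'n)"
proof -
  define R where "R = norm Z + 1"
  obtain K where K: "K > 0" "\<And>Z Z' H :: complex^'m^'n. norm Z \<le> R \<Longrightarrow> norm Z' \<le> R \<Longrightarrow>
    \<bar>quartic_deriv S L A Z H - quartic_deriv S L A Z' H\<bar> \<le> K * norm (Z - Z') * norm H"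
    by (rule quartic_deriv_lipschitz[of R]) (auto simp: R_def)
  have lip: "norm (quartic_grad S L A Z' - quartic_grad S L A Z) \<le> K * norm (Z' - Z)" if "norm (Z' - Z) < 1" for Z'
  proof -
    let ?D = "quartic_grad S L A Z' - quartic_grad S L A Z"
    have "norm Z' \<le> R" using that norm_triangle_sub[of Z' Z] by (simp add: R_def)
    have "norm ?D * norm ?D = ?D \<bullet> quartic_grad S L A Z' - ?D \<bullet> quartic_grad S L A Z"
      by (simp add: inner_diff_right power2_norm_eq_inner flip: power2_eq_square)
    also have "\<dots> \<le> K * norm (Z' - Z) * norm ?D"
      unfolding inner_quartic_grad
      by (rule order_trans[OF abs_ge_self K(2)]) (use \<open>norm Z' \<le> R\<close> in \<open>auto simp: R_def\<close>)
    finally show ?thesis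
      by (cases "?D = 0") (use K(1) in \<open>auto simp: mult_le_cancel_right\<close>)
  qed
  have "((\<lambda>Z'. quartic_grad S L A Z' - quartic_grad S L A Z) \<longlongrightarrow> 0) (at Z)"
  proof (rule Lim_null_comparison)
    show "\<forall>\<^sub>F x in at Z. norm (quartic_grad S L A x - quartic_grad S L A Z) \<le> K * norm (x - Z)"
      unfolding eventually_at using lip by (intro exI[of _ 1]) (auto simp: dist_norm)
    show "((\<lambda>x. K * norm (x - Z)) \<longlongrightarrow> 0) (at Z)"
      by (rule tendsto_eq_intros refl | simp)+
  qed
  then show ?thesis unfolding isCont_def by (simp add: LIM_zero_iff)
qed

lemma nabla_cost_fst: "nabla (\<lambda>Z. cost S L A (Z, X)) Y = quartic_grad S L A (Y ** X) ** ctranspose X"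
proof (rule nabla_eqI)
  have "((\<lambda>Z. quartic S L A (Z ** X)) has_derivative (\<lambda>H. quartic_deriv S L A (Y ** X) (H ** X))) (at Y)"
    by (rule has_derivative_compose[OF _ has_derivative_quartic])
       (rule bounded_linear_imp_has_derivative[OF matmul.bounded_linear_left])
  then show "GDERIV (\<lambda>Z. cost S L A (Z, X)) Y :> quartic_grad S L A (Y ** X) ** ctranspose X"
    unfolding gderiv_def cost_eq_quartic by (simp add: inner_quartic_grad flip: inner_mult_right)
qed

lemma nabla_cost_snd: "nabla (\<lambda>Z. cost S L A (Y, Z)) X = ctranspose Y ** quartic_grad S L A (Y ** X)"
proof (rule nabla_eqI)
  have "((\<lambda>Z. quartic S L A (Y ** Z)) has_derivative (\<lambda>H. quartic_deriv S L A (Y ** X) (Y ** H))) (at X)"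
    by (rule has_derivative_compose[OF _ has_derivative_quartic])
       (rule bounded_linear_imp_has_derivative[OF matmul.bounded_linear_right])
  then show "GDERIV (\<lambda>Z. cost S L A (Y, Z)) X :> ctranspose Y ** quartic_grad S L A (Y ** X)"
    unfolding gderiv_def cost_eq_quartic by (simp add: inner_quartic_grad flip: inner_mult_left)
qed

section \<open>Geodesics of the Stiefel manifold\<close>

lemmas matmul_simps = matmul.add_left matmul.add_right matmul.diff_left matmul.diff_right
  matmul.minus_left matmul.minus_right matmul.scaleR_left matmul.scaleR_right
  matrix_mul_assoc[symmetric] ctranspose_mult ctranspose_add ctranspose_diff ctranspose_minus
  ctranspose_scaleR

text \<open>Gronwall on both sides of 0: the squared norm times \<open>exp (- 2 * K * t)\<close> is
  nonincreasing for \<open>t \<ge> 0\<close>, and times \<open>exp (2 * K * t)\<close> it is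
  nondecreasing for \<open>t \<le> 0\<close>. The case \<open>K = 0\<close> gives conserved
  quantities.\<close>

lemma zero_of_vector_derivative_bound:
  fixes w :: "real \<Rightarrow> 'a::real_inner"
  assumes der: "\<And>t. (w has_vector_derivative w' t) (at t)"
    and bound: "\<And>t. norm (w' t) \<le> K * norm (w t)"
    and "w 0 = 0"
  shows "w t = 0"
proof -
  have ww: "((\<lambda>t. w t \<bullet> w t) has_real_derivative 2 * (w t \<bullet> w' t)) (at t)" for t
    using bounded_bilinear.has_vector_derivative[OF bounded_bilinear_inner der der, of t]
    by (simp add: has_real_derivative_iff_has_vector_derivative inner_commute)
  have cs: "\<bar>w t \<bullet> w' t\<bar> \<le> K * (w t \<bullet> w t)" for t
  proof -
    have "\<bar>w t \<bullet> w' t\<bar> \<le> norm (w t) * norm (w' t)" by (rule Cauchy_Schwarz_ineq2)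
    also have "\<dots> \<le> norm (w t) * (K * norm (w t))" by (intro mult_left_mono bound) auto
    finally show ?thesis by (simp add: power2_norm_eq_inner[symmetric] power2_eq_square algebra_simps)
  qed
  define \<phi> where "\<phi> c t = exp (c * t) * (w t \<bullet> w t)" for c t
  have \<phi>: "(\<phi> c has_real_derivative exp (c * t) * (2 * (w t \<bullet> w' t) + c * (w t \<bullet> w t))) (at t)" for c t
    unfolding \<phi>_def[abs_def] by (auto intro!: derivative_eq_intros ww simp: algebra_simps)
  have "w t \<bullet> w t \<le> 0"
  proof (cases "t \<ge> 0")
    case True
    have "\<phi> (- 2 * K) t \<le> \<phi> (- 2 * K) 0"
    proof (rule DERIV_nonpos_imp_nonincreasing[OF True, where f = "\<phi> (- 2 * K)"])
      fix s
      show "\<exists>y. (\<phi> (- 2 * K) has_real_derivative y) (at s) \<and> y \<le> 0"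
        using cs[of s] by (intro exI[of _ "exp (-2 * K * s) * (2 * (w s \<bullet> w' s) + (-2 * K) * (w s \<bullet> w s))"]
            conjI \<phi> mult_nonneg_nonpos) auto
    qed
    then show ?thesis using \<open>w 0 = 0\<close> by (simp add: \<phi>_def mult_le_0_iff)
  next
    case False
    have "\<phi> (2 * K) t \<le> \<phi> (2 * K) 0"
    proof (rule DERIV_nonneg_imp_nondecreasing[where f = "\<phi> (2 * K)"])
      show "t \<le> 0" using False by simp
      fix s
      show "\<exists>y. (\<phi> (2 * K) has_real_derivative y) (at s) \<and> 0 \<le> y"
        using cs[of s] by (intro exI[of _ "exp (2 * K * s) * (2 * (w s \<bullet> w' s) + (2 * K) * (w s \<bullet> w s))"]
            conjI \<phi> mult_nonneg_nonneg) auto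
    qed
    then show ?thesis using \<open>w 0 = 0\<close> by (simp add: \<phi>_def mult_le_0_iff)
  qed
  then show ?thesis by (metis inner_ge_zero inner_eq_zero_iff order_antisym)
qed

text \<open>The exponential series of \<open>B\<close>, applied to \<open>x\<close>. Each coordinate
  is a real power series and may be differentiated termwise; the index shift of its coefficients
  supplies the additional factor \<open>B\<close>.\<close>

lemma linear_ode_exists:
  fixes B :: "'a::euclidean_space \<Rightarrow> 'a"
  assumes B: "bounded_linear B"
  obtains u where "u 0 = x" "\<And>t. (u has_vector_derivative B (u t)) (at t)"
proof -
  interpret B: bounded_linear B by (rule B)
  obtain K where K: "K > 0" "\<And>x. norm (B x) \<le> norm x * K" using B.pos_bounded by blast
  have pw: "norm ((B ^^ n) x) \<le> K ^ n * norm x" for n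
  proof (induction n)
    case (Suc n)
    have "norm ((B ^^ Suc n) x) \<le> norm ((B ^^ n) x) * K" using K(2) by simp
    also have "\<dots> \<le> K ^ n * norm x * K" using Suc K(1) by (intro mult_right_mono) auto
    finally show ?case by (simp add: mult_ac)
  qed simp
  have "summable (\<lambda>n. norm ((t ^ n / fact n) *\<^sub>R (B ^^ n) x))" for t
  proof (rule summable_comparison_test')
    show "summable (\<lambda>n. norm x * (inverse (fact n) * (\<bar>t\<bar> * K) ^ n))"
      by (intro summable_mult summable_exp)
    fix n :: nat
    show "norm (norm ((t ^ n / fact n) *\<^sub>R (B ^^ n) x)) \<le> norm x * (inverse (fact n) * (\<bar>t\<bar> * K) ^ n)"
      using mult_left_mono[OF pw[of n], of "\<bar>t\<bar> ^ n * inverse (fact n)"]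
      by (simp add: power_mult_distrib divide_inverse mult_ac abs_mult power_abs)
  qed
  then have sm: "summable (\<lambda>n. (t ^ n / fact n) *\<^sub>R (B ^^ n) x)" for t
    by (rule summable_norm_cancel)
  define u where "u t = (\<Sum>n. (t ^ n / fact n) *\<^sub>R (B ^^ n) x)" for t
  have "((\<lambda>t. u t \<bullet> b) has_real_derivative B (u t) \<bullet> b) (at t)" for b t
  proof -
    define c where "c n = ((B ^^ n) x \<bullet> b) / fact n" for n
    have u_b: "u t \<bullet> b = (\<Sum>n. c n * t ^ n)" and sc: "summable (\<lambda>n. c n * t ^ n)" for t
      using bounded_linear.suminf[OF bounded_linear_inner_left[of b] sm[of t]]
        bounded_linear.summable[OF bounded_linear_inner_left[of b] sm[of t]]
      by (simp_all add: u_def c_def mult_ac)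
    have diffs: "diffs c n = (B ((B ^^ n) x) \<bullet> b) / fact n" for n
    proof -
      have "real (Suc n) * inverse (real (Suc n)) = 1" by (rule right_inverse) simp
      then show ?thesis by (simp add: diffs_def c_def divide_inverse del: of_nat_Suc)
    qed
    have "(\<Sum>n. diffs c n * t ^ n) = (\<Sum>n. B ((t ^ n / fact n) *\<^sub>R (B ^^ n) x) \<bullet> b)"
      by (intro arg_cong[of _ _ suminf]) (simp add: diffs B.scaleR mult_ac)
    also have "\<dots> = B (u t) \<bullet> b"
      unfolding u_def using bounded_linear.suminf[OF bounded_linear_inner_left[of b] B.summable[OF sm[of t]]]
        B.suminf[OF sm[of t]] by simp
    finally show ?thesis
      using termdiffs_strong_converges_everywhere[of c t] sc by (simp add: u_b)
  qed
  then have "(u has_vector_derivative B (u t)) (at t)" for t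
    unfolding has_vector_derivative_def
    by (subst has_derivative_componentwise_within)
       (simp add: has_field_derivative_def mult_commute_abs)
  moreover have "u 0 = x"
    unfolding u_def by (subst suminf_finite[of "{0}"]) auto
  ultimately show ?thesis using that by blast
qed

lemma inner_hermitian_skew:
  assumes "ctranspose H = H" "ctranspose K = - K"
  shows "H \<bullet> K = 0"
proof -
  have "H \<bullet> K = ctranspose H \<bullet> ctranspose K" by (simp add: inner_ctranspose)
  then show ?thesis by (simp add: assms)
qed

text \<open>Describes normal vectors at \<open>c\<close>. Against a tangent vector \<open>V\<close>,
  the inner product pairs the Hermitian \<open>H\<close> with \<open>ctranspose c ** V\<close>,
  which is skew-Hermitian.\<close>

lemma St_normal:
  assumes "ctranspose H = H" "V \<in> St_tangent c"
  shows "(c ** H) \<bullet> V = 0"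
proof -
  have "ctranspose (ctranspose c ** V) = - (ctranspose c ** V)"
    using assms(2) by (simp add: St_tangent_def ctranspose_mult eq_neg_iff_add_eq_0 add.commute)
  then show ?thesis using inner_hermitian_skew[OF assms(1)] by (simp add: inner_mult_left)
qed

lemma norm_St:
  assumes "(c :: complex^'m^'n) \<in> St"
  shows "norm c = norm (mat 1 :: complex^'m^'m)"
proof -
  have "c \<bullet> c = (c ** mat 1) \<bullet> c" by simp
  also have "\<dots> = (mat 1 :: complex^'m^'m) \<bullet> mat 1"
    using assms by (simp only: inner_mult_left) (simp add: St_def)
  finally show ?thesis by (simp add: norm_eq_sqrt_inner)
qed

text \<open>
  The geodesic is \<open>P F\<close>, where \<open>F = exp(- t a)\<close> and \<open>(P, R)\<close> are position and velocity times \<open>exp(t a)\<close>;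
  since \<open>a = c\<^sup>H c'\<close> is constant along a geodesic, \<open>(P, R, F)\<close> solves a linear system with constant
  coefficients. The defects of \<open>P\<^sup>H P = I\<close>, \<open>P\<^sup>H R = a\<close> and \<open>R\<^sup>H R = s\<close> satisfy a homogeneous linear system,
  hence stay \<open>0\<close>.
\<close>

lemma St_geodesic_exists:
  fixes Y V :: "complex^'m^'n"
  assumes Y: "Y \<in> St" and V: "V \<in> St_tangent Y"
  obtains c where "St_geodesic c" "c 0 = Y" "(c has_vector_derivative V) (at 0)"
proof -
  define a where "a = ctranspose Y ** V"
  define s where "s = ctranspose V ** V"
  have a: "ctranspose a = - a"
    using V by (simp add: a_def St_tangent_def ctranspose_mult eq_neg_iff_add_eq_0 add.commute)
  have s: "ctranspose s = s" by (simp add: s_def ctranspose_mult)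
  define B :: "(complex^'m^'n) \<times> (complex^'m^'n) \<times> (complex^'m^'m) \<Rightarrow> _"
    where "B = (\<lambda>(P, R, F). (P ** a + R, R ** a - P ** s, - (a ** F)))"
  have "bounded_linear B"
    unfolding B_def
    by (rule linear_conv_bounded_linear[THEN iffD1])
       (auto intro!: linearI simp: matmul_simps algebra_simps)
  then obtain u where u: "u 0 = (Y, V, mat 1)" "\<And>t. (u has_vector_derivative B (u t)) (at t)"
    using linear_ode_exists[of B "(Y, V, mat 1)"] by blast
  define P where "P t = fst (u t)" for t
  define R where "R t = fst (snd (u t))" for t
  define F where "F t = snd (snd (u t))" for t
  have u_eq: "u t = (P t, R t, F t)" for t by (simp add: P_def R_def F_def)
  note fst_der = bounded_linear.has_vector_derivative[OF bounded_linear_fst]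
  note snd_der = bounded_linear.has_vector_derivative[OF bounded_linear_snd]
  have dP: "(P has_vector_derivative P t ** a + R t) (at t)" for t
    using fst_der[OF u(2)[of t]] by (simp add: u_eq B_def)
  have dR: "(R has_vector_derivative R t ** a - P t ** s) (at t)" for t
    using fst_der[OF snd_der[OF u(2)[of t]]] by (simp add: u_eq B_def)
  have dF: "(F has_vector_derivative - (a ** F t)) (at t)" for t
    using snd_der[OF snd_der[OF u(2)[of t]]] by (simp add: u_eq B_def)
  have init: "P 0 = Y" "R 0 = V" "F 0 = mat 1" by (simp_all add: P_def R_def F_def u(1))
  note ct_der = bounded_linear.has_vector_derivative[OF bounded_linear_ctranspose]
  have FF: "ctranspose (F t) ** F t = mat 1" for t
  proof -
    have "((\<lambda>t. ctranspose (F t) ** F t - mat 1) has_vector_derivative 0) (at t)" for t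
      by (rule has_vector_derivative_eq_rhs[OF has_vector_derivative_diff[OF
            matmul.has_vector_derivative[OF ct_der[OF dF] dF] has_vector_derivative_const]])
         (simp add: matmul_simps a)
    then have "ctranspose (F t) ** F t - mat 1 = 0"
      by (rule zero_of_vector_derivative_bound[where K = 0]) (simp_all add: init)
    then show ?thesis by simp
  qed
  then have FF': "F t ** ctranspose (F t) = mat 1" for t
    using matrix_left_right_inverse by blast
  define N where "N t = (ctranspose (P t) ** P t - mat 1, ctranspose (P t) ** R t - a,
    ctranspose (R t) ** R t - s)" for t
  define G :: "(complex^'m^'m) \<times> (complex^'m^'m) \<times> (complex^'m^'m) \<Rightarrow> _"
    where "G = (\<lambda>(N1, N2, N3). (N1 ** a - a ** N1 + ctranspose N2 + N2,
      N2 ** a - a ** N2 + N3 - N1 ** s,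
      N3 ** a - a ** N3 - s ** N2 - ctranspose N2 ** s))"
  have "bounded_linear G"
    unfolding G_def
    by (rule linear_conv_bounded_linear[THEN iffD1])
       (auto intro!: linearI simp: matmul_simps algebra_simps)
  then obtain K where K: "\<And>x. norm (G x) \<le> norm x * K" using bounded_linear.bounded by blast
  have dN: "(N has_vector_derivative G (N t)) (at t)" for t
    unfolding N_def[abs_def]
    apply (rule has_vector_derivative_eq_rhs)
     apply (rule has_vector_derivative_Pair has_vector_derivative_diff has_vector_derivative_const
        matmul.has_vector_derivative ct_der dP dR)+
    apply (simp add: N_def G_def matmul_simps a s)
    done
  have "N t = 0" for t
    by (rule zero_of_vector_derivative_bound[OF dN, where K = K])
       (use K Y in \<open>simp_all add: mult.commute N_def init a_def s_def St_def zero_prod_def\<close>)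
  then have PP: "ctranspose (P t) ** P t = mat 1" for t
    by (simp_all add: N_def zero_prod_def)
  have PP': "ctranspose (P t) ** (P t ** M) = M" for t and M :: "complex^'m^'m"
    using PP by (simp add: matrix_mul_assoc)
  have FF'': "F t ** (ctranspose (F t) ** M) = M" for t and M :: "complex^'m^'m"
    using FF' by (simp add: matrix_mul_assoc)
  define c where "c t = P t ** F t" for t
  have c_St: "c t \<in> St" for t
    using FF by (simp add: St_def c_def matmul_simps PP')
  have dc: "(c has_vector_derivative R t ** F t) (at t)" for t
    unfolding c_def[abs_def]
    by (rule has_vector_derivative_eq_rhs[OF matmul.has_vector_derivative[OF dP dF]])
       (simp add: matmul_simps)
  \<comment> \<open>The terms with \<open>a\<close> cancel. Inserting
    \<open>F t ** ctranspose (F t)\<close> then exhibits the acceleration as \<open>c t\<close>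
    times a Hermitian matrix, hence as normal.\<close>
  have ddc: "((\<lambda>t. R t ** F t) has_vector_derivative c t ** (- (ctranspose (F t) ** s ** F t))) (at t)" for t
    by (rule has_vector_derivative_eq_rhs[OF matmul.has_vector_derivative[OF dR dF]])
       (simp add: matmul_simps c_def FF'')
  have "St_geodesic c"
    unfolding St_geodesic_def orthogonal_def
  proof (intro conjI allI exI ballI)
    fix t V assume "V \<in> St_tangent (c t)"
    show "(c t ** (- (ctranspose (F t) ** s ** F t))) \<bullet> V = 0"
      by (rule St_normal) (simp_all add: matmul_simps s \<open>V \<in> _\<close>)
  qed (rule c_St dc ddc)+
  moreover have "c 0 = Y" "(c has_vector_derivative V) (at 0)"
    using dc[of 0] by (simp_all add: init c_def)
  ultimately show ?thesis using that by blast
qed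

section \<open>The geodesic equation and uniqueness of geodesics\<close>

lemma St_geodesic_velocity_tangent:
  assumes "\<And>t. c t \<in> St" "\<And>t. (c has_vector_derivative c' t) (at t)"
  shows "c' t \<in> St_tangent (c t)"
proof -
  have "((\<lambda>t. ctranspose (c t) ** c t) has_vector_derivative
     ctranspose (c t) ** c' t + ctranspose (c' t) ** c t) (at t)"
    by (intro matmul.has_vector_derivative bounded_linear.has_vector_derivative[OF bounded_linear_ctranspose] assms)
  moreover have "(\<lambda>t. ctranspose (c t) ** c t) = (\<lambda>t. mat 1)"
    using assms(1) by (auto simp: St_def)
  ultimately have "((\<lambda>t. mat 1) has_vector_derivative
     ctranspose (c t) ** c' t + ctranspose (c' t) ** c t) (at t)" by simp
  from vector_derivative_unique_at[OF this has_vector_derivative_const]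
  show ?thesis by (simp add: St_tangent_def)
qed

text \<open>This is the orthogonal projection onto the tangent space, in the form used by
  \<open>St_grad\<close>: the subtracted term removes the Hermitian part of
  \<open>ctranspose Y ** N\<close>.\<close>

lemma St_tangent_part:
  assumes "Y \<in> St"
  shows "N - (1/2) *\<^sub>R (Y ** (ctranspose Y ** N + ctranspose N ** Y)) \<in> St_tangent Y"
proof -
  have 1: "ctranspose Y ** Y = mat 1" using assms by (simp add: St_def)
  then have 2: "ctranspose Y ** (Y ** M) = M" for M :: "complex^'a^'a"
    by (simp add: matrix_mul_assoc)
  define S where "S = ctranspose Y ** N + ctranspose N ** Y"
  have S: "ctranspose S = S" by (simp add: S_def matmul_simps add.commute)
  have "(1/2) *\<^sub>R S + (1/2) *\<^sub>R S = S" by (simp flip: scaleR_add_left)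
  then have "(ctranspose Y ** N - (1/2) *\<^sub>R S) + (ctranspose N ** Y - (1/2) *\<^sub>R S) = 0"
    by (simp add: S_def algebra_simps)
  then show ?thesis
    unfolding St_tangent_def S_def[symmetric] by (simp add: matmul_simps 1 2 S)
qed

text \<open>The tangential part \<open>T\<close> of the acceleration is orthogonal to itself, so the
  acceleration is \<open>c t ** H\<close>; differentiating the constraint a second time determines
  \<open>H\<close>. The speed is constant because the acceleration is orthogonal to the
  velocity.\<close>

lemma St_geodesic_ode:
  assumes St: "\<And>t. c t \<in> St" and dc: "\<And>t. (c has_vector_derivative c' t) (at t)"
    and ddc: "\<And>t. (c' has_vector_derivative c'' t) (at t)"
    and orth: "\<And>t V. V \<in> St_tangent (c t) \<Longrightarrow> orthogonal (c'' t) V"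
  shows "c'' t = - (c t ** (ctranspose (c' t) ** c' t))" and "norm (c' t) = norm (c' 0)"
proof -
  have tan: "ctranspose (c t) ** c' t + ctranspose (c' t) ** c t = 0" for t
    using St_geodesic_velocity_tangent[OF St dc] by (simp add: St_tangent_def)
  define H where "H = (1/2) *\<^sub>R (ctranspose (c t) ** c'' t + ctranspose (c'' t) ** c t)"
  have H: "ctranspose H = H" by (simp add: H_def matmul_simps add.commute)
  define T where "T = c'' t - c t ** H"
  have T: "T \<in> St_tangent (c t)"
    using St_tangent_part[OF St[of t], of "c'' t"] by (simp add: T_def H_def matmul_simps)
  have "T \<bullet> T = c'' t \<bullet> T - (c t ** H) \<bullet> T" by (simp add: T_def inner_diff_left)
  then have "T = 0" using orth[OF T] St_normal[OF H T] by (simp add: orthogonal_def)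
  then have c'': "c'' t = c t ** H" by (simp add: T_def)
  note ct_der = bounded_linear.has_vector_derivative[OF bounded_linear_ctranspose]
  have "((\<lambda>t. ctranspose (c t) ** c' t + ctranspose (c' t) ** c t) has_vector_derivative
     (ctranspose (c t) ** c'' t + ctranspose (c' t) ** c' t) +
     (ctranspose (c' t) ** c' t + ctranspose (c'' t) ** c t)) (at t)"
    by (intro has_vector_derivative_add matmul.has_vector_derivative ct_der dc ddc)
  then have "((\<lambda>t::real. 0) has_vector_derivative
     (ctranspose (c t) ** c'' t + ctranspose (c' t) ** c' t) +
     (ctranspose (c' t) ** c' t + ctranspose (c'' t) ** c t)) (at t)"
    by (simp add: tan)
  from vector_derivative_unique_at[OF this has_vector_derivative_const]
  have "2 *\<^sub>R H + 2 *\<^sub>R (ctranspose (c' t) ** c' t) = 0"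
    by (simp add: H_def algebra_simps scaleR_2)
  then have "2 *\<^sub>R (H + ctranspose (c' t) ** c' t) = 0" by (simp only: scaleR_add_right)
  then have "H = - (ctranspose (c' t) ** c' t)" by (simp add: eq_neg_iff_add_eq_0)
  then show "c'' t = - (c t ** (ctranspose (c' t) ** c' t))"
    by (simp add: c'' matmul.minus_right)
next
  have z: "c'' t \<bullet> c' t = 0" for t
    using orth[OF St_geodesic_velocity_tangent[OF St dc]] by (simp add: orthogonal_def)
  have "((\<lambda>t. c' t \<bullet> c' t - c' 0 \<bullet> c' 0) has_vector_derivative 0) (at t)" for t
    using has_vector_derivative_diff[OF bounded_bilinear.has_vector_derivative[OF bounded_bilinear_inner ddc ddc, of t]
       has_vector_derivative_const]
    by (simp add: z inner_commute[of "c' t"])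
  then have "c' t \<bullet> c' t - c' 0 \<bullet> c' 0 = 0"
    by (rule zero_of_vector_derivative_bound[where K = 0]) simp_all
  then show "norm (c' t) = norm (c' 0)" by (simp add: norm_eq_sqrt_inner)
qed

text \<open>As a first-order system for position and velocity, the geodesic equation is cubic and so
  only locally Lipschitz. Both curves however have norm \<open>m\<close> and speed \<open>v\<close>
  at all times, which gives one Lipschitz constant along them, and the Gronwall argument applies to
  their difference.\<close>

lemma St_geodesic_unique:
  fixes c d :: "real \<Rightarrow> complex^'m^'n"
  assumes "St_geodesic c" "St_geodesic d" "c 0 = d 0"
    and V: "(c has_vector_derivative V) (at 0)" "(d has_vector_derivative V) (at 0)"
  shows "c t = d t"
proof -
  obtain c' c'' where c: "\<And>t. c t \<in> St" "\<And>t. (c has_vector_derivative c' t) (at t)"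
    "\<And>t. (c' has_vector_derivative c'' t) (at t)" "\<And>t V. V \<in> St_tangent (c t) \<Longrightarrow> orthogonal (c'' t) V"
    using assms(1) unfolding St_geodesic_def by blast
  obtain d' d'' where d: "\<And>t. d t \<in> St" "\<And>t. (d has_vector_derivative d' t) (at t)"
    "\<And>t. (d' has_vector_derivative d'' t) (at t)" "\<And>t V. V \<in> St_tangent (d t) \<Longrightarrow> orthogonal (d'' t) V"
    using assms(2) unfolding St_geodesic_def by blast
  have V': "c' 0 = V" "d' 0 = V"
    using vector_derivative_unique_at[OF V(1) c(2)] vector_derivative_unique_at[OF V(2) d(2)] by auto
  have nV: "norm (c' t) = norm V" "norm (d' t) = norm V" for t
    using St_geodesic_ode(2)[OF c] St_geodesic_ode(2)[OF d] by (simp_all add: V')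
  define m where "m = norm (mat 1 :: complex^'m^'m)"
  define v where "v = norm V"
  define w where "w t = (c t - d t, c' t - d' t)" for t
  have bound: "norm (c' t - d' t, c'' t - d'' t) \<le> (1 + v * v + 2 * m * v) * norm (w t)" for t
  proof -
    have w1: "norm (c t - d t) \<le> norm (w t)" and w2: "norm (c' t - d' t) \<le> norm (w t)"
      using norm_fst_le[of "c t - d t" "c' t - d' t"] norm_snd_le[of "c' t - d' t" "c t - d t"]
      by (simp_all add: w_def)
    have c'': "c'' t = - (c t ** (ctranspose (c' t) ** c' t))"
      by (rule St_geodesic_ode(1)[OF c])
    have d'': "d'' t = - (d t ** (ctranspose (d' t) ** d' t))"
      by (rule St_geodesic_ode(1)[OF d])
    have "c'' t - d'' t = - ((c t - d t) ** (ctranspose (c' t) ** c' t)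
        + d t ** (ctranspose (c' t - d' t) ** c' t) + d t ** (ctranspose (d' t) ** (c' t - d' t)))"
      unfolding c'' d'' by (simp add: matmul_simps)
    then have "norm (c'' t - d'' t) = norm ((c t - d t) ** (ctranspose (c' t) ** c' t)
        + d t ** (ctranspose (c' t - d' t) ** c' t) + d t ** (ctranspose (d' t) ** (c' t - d' t)))"
      by (simp only: norm_minus_cancel)
    also have "\<dots> \<le> norm ((c t - d t) ** (ctranspose (c' t) ** c' t))
        + norm (d t ** (ctranspose (c' t - d' t) ** c' t)) + norm (d t ** (ctranspose (d' t) ** (c' t - d' t)))"
      by (intro norm_triangle_mono order_refl norm_triangle_ineq)
    also have "\<dots> \<le> norm (w t) * (v * v) + m * (norm (w t) * v) + m * (v * norm (w t))"
    proof (intro add_mono)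
      note le = order_trans[OF norm_matrix_mult_le mult_mono]
      have d: "norm (d t) \<le> m" and cv: "norm (c' t) \<le> v" and dv: "norm (ctranspose (d' t)) \<le> v"
        by (simp_all add: norm_St[OF d(1)] m_def v_def nV)
      have cv': "norm (ctranspose (c' t)) \<le> v" and w2': "norm (ctranspose (c' t - d' t)) \<le> norm (w t)"
        using cv w2 by simp_all
      have pos: "0 \<le> v" "0 \<le> m" by (simp_all add: v_def m_def)
      show "norm ((c t - d t) ** (ctranspose (c' t) ** c' t)) \<le> norm (w t) * (v * v)"
        by (rule le[OF w1 le[OF cv' cv]]) (use pos in simp_all)
      show "norm (d t ** (ctranspose (c' t - d' t) ** c' t)) \<le> m * (norm (w t) * v)"
        by (rule le[OF d le[OF w2' cv]]) (use pos in simp_all)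
      show "norm (d t ** (ctranspose (d' t) ** (c' t - d' t))) \<le> m * (v * norm (w t))"
        by (rule le[OF d le[OF dv w2]]) (use pos in simp_all)
    qed
    finally have "norm (c'' t - d'' t) \<le> (v * v + 2 * m * v) * norm (w t)" by (simp add: algebra_simps)
    then have "norm (c' t - d' t) + norm (c'' t - d'' t) \<le> (1 + v * v + 2 * m * v) * norm (w t)"
      using w2 by (simp add: algebra_simps)
    then show ?thesis using norm_Pair_le[of "c' t - d' t" "c'' t - d'' t"] by linarith
  qed
  have "w t = 0"
    by (rule zero_of_vector_derivative_bound[OF _ bound])
       (auto simp: w_def[abs_def] assms(3) V' zero_prod_def
         intro!: has_vector_derivative_Pair has_vector_derivative_diff c d)
  then show ?thesis by (simp add: w_def zero_prod_def)
qed

section \<open>The exponential map along a ray\<close>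

lemma St_geodesic_rescale:
  assumes "St_geodesic c"
  shows "St_geodesic (\<lambda>t. c (s * t))"
proof -
  obtain c' c'' where c: "\<And>t. c t \<in> St" "\<And>t. (c has_vector_derivative c' t) (at t)"
    "\<And>t. (c' has_vector_derivative c'' t) (at t)" "\<And>t V. V \<in> St_tangent (c t) \<Longrightarrow> orthogonal (c'' t) V"
    using assms unfolding St_geodesic_def by blast
  have scale: "((\<lambda>t. s * t) has_vector_derivative s) (at t)" for t
    by (auto intro!: derivative_eq_intros)
  have 1: "((\<lambda>t. c (s * t)) has_vector_derivative s *\<^sub>R c' (s * t)) (at t)" for t
    using vector_diff_chain_at[OF scale c(2)] by (simp add: o_def)
  have 2: "((\<lambda>t. s *\<^sub>R c' (s * t)) has_vector_derivative s *\<^sub>R s *\<^sub>R c'' (s * t)) (at t)" for t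
    using vector_diff_chain_at[OF scale c(3)]
    by (intro bounded_linear.has_vector_derivative[OF bounded_linear_scaleR_right]) (simp add: o_def)
  show ?thesis
    unfolding St_geodesic_def
    using c(1,4) 1 2
    by (intro conjI exI[of _ "\<lambda>t. s *\<^sub>R c' (s * t)"] exI[of _ "\<lambda>t. s *\<^sub>R s *\<^sub>R c'' (s * t)"])
       (auto simp: orthogonal_def)
qed

text \<open>Following a geodesic at \<open>s\<close> times its speed for unit time reaches its point
  at time \<open>s\<close>. Hence the exponential map along a ray is the geodesic itself, and
  \<open>St_DExp\<close> is its velocity.\<close>

lemma St_Exp_eq:
  assumes "St_geodesic c" "(c has_vector_derivative V) (at 0)"
  shows "St_Exp (c 0) (s *\<^sub>R V) = c s"
  unfolding St_Exp_def
proof (rule the_equality)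
  let ?c = "\<lambda>t. c (s * t)"
  have "((\<lambda>t. s * t) has_vector_derivative s) (at 0)" by (auto intro!: derivative_eq_intros)
  then have V: "(?c has_vector_derivative s *\<^sub>R V) (at 0)"
    using vector_diff_chain_at[of "\<lambda>t. s * t" s 0 c V] assms(2) by (simp add: o_def)
  note geo = St_geodesic_rescale[OF assms(1)]
  show "\<exists>d. St_geodesic d \<and> d 0 = c 0 \<and> (d has_vector_derivative s *\<^sub>R V) (at 0) \<and> c s = d 1"
    using geo V by (intro exI[of _ ?c]) simp
  fix Z assume "\<exists>d. St_geodesic d \<and> d 0 = c 0 \<and> (d has_vector_derivative s *\<^sub>R V) (at 0) \<and> Z = d 1"
  then show "Z = c s" using St_geodesic_unique[OF _ geo _ _ V, of _ 1] by auto
qed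

text \<open>Provides what the line search needs, freed from geodesics. The two distance bounds are
  mean value inequalities for the curve, of speed \<open>norm V\<close>, and for its velocity, whose
  derivative is quadratic in \<open>norm V\<close>.\<close>

lemma St_Exp_curve:
  fixes Y V :: "complex^'m^'n"
  assumes "Y \<in> St" "V \<in> St_tangent Y" "0 < \<tau>"
  obtains c' where "St_Exp Y (\<tau> *\<^sub>R V) \<in> St" "c' \<in> St_tangent (St_Exp Y (\<tau> *\<^sub>R V))"
    "c' = St_DExp Y \<tau> V" "norm c' = norm V"
    "norm (St_Exp Y (\<tau> *\<^sub>R V) - Y) \<le> \<tau> * norm V"
    "norm (c' - V) \<le> \<tau> * (norm (mat 1 :: complex^'m^'m) * (norm V)\<^sup>2)"
proof -
  obtain c where c: "St_geodesic c" "c 0 = Y" "(c has_vector_derivative V) (at 0)"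
    using St_geodesic_exists assms by blast
  obtain c' c'' where d: "\<And>t. c t \<in> St" "\<And>t. (c has_vector_derivative c' t) (at t)"
    "\<And>t. (c' has_vector_derivative c'' t) (at t)" "\<And>t V. V \<in> St_tangent (c t) \<Longrightarrow> orthogonal (c'' t) V"
    using c unfolding St_geodesic_def by blast
  have V': "c' 0 = V" using vector_derivative_unique_at[OF c(3) d(2)] by simp
  have Exp: "St_Exp Y (s *\<^sub>R V) = c s" for s using St_Exp_eq[OF c(1,3)] c(2) by simp
  have DExp: "St_DExp Y \<tau> V = c' \<tau>"
    unfolding St_DExp_def Exp using d(2) by (rule vector_derivative_at)
  have nV: "norm (c' t) = norm V" for t using St_geodesic_ode(2)[OF d] by (simp add: V')
  have c'': "c'' t = - (c t ** (ctranspose (c' t) ** c' t))" for t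
    by (rule St_geodesic_ode(1)[OF d])
  have nc'': "norm (c'' t) \<le> norm (mat 1 :: complex^'m^'m) * (norm V)\<^sup>2" for t
    unfolding c'' norm_minus_cancel power2_eq_square
    by (rule order_trans[OF norm_matrix_mult_le] mult_mono)+
       (auto simp: nV norm_St[OF d(1)] intro: order_trans[OF norm_matrix_mult_le])
  have mv: "norm (f \<tau> - f 0) \<le> \<tau> * B"
    if "\<And>t. (f has_vector_derivative f' t) (at t)" "\<And>t. norm (f' t) \<le> B"
    for f f' :: "real \<Rightarrow> complex^'m^'n" and B
  proof -
    have "norm (f \<tau> - f 0) \<le> B * norm (\<tau> - 0)"
    proof (rule differentiable_bound[of UNIV])
      show "(f has_derivative (\<lambda>h. h *\<^sub>R f' t)) (at t within UNIV)" for t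
        using that(1) by (simp add: has_vector_derivative_def)
      show "onorm (\<lambda>h. h *\<^sub>R f' t) \<le> B" for t
        using that(2)[of t] by (intro onorm_le) (simp add: mult.commute[of "\<bar>_\<bar>"] mult_right_mono)
    qed auto
    then show ?thesis using \<open>0 < \<tau>\<close> by (simp add: mult.commute)
  qed
  show ?thesis
  proof (rule that[of "c' \<tau>"])
    show "c' \<tau> \<in> St_tangent (St_Exp Y (\<tau> *\<^sub>R V))"
      unfolding Exp by (rule St_geodesic_velocity_tangent[OF d(1,2)])
    show "norm (St_Exp Y (\<tau> *\<^sub>R V) - Y) \<le> \<tau> * norm V"
      using mv[OF d(2), of "norm V"] nV unfolding Exp c(2) by simp
    show "norm (c' \<tau> - V) \<le> \<tau> * (norm (mat 1 :: complex^'m^'m) * (norm V)\<^sup>2)"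
      using mv[OF d(3) nc''] unfolding V' .
  qed (simp_all only: Exp DExp nV d(1))
qed

section \<open>Line search and unipotent transformations\<close>

lemma quartic_deriv_0 [simp]: "quartic_deriv S L A 0 H = 0" "quartic_deriv S L A Z 0 = 0"
  by (simp_all add: quartic_deriv_def cost_form.zero_left cost_form.zero_right)

lemma quartic_deriv_bounded:
  fixes A :: "nat \<Rightarrow> complex^'n^'n"
  assumes "0 \<le> R"
  obtains K where "K > 0" "\<And>Z H :: complex^'m^'n. norm Z \<le> R \<Longrightarrow>
    \<bar>quartic_deriv S L A Z H\<bar> \<le> K * norm H"
proof -
  obtain K where K: "K > 0" "\<And>Z Z' H :: complex^'m^'n. norm Z \<le> R \<Longrightarrow> norm Z' \<le> R \<Longrightarrow>
    \<bar>quartic_deriv S L A Z H - quartic_deriv S L A Z' H\<bar> \<le> K * norm (Z - Z') * norm H"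
    using quartic_deriv_lipschitz[OF assms] by blast
  show ?thesis
  proof
    \<comment> \<open>The added 1 keeps the constant positive when \<open>R = 0\<close>.\<close>
    show "K * (R + 1) > 0" using K(1) assms by simp
    fix Z H :: "complex^'m^'n" assume Z: "norm Z \<le> R"
    have "\<bar>quartic_deriv S L A Z H\<bar> \<le> K * norm Z * norm H"
      using K(2)[of Z 0 H] Z assms by simp
    also have "\<dots> \<le> K * (R + 1) * norm H"
      using K(1) Z by (intro mult_right_mono mult_left_mono) auto
    finally show "\<bar>quartic_deriv S L A Z H\<bar> \<le> K * (R + 1) * norm H" .
  qed
qed

lemma inner_St_grad:
  assumes "V \<in> St_tangent Y"
  shows "St_grad p Y \<bullet> V = nabla p Y \<bullet> V"
proof -
  have "(Y ** (ctranspose Y ** nabla p Y + ctranspose (nabla p Y) ** Y)) \<bullet> V = 0"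
    by (rule St_normal[OF _ assms]) (simp add: matmul_simps add.commute)
  then show ?thesis by (simp add: St_grad_def inner_diff_left)
qed

text \<open>Let \<open>a\<close> be minus the slope in the direction \<open>V\<close>. The curvature
  condition bounds the step below by
  \<open>(1 - \<delta>c) * a \<le> C * (\<tau> * (norm V)\<^sup>2)\<close>. After multiplication by
  \<open>a\<close>, the angle condition turns \<open>a\<^sup>2\<close> into the squared gradient
  times \<open>(norm V)\<^sup>2\<close>, which cancels; what remains bounds the sufficient decrease
  \<open>\<delta>w * \<tau> * a\<close> from below.\<close>

lemma line_search_descent:
  fixes A :: "nat \<Rightarrow> complex^'n^'n"
  assumes R: "0 \<le> R" and "0 < \<delta>s" "0 < \<delta>w" "\<delta>c < 1"
  obtains \<kappa> where "\<kappa> > 0"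
    "\<And>(X :: complex^'m^'m) Y Y'. norm X \<le> R \<Longrightarrow> Y \<in> St \<Longrightarrow>
      line_search \<delta>s \<delta>w \<delta>c (\<lambda>Z. cost S L A (Z, X)) Y Y' \<Longrightarrow>
      Y' \<in> St \<and> \<kappa> * (norm (St_grad (\<lambda>Z. cost S L A (Z, X)) Y))\<^sup>2 \<le> cost S L A (Y, X) - cost S L A (Y', X)"
proof -
  define m where "m = norm (mat 1 :: complex^'m^'m)"
  have m: "0 \<le> m" by (simp add: m_def)
  obtain K where K: "K > 0" "\<And>Z Z' H :: complex^'m^'n. norm Z \<le> m * R \<Longrightarrow> norm Z' \<le> m * R \<Longrightarrow>
    \<bar>quartic_deriv S L A Z H - quartic_deriv S L A Z' H\<bar> \<le> K * norm (Z - Z') * norm H"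
    using quartic_deriv_lipschitz[of "m * R"] R m by (metis mult_nonneg_nonneg)
  obtain K' where K': "K' > 0" "\<And>Z H :: complex^'m^'n. norm Z \<le> m * R \<Longrightarrow>
    \<bar>quartic_deriv S L A Z H\<bar> \<le> K' * norm H"
    using quartic_deriv_bounded[of "m * R"] R m by (metis mult_nonneg_nonneg)
  \<comment> \<open>Bounds the change of slope along the geodesic per unit of
    \<open>\<tau> * (norm V)\<^sup>2\<close>: the first term stems from the change of the gradient,
    the second from the turning of the velocity.\<close>
  define C where "C = K * R\<^sup>2 + K' * m * R + 1"
  have C: "C > 0" unfolding C_def using K(1) K'(1) R m by (intro add_nonneg_pos) auto
  define \<kappa> where "\<kappa> = \<delta>w * (1 - \<delta>c) * \<delta>s\<^sup>2 / C"
  have \<kappa>: "\<kappa> > 0" using C assms by (simp add: \<kappa>_def)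
  show ?thesis
  proof (rule that[OF \<kappa>])
    fix X :: "complex^'m^'m" and Y Y' :: "complex^'m^'n"
    let ?p = "\<lambda>Z. cost S L A (Z, X)"
    assume X: "norm X \<le> R" and Y: "Y \<in> St" and ls: "line_search \<delta>s \<delta>w \<delta>c ?p Y Y'"
    obtain V \<tau> where V: "V \<in> St_tangent Y" "V \<noteq> 0" "\<tau> > 0" "Y' = St_Exp Y (\<tau> *\<^sub>R V)"
      and angle: "St_grad ?p Y \<bullet> V \<le> - \<delta>s * norm (St_grad ?p Y) * norm V"
      and armijo: "?p Y' \<le> ?p Y + \<delta>w * \<tau> * (St_grad ?p Y \<bullet> V)"
      and curvature: "St_grad ?p Y' \<bullet> St_DExp Y \<tau> V \<ge> \<delta>c * (St_grad ?p Y \<bullet> V)"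
      using ls unfolding line_search_def by blast
    obtain c' where c': "Y' \<in> St" "c' \<in> St_tangent Y'" "c' = St_DExp Y \<tau> V" "norm c' = norm V"
      "norm (Y' - Y) \<le> \<tau> * norm V" "norm (c' - V) \<le> \<tau> * (m * (norm V)\<^sup>2)"
      using St_Exp_curve[OF Y V(1,3)] unfolding V(4) m_def by metis
    have grad: "St_grad ?p Z \<bullet> H = quartic_deriv S L A (Z ** X) (H ** X)" if "H \<in> St_tangent Z" for Z H
      by (subst inner_St_grad[OF that], subst inner_commute)
         (simp add: nabla_cost_fst inner_quartic_grad flip: inner_mult_right)
    have YX: "norm (Z ** X) \<le> m * R" if "Z \<in> St" for Z :: "complex^'m^'n"
      by (rule order_trans[OF norm_matrix_mult_le mult_mono]) (use X that m in \<open>auto simp: norm_St m_def\<close>)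
    have "\<bar>quartic_deriv S L A (Y' ** X) (c' ** X) - quartic_deriv S L A (Y ** X) (c' ** X)\<bar>
      \<le> K * norm ((Y' - Y) ** X) * norm (c' ** X)"
      using K(2)[OF YX YX] c'(1) Y by (simp add: matmul.diff_left)
    also have "\<dots> \<le> K * (\<tau> * norm V * R) * (norm V * R)"
      using norm_matrix_mult_le[of "Y' - Y" X] norm_matrix_mult_le[of c' X] X c'(4,5) K(1) V(3) R
      by (intro mult_mono order_trans[OF norm_matrix_mult_le] order_refl mult_nonneg_nonneg) auto
    finally have 1: "\<bar>quartic_deriv S L A (Y' ** X) (c' ** X) - quartic_deriv S L A (Y ** X) (c' ** X)\<bar>
      \<le> K * R\<^sup>2 * (\<tau> * (norm V)\<^sup>2)" by (simp add: power2_eq_square mult_ac)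
    have "\<bar>quartic_deriv S L A (Y ** X) ((c' - V) ** X)\<bar> \<le> K' * norm ((c' - V) ** X)"
      using K'(2)[OF YX[OF Y]] .
    also have "\<dots> \<le> K' * (\<tau> * (m * (norm V)\<^sup>2) * R)"
      using X c'(6) K'(1) V(3) R m
      by (intro mult_mono order_trans[OF norm_matrix_mult_le] order_refl mult_nonneg_nonneg) auto
    finally have 2: "\<bar>quartic_deriv S L A (Y ** X) ((c' - V) ** X)\<bar> \<le> K' * m * R * (\<tau> * (norm V)\<^sup>2)"
      by (simp add: mult_ac)
    define a where "a = - (St_grad ?p Y \<bullet> V)"
    have "quartic_deriv S L A (Y ** X) ((c' - V) ** X) =
      quartic_deriv S L A (Y ** X) (c' ** X) - quartic_deriv S L A (Y ** X) (V ** X)"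
      by (simp add: matmul.diff_left linear_diff[OF linear_quartic_deriv])
    then have "(1 - \<delta>c) * a \<le> K * R\<^sup>2 * (\<tau> * (norm V)\<^sup>2) + K' * m * R * (\<tau> * (norm V)\<^sup>2)"
      using 1 2 curvature unfolding c'(3)[symmetric] a_def grad[OF V(1)] grad[OF c'(2)]
      by (simp add: algebra_simps)
    also have "\<dots> \<le> C * (\<tau> * (norm V)\<^sup>2)" using V(3) by (simp add: C_def algebra_simps)
    finally have step: "(1 - \<delta>c) * a \<le> C * (\<tau> * (norm V)\<^sup>2)" .
    have a: "\<delta>s * norm (St_grad ?p Y) * norm V \<le> a" using angle by (simp add: a_def)
    have a0: "0 \<le> a" by (rule order_trans[OF _ a]) (use assms in simp)
    have "(\<delta>s * norm (St_grad ?p Y) * norm V)\<^sup>2 \<le> a\<^sup>2"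
      by (rule power_mono[OF a]) (use assms in simp)
    then have "(1 - \<delta>c) * (\<delta>s * norm (St_grad ?p Y) * norm V)\<^sup>2 \<le> (1 - \<delta>c) * a * a"
      using assms(4) by (simp add: power2_eq_square mult_left_mono)
    also have "\<dots> \<le> C * (\<tau> * (norm V)\<^sup>2) * a" by (rule mult_right_mono[OF step a0])
    finally have "(norm V)\<^sup>2 * ((1 - \<delta>c) * \<delta>s\<^sup>2 * (norm (St_grad ?p Y))\<^sup>2) \<le> (norm V)\<^sup>2 * (C * \<tau> * a)"
      by (simp add: power_mult_distrib mult_ac)
    then have "(1 - \<delta>c) * \<delta>s\<^sup>2 * (norm (St_grad ?p Y))\<^sup>2 \<le> C * \<tau> * a"
      using V(2) by (simp add: mult_le_cancel_left)
    then have "\<delta>w * ((1 - \<delta>c) * \<delta>s\<^sup>2 * (norm (St_grad ?p Y))\<^sup>2) \<le> \<delta>w * (C * \<tau> * a)"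
      using assms by simp
    then have "\<kappa> * (norm (St_grad ?p Y))\<^sup>2 \<le> \<delta>w * \<tau> * a"
      using C by (simp add: \<kappa>_def field_simps)
    then show "Y' \<in> St \<and> \<kappa> * (norm (St_grad ?p Y))\<^sup>2 \<le> ?p Y - ?p Y'"
      using armijo c'(1) by (simp add: a_def)
  qed
qed

text \<open>A gradient step of fixed step size in the two real parameters decreases the cost enough,
  and a minimizer can only do better. For this comparison the existence of one good \<open>z\<close>
  suffices.\<close>

lemma linear_param_descent:
  fixes A :: "nat \<Rightarrow> complex^'n^'n"
  assumes R: "0 \<le> R"
  obtains \<kappa> where "\<kappa> > 0"
    "\<And>(E :: real \<times> real \<Rightarrow> complex^'m^'m) (Z :: complex^'m^'n). linear E \<Longrightarrow> (\<And>z. norm (E z) \<le> norm z) \<Longrightarrow> norm Z \<le> R \<Longrightarrow>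
      (\<exists>z. \<kappa> * (norm (nabla (\<lambda>z. quartic S L A (Z ** (mat 1 + E z))) 0))\<^sup>2
        \<le> quartic S L A Z - quartic S L A (Z ** (mat 1 + E z)))"
proof -
  obtain K' where K': "K' > 0" "\<And>Z H :: complex^'m^'n. norm Z \<le> R \<Longrightarrow>
    \<bar>quartic_deriv S L A Z H\<bar> \<le> K' * norm H"
    using quartic_deriv_bounded[OF R] by blast
  \<comment> \<open>The ball for the Taylor estimate has to contain \<open>Z\<close> and the
    increment \<open>Z ** E z\<close>. The latter has norm at most \<open>R * (K' * R)\<close>,
    because \<open>norm D \<le> K' * R\<close> and \<open>s \<le> 1\<close>.\<close>
  define Q where "Q = R + R * (K' * R)"
  have Q: "0 \<le> Q" "R \<le> Q" "R * (K' * R) \<le> Q" using R K'(1) by (simp_all add: Q_def)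
  obtain K where K: "K > 0" "\<And>Z H :: complex^'m^'n. norm Z \<le> Q \<Longrightarrow> norm H \<le> Q \<Longrightarrow>
    quartic S L A (Z + H) \<le> quartic S L A Z + quartic_deriv S L A Z H + K * (norm H)\<^sup>2"
    using quartic_taylor[OF Q(1)] by blast
  \<comment> \<open>This step size makes the quadratic remainder at most half of the linear gain
    \<open>s * (norm D)\<^sup>2\<close>.\<close>
  define s where "s = 1 / (1 + 2 * K * R\<^sup>2)"
  have s: "0 < s" "s \<le> 1" "K * s * R\<^sup>2 \<le> 1 / 2"
    using K(1) R by (simp_all add: s_def field_simps add_pos_nonneg)
  show ?thesis
  proof (rule that[of "s / 2"])
    show "s / 2 > 0" using s by simp
    fix E :: "real \<times> real \<Rightarrow> complex^'m^'m" and Z :: "complex^'m^'n"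
    assume E: "linear E" "\<And>z. norm (E z) \<le> norm z" and Z: "norm Z \<le> R"
    let ?h = "\<lambda>z. quartic S L A (Z ** (mat 1 + E z))"
    have lin: "linear (\<lambda>z. quartic_deriv S L A Z (Z ** E z))"
      by (rule linear_compose[OF _ linear_quartic_deriv, unfolded o_def])
         (rule linearI; simp only: matmul.add_right matmul.scaleR_right linear_add[OF E(1)] linear_scale[OF E(1)])
    have "(?h has_derivative (\<lambda>z. quartic_deriv S L A (Z ** (mat 1 + E 0)) (Z ** (0 + E z)))) (at 0)"
      by (rule has_derivative_compose[OF _ has_derivative_quartic]
          bounded_linear.has_derivative[OF matmul.bounded_linear_right]
          has_derivative_add has_derivative_const linear_imp_has_derivative E(1))+
    then have D: "nabla ?h 0 = adjoint (\<lambda>z. quartic_deriv S L A Z (Z ** E z)) 1"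
      by (intro nabla_eqI) (simp add: gderiv_def linear_0[OF E(1)] adjoint_works[OF lin])
    define D where "D = nabla ?h 0"
    have Dz: "z \<bullet> D = quartic_deriv S L A Z (Z ** E z)" for z
      by (simp add: D_def D adjoint_works[OF lin])
    have ZE: "norm (Z ** E z) \<le> R * norm z" for z
      by (rule order_trans[OF norm_matrix_mult_le mult_mono]) (use Z E(2) R in auto)
    have "norm D * norm D = quartic_deriv S L A Z (Z ** E D)"
      by (simp add: power2_norm_eq_inner flip: Dz power2_eq_square)
    also have "\<dots> \<le> K' * norm (Z ** E D)"
      using K'(2)[OF Z] by (rule order_trans[OF abs_ge_self])
    also have "\<dots> \<le> K' * (R * norm D)" using ZE K'(1) by (intro mult_left_mono) auto
    finally have "norm D * norm D \<le> K' * R * norm D" by (simp add: mult_ac)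
    then have nD: "norm D \<le> K' * R"
      using K'(1) R by (cases "D = 0") (auto simp: mult_le_cancel_right)
    define z where "z = - s *\<^sub>R D"
    have nz: "norm z = s * norm D" using s by (simp add: z_def)
    have "norm (Z ** E z) \<le> R * (K' * R)"
      using order_trans[OF ZE mult_left_mono[of "norm z" "K' * R" R]] nz nD R s K'(1)
      by (metis norm_ge_zero mult_left_le_one_le order_trans less_imp_le)
    then have "quartic S L A (Z + Z ** E z) \<le> quartic S L A Z + quartic_deriv S L A Z (Z ** E z) + K * (norm (Z ** E z))\<^sup>2"
      using Q Z by (intro K(2)) linarith+
    also have "quartic_deriv S L A Z (Z ** E z) = - s * (norm D)\<^sup>2"
      by (simp add: z_def power2_norm_eq_inner flip: Dz)
    also have "K * (norm (Z ** E z))\<^sup>2 \<le> K * (R * norm z)\<^sup>2"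
      using K(1) by (intro mult_left_mono power_mono ZE) auto
    also have "K * (R * norm z)\<^sup>2 = (K * s * R\<^sup>2) * (s * (norm D)\<^sup>2)"
      by (simp add: nz power_mult_distrib power2_eq_square)
    also have "\<dots> \<le> 1 / 2 * (s * (norm D)\<^sup>2)"
      using s by (intro mult_right_mono) auto
    finally have "s / 2 * (norm D)\<^sup>2 \<le> quartic S L A Z - ?h z"
      by (simp add: matmul.add_right)
    then show "\<exists>z. s / 2 * (norm (nabla ?h 0))\<^sup>2 \<le> quartic S L A Z - ?h z"
      unfolding D_def by blast
  qed
qed

text \<open>In the constant case the gradient is 0 and nothing has to be gained. Otherwise
  \<open>z\<close> is a global minimizer and does no worse than the witness of the second
  assumption.\<close>

lemma quad_argmin_descent:
  assumes "quad_argmin h z" "\<exists>z. \<kappa> * (norm (nabla h 0))\<^sup>2 \<le> h 0 - h z"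
  shows "\<kappa> * (norm (nabla h (0, 0)))\<^sup>2 \<le> h 0 - h z"
proof (cases "h constant_on UNIV")
  case True
  then obtain c where "\<forall>z. h z = c" unfolding constant_on_def by blast
  then have "h = (\<lambda>_. c)" by (intro ext) blast
  then show ?thesis by (simp add: nabla_eqI[OF GDERIV_const])
next
  case False
  then have "\<not> h y < h z" for y
    using assms(1) by (simp add: quad_argmin_def is_arg_min_def del: split_paired_All split_paired_Ex)
  then show ?thesis using assms(2) by (smt (verit) zero_prod_def)
qed

section \<open>Perturbations of a single entry: types \<open>U\<close> and \<open>L\<close>\<close>

definition entry_mat :: "'m \<Rightarrow> 'm \<Rightarrow> real \<times> real \<Rightarrow> complex^'m^'m" where
  "entry_mat i j z = (\<chi> a b. if a = i \<and> b = j then Complex (fst z) (snd z) else 0)"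

lemma linear_entry_mat: "linear (entry_mat i j)"
  by (rule linearI) (auto simp: entry_mat_def vec_eq_iff complex_eq_iff)

lemma norm_entry_mat: "norm (entry_mat i j z) \<le> norm z"
proof -
  have "norm (entry_mat i j z) ^ 2 = (\<Sum>a\<in>UNIV. \<Sum>b\<in>UNIV. (cmod (entry_mat i j z $ a $ b))\<^sup>2)"
    by (simp add: norm_vec_def L2_set_def sum_nonneg)
  also have "\<dots> = (\<Sum>a\<in>UNIV. \<Sum>b\<in>UNIV. if b = j then if a = i then (cmod (Complex (fst z) (snd z)))\<^sup>2 else 0 else 0)"
    by (intro sum.cong) (auto simp: entry_mat_def)
  also have "\<dots> = (norm z)\<^sup>2"
    by (simp add: sum.delta cmod_def norm_prod_def)
  finally show ?thesis by simp
qed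

lemma mat2_nth [simp]:
  "mat2 a b c d $ 1 $ 1 = a" "mat2 a b c d $ 1 $ 2 = b" "mat2 a b c d $ 2 $ 1 = c" "mat2 a b c d $ 2 $ 2 = d"
  by (simp_all add: mat2_def)

lemma elem_mat_\<Psi>U: "i \<noteq> j \<Longrightarrow> elem_mat i j (\<Psi>U z) = mat 1 + entry_mat i j z"
  by (auto simp: elem_mat_def \<Psi>U_def entry_mat_def mat_def vec_eq_iff split: prod.split)

lemma elem_mat_\<Psi>L: "i \<noteq> j \<Longrightarrow> elem_mat i j (\<Psi>L z) = mat 1 + entry_mat j i z"
  by (auto simp: elem_mat_def \<Psi>L_def entry_mat_def mat_def vec_eq_iff split: prod.split)

lemma UL_descent:
  fixes A :: "nat \<Rightarrow> complex^'n^'n"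
  assumes R: "0 \<le> R"
  obtains \<kappa> where "\<kappa> > 0"
    "\<And>(X :: complex^'m^'m) (Y :: complex^'m^'n) i j ty \<Psi>. norm (Y ** X) \<le> R \<Longrightarrow> i \<noteq> j \<Longrightarrow> ty \<in> {TU, TL} \<Longrightarrow>
      elem_choice S L A \<sigma>D \<sigma>Q Y X i j ty \<Psi> \<Longrightarrow>
      \<kappa> * (elem_grad_norm (\<lambda>Z. cost S L A (Y, Z)) X i j ty)\<^sup>2
        \<le> cost S L A (Y, X) - cost S L A (Y, X ** elem_mat i j \<Psi>)"
proof -
  obtain \<kappa> where \<kappa>: "\<kappa> > 0"
    "\<And>(E :: real \<times> real \<Rightarrow> complex^'m^'m) (Z :: complex^'m^'n). linear E \<Longrightarrow> (\<And>z. norm (E z) \<le> norm z) \<Longrightarrow> norm Z \<le> R \<Longrightarrow>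
      (\<exists>z. \<kappa> * (norm (nabla (\<lambda>z. quartic S L A (Z ** (mat 1 + E z))) 0))\<^sup>2
        \<le> quartic S L A Z - quartic S L A (Z ** (mat 1 + E z)))"
    using linear_param_descent[OF R] by blast
  show ?thesis
  proof (rule that[OF \<kappa>(1)])
    fix X :: "complex^'m^'m" and Y :: "complex^'m^'n" and i j ty \<Psi>
    assume *: "norm (Y ** X) \<le> R" "i \<noteq> j" "ty \<in> {TU, TL}" and choice: "elem_choice S L A \<sigma>D \<sigma>Q Y X i j ty \<Psi>"
    \<comment> \<open>Type \<open>L\<close> is type \<open>U\<close> with the varying entry at
      \<open>(j, i)\<close>; one parametrization covers both.\<close>
    define \<Theta> where "\<Theta> = (if ty = TU then \<Psi>U else \<Psi>L)"
    define E :: "real \<times> real \<Rightarrow> complex^'m^'m" where "E = (if ty = TU then entry_mat i j else entry_mat j i)"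
    have E: "elem_mat i j (\<Theta> z) = mat 1 + E z" for z
      using * by (auto simp: \<Theta>_def E_def elem_mat_\<Psi>U elem_mat_\<Psi>L)
    have linE: "linear E" and nE: "norm (E z) \<le> norm z" for z
      by (simp_all add: E_def linear_entry_mat norm_entry_mat)
    let ?h = "\<lambda>z. quartic S L A ((Y ** X) ** (mat 1 + E z))"
    have h: "(\<lambda>\<Psi>. cost S L A (Y, X ** elem_mat i j \<Psi>)) \<circ> \<Theta> = ?h"
      by (simp add: o_def E cost_eq_quartic matrix_mul_assoc)
    have h0: "?h 0 = cost S L A (Y, X)" by (simp add: cost_eq_quartic linear_0[OF linE])
    obtain z where z: "quad_argmin ?h z" "\<Psi> = \<Theta> z"
      using choice * by (auto simp: elem_choice_def Let_def \<Theta>_def simp flip: h)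
    have grad: "elem_grad_norm (\<lambda>Z. cost S L A (Y, Z)) X i j ty = norm (nabla ?h (0, 0))"
      using * by (auto simp: elem_grad_norm_def Let_def \<Theta>_def simp flip: h)
    have "?h 0 = quartic S L A (Y ** X)" by (simp add: linear_0[OF linE])
    then have "\<kappa> * (norm (nabla ?h (0, 0)))\<^sup>2 \<le> ?h 0 - ?h z"
      by (intro quad_argmin_descent[OF z(1)]) (use \<kappa>(2)[OF linE nE *(1)] in simp)
    then show "\<kappa> * (elem_grad_norm (\<lambda>Z. cost S L A (Y, Z)) X i j ty)\<^sup>2
        \<le> cost S L A (Y, X) - cost S L A (Y, X ** elem_mat i j \<Psi>)"
      unfolding grad h0 z(2) E by (simp add: cost_eq_quartic matrix_mul_assoc)
  qed
qed

section \<open>Diagonal transformations\<close>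

definition star_scalar :: "star_kind \<Rightarrow> complex \<Rightarrow> complex" where
  "star_scalar S z = (case S of Trans \<Rightarrow> z | Herm \<Rightarrow> cnj z)"

lemma star_scalar_simps [simp]: "star_scalar S 0 = 0" "star_scalar S 1 = 1"
  "star_scalar Trans z = z" "star_scalar Herm z = cnj z" "cmod (star_scalar S z) = cmod z"
  by (cases S; simp add: star_scalar_def)+

lemma star_nth': "star S M $ a $ b = star_scalar S (M $ b $ a)"
  by (simp add: star_nth star_scalar_def)

lemma norm_star [simp]: "norm (star S M) = norm M"
proof (cases S)
  case Trans
  have "norm (transpose M) = norm (ctranspose M)"
    by (simp add: norm_vec_def transpose_def)
  with Trans show ?thesis by (simp add: star_def)
qed (simp add: star_def)

lemma sum_UNIV_split2:
  fixes f :: "'m::finite \<Rightarrow> 'a::comm_monoid_add"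
  assumes "i \<noteq> j"
  shows "sum f UNIV = f i + (f j + sum f (UNIV - {i, j}))"
proof -
  have "sum f UNIV = sum f (insert i (insert j (UNIV - {i, j})))"
    by (rule arg_cong[where f = "sum f"]) auto
  then show ?thesis using assms by simp
qed

lemma mult_elem_mat:
  assumes "i \<noteq> j"
  shows "(M ** elem_mat i j \<Psi>) $ a $ b =
    (if b = i then M $ a $ i * \<Psi> $ 1 $ 1 + M $ a $ j * \<Psi> $ 2 $ 1
     else if b = j then M $ a $ i * \<Psi> $ 1 $ 2 + M $ a $ j * \<Psi> $ 2 $ 2 else M $ a $ b)"
proof -
  have "(\<Sum>k\<in>UNIV - {i, j}. M $ a $ k * elem_mat i j \<Psi> $ k $ b) =
    (\<Sum>k\<in>UNIV - {i, j}. if k = b then M $ a $ b else 0)"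
    by (intro sum.cong) (auto simp: elem_mat_def)
  then show ?thesis
    using assms by (auto simp: matrix_matrix_mult_def sum_UNIV_split2[OF assms] elem_mat_def sum.delta)
qed

lemma star_elem_mat_mult:
  assumes "i \<noteq> j"
  shows "(star S (elem_mat i j \<Psi>) ** M) $ a $ b =
    (if a = i then star_scalar S (\<Psi> $ 1 $ 1) * M $ i $ b + star_scalar S (\<Psi> $ 2 $ 1) * M $ j $ b
     else if a = j then star_scalar S (\<Psi> $ 1 $ 2) * M $ i $ b + star_scalar S (\<Psi> $ 2 $ 2) * M $ j $ b
     else M $ a $ b)"
proof -
  have "(\<Sum>k\<in>UNIV - {i, j}. star_scalar S (elem_mat i j \<Psi> $ k $ a) * M $ k $ b) =
    (\<Sum>k\<in>UNIV - {i, j}. if k = a then M $ a $ b else 0)"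
    by (intro sum.cong) (auto simp: elem_mat_def)
  then show ?thesis
    using assms by (auto simp: matrix_matrix_mult_def star_nth' sum_UNIV_split2[OF assms] elem_mat_def sum.delta)
qed

text \<open>The share of the off-diagonal norm outside rows and columns \<open>i\<close> and
  \<open>j\<close>, which congruence by \<open>elem_mat i j\<close> leaves alone.\<close>

definition rest_offdiag :: "'m \<Rightarrow> 'm \<Rightarrow> complex^'m^'m \<Rightarrow> real" where
  "rest_offdiag i j W = (\<Sum>a\<in>UNIV - {i, j}. \<Sum>b\<in>UNIV - {i, j}. if a = b then 0 else (cmod (W $ a $ b))\<^sup>2)"

text \<open>Groups entries by how many of their indices lie in \<open>{i, j}\<close>, since an
  elementary congruence mixes entries only within such a group; the last group mixes together with
  the diagonal entries at \<open>i\<close> and \<open>j\<close>.\<close>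

lemma norm_offdiag_split:
  assumes "i \<noteq> j"
  shows "(norm (offdiag W))\<^sup>2 = rest_offdiag i j W
    + (\<Sum>p\<in>UNIV - {i, j}. (cmod (W $ p $ i))\<^sup>2 + (cmod (W $ p $ j))\<^sup>2)
    + (\<Sum>p\<in>UNIV - {i, j}. (cmod (W $ i $ p))\<^sup>2 + (cmod (W $ j $ p))\<^sup>2)
    + ((cmod (W $ i $ j))\<^sup>2 + (cmod (W $ j $ i))\<^sup>2)"
proof -
  define f where "f a b = (if a = b then 0 else (cmod (W $ a $ b))\<^sup>2)" for a b
  have "(norm (offdiag W))\<^sup>2 = (\<Sum>a\<in>UNIV. \<Sum>b\<in>UNIV. f a b)"
    unfolding norm_vec_def L2_set_def by (simp add: sum_nonneg) (auto simp: offdiag_def f_def intro!: sum.cong)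
  also have "\<dots> = f i i + f i j + sum (f i) (UNIV - {i, j}) + f j i + f j j + sum (f j) (UNIV - {i, j})
    + (\<Sum>p\<in>UNIV - {i, j}. f p i + f p j) + (\<Sum>p\<in>UNIV - {i, j}. \<Sum>b\<in>UNIV - {i, j}. f p b)"
    by (simp add: sum_UNIV_split2[OF assms] sum.distrib)
  also have "sum (f i) (UNIV - {i, j}) = (\<Sum>p\<in>UNIV - {i, j}. (cmod (W $ i $ p))\<^sup>2)"
    by (rule sum.cong) (auto simp: f_def)
  also have "sum (f j) (UNIV - {i, j}) = (\<Sum>p\<in>UNIV - {i, j}. (cmod (W $ j $ p))\<^sup>2)"
    by (rule sum.cong) (auto simp: f_def)
  also have "(\<Sum>p\<in>UNIV - {i, j}. f p i + f p j) = (\<Sum>p\<in>UNIV - {i, j}. (cmod (W $ p $ i))\<^sup>2 + (cmod (W $ p $ j))\<^sup>2)"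
    by (rule sum.cong) (auto simp: f_def)
  finally show ?thesis
    using assms by (simp add: rest_offdiag_def f_def sum.distrib)
qed

lemma cost_elem_mat:
  "cost S L A (Y, X ** elem_mat i j \<Psi>) =
    (\<Sum>l=1..L. (norm (offdiag (star S (elem_mat i j \<Psi>) ** (star S X ** star S Y ** A l ** Y ** X) ** elem_mat i j \<Psi>)))\<^sup>2)"
  by (simp add: cost_def star_mult matrix_mul_assoc)

lemma rest_offdiag_elem_mat:
  assumes "i \<noteq> j"
  shows "rest_offdiag i j (star S (elem_mat i j \<Psi>) ** W ** elem_mat i j \<Psi>) = rest_offdiag i j W"
  unfolding rest_offdiag_def
  by (intro sum.cong refl) (auto simp: mult_elem_mat[OF assms] star_elem_mat_mult[OF assms])

lemma elem_mat_1:
  assumes "i \<noteq> j"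
  shows "elem_mat i j (mat2 1 0 0 1) = mat 1"
proof -
  have "Complex 0 0 = 0" by (simp add: complex_eq_iff)
  then show ?thesis
    using elem_mat_\<Psi>U[OF assms, of 0] linear_0[OF linear_entry_mat, of i j]
    by (simp add: \<Psi>U_def zero_prod_def)
qed

lemma gamma_nonneg: "0 \<le> gamma L W i j q"
  by (auto simp: gamma_def intro!: sum_nonneg)

text \<open>Row and column \<open>i\<close> scale by the modulus of \<open>z\<close>, row and column
  \<open>j\<close> by its inverse. The entries at \<open>(i, j)\<close> and \<open>(j, i)\<close>
  get a factor of modulus 1 and belong to \<open>C\<close>.\<close>

lemma cost_diag_scaling:
  assumes "i \<noteq> j"
  obtains C where "C \<ge> 0" "\<And>z. z \<noteq> 0 \<Longrightarrow> cost S L A (Y, X ** elem_mat i j (mat2 z 0 0 (1 / z))) =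
    C + gamma L (\<lambda>l. star S X ** star S Y ** A l ** Y ** X) i j i * (cmod z)\<^sup>2
      + gamma L (\<lambda>l. star S X ** star S Y ** A l ** Y ** X) i j j / (cmod z)\<^sup>2"
proof -
  define W where "W l = star S X ** star S Y ** A l ** Y ** X" for l
  define C where "C = (\<Sum>l=1..L. rest_offdiag i j (W l) + ((cmod (W l $ i $ j))\<^sup>2 + (cmod (W l $ j $ i))\<^sup>2))"
  have "C \<ge> 0"
    unfolding C_def rest_offdiag_def by (intro sum_nonneg add_nonneg_nonneg) auto
  moreover have "cost S L A (Y, X ** elem_mat i j (mat2 z 0 0 (1 / z))) =
    C + gamma L W i j i * (cmod z)\<^sup>2 + gamma L W i j j / (cmod z)\<^sup>2" if z: "z \<noteq> 0" for z
  proof -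
    let ?E = "elem_mat i j (mat2 z 0 0 (1 / z))"
    have "(norm (offdiag (star S ?E ** W l ** ?E)))\<^sup>2 =
      rest_offdiag i j (W l) + ((cmod (W l $ i $ j))\<^sup>2 + (cmod (W l $ j $ i))\<^sup>2)
      + (\<Sum>p\<in>UNIV - {i, j}. (cmod (W l $ i $ p))\<^sup>2 + (cmod (W l $ p $ i))\<^sup>2) * (cmod z)\<^sup>2
      + (\<Sum>p\<in>UNIV - {i, j}. (cmod (W l $ j $ p))\<^sup>2 + (cmod (W l $ p $ j))\<^sup>2) / (cmod z)\<^sup>2" for l
    proof -
      have sd: "star_scalar S (1 / z) = 1 / star_scalar S z" by (cases S) simp_all
      have 1: "(\<Sum>p\<in>UNIV - {i, j}. (cmod ((star S ?E ** W l ** ?E) $ p $ i))\<^sup>2 + (cmod ((star S ?E ** W l ** ?E) $ p $ j))\<^sup>2)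
        = (\<Sum>p\<in>UNIV - {i, j}. (cmod (W l $ p $ i))\<^sup>2 * (cmod z)\<^sup>2 + (cmod (W l $ p $ j))\<^sup>2 / (cmod z)\<^sup>2)"
        using assms by (intro sum.cong) (auto simp: mult_elem_mat star_elem_mat_mult norm_mult norm_divide power_mult_distrib power_divide)
      have 2: "(\<Sum>p\<in>UNIV - {i, j}. (cmod ((star S ?E ** W l ** ?E) $ i $ p))\<^sup>2 + (cmod ((star S ?E ** W l ** ?E) $ j $ p))\<^sup>2)
        = (\<Sum>p\<in>UNIV - {i, j}. (cmod (W l $ i $ p))\<^sup>2 * (cmod z)\<^sup>2 + (cmod (W l $ j $ p))\<^sup>2 / (cmod z)\<^sup>2)"
        using assms by (intro sum.cong) (auto simp: mult_elem_mat star_elem_mat_mult norm_mult norm_divide power_mult_distrib power_divide sd)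
      have 3: "cmod ((star S ?E ** W l ** ?E) $ i $ j) = cmod (W l $ i $ j)"
        "cmod ((star S ?E ** W l ** ?E) $ j $ i) = cmod (W l $ j $ i)"
        using assms z by (auto simp: mult_elem_mat star_elem_mat_mult norm_mult norm_divide sd)
      show ?thesis
        unfolding norm_offdiag_split[OF assms, of "star S ?E ** W l ** ?E"] rest_offdiag_elem_mat[OF assms] 1 2 3
        by (simp add: sum.distrib sum_distrib_right sum_divide_distrib distrib_right add_divide_distrib)
    qed
    then show ?thesis
      unfolding cost_elem_mat W_def[symmetric]
      by (simp add: C_def gamma_def sum.distrib sum_distrib_right sum_divide_distrib distrib_right add_divide_distrib)
  qed
  ultimately show ?thesis using that unfolding W_def by blast
qed

text \<open>With \<open>y\<close> the square of the scale, the claim concerns the decrease of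
  \<open>\<gamma>1 * y + \<gamma>2 / y\<close> from its value at 1. At the clipped scales 1/2 and 2
  it is 3/4 of the larger weight minus 3 times the other, hence at least
  \<open>3/4 * (1 - 4 * \<sigma>D)\<close> of the larger one. In between, \<open>y\<close> is the
  exact minimizer.\<close>

lemma D_scale_descent:
  assumes \<gamma>: "0 \<le> \<gamma>1" "0 \<le> \<gamma>2" "\<gamma>1 + \<gamma>2 \<le> G" and G: "0 < G" and \<sigma>: "0 < \<sigma>D" "\<sigma>D < 1/4"
  shows "0 < D_scale \<sigma>D \<gamma>1 \<gamma>2" (is ?pos)
    and "(1 - 4 * \<sigma>D) / (8 * G) * (2 * (\<gamma>1 - \<gamma>2))\<^sup>2 \<le>
      \<gamma>1 + \<gamma>2 - (\<gamma>1 * (D_scale \<sigma>D \<gamma>1 \<gamma>2)\<^sup>2 + \<gamma>2 / (D_scale \<sigma>D \<gamma>1 \<gamma>2)\<^sup>2)" (is ?dec)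
proof -
  define e where "e = 1 - 4 * \<sigma>D"
  have e: "0 < e" "e \<le> 1" using \<sigma> by (simp_all add: e_def)
  have key: "e / (8 * G) * (2 * (\<gamma>1 - \<gamma>2))\<^sup>2 \<le> d" if "e * (\<gamma>1 - \<gamma>2)\<^sup>2 \<le> 2 * G * d" for d
  proof -
    have "e / (8 * G) * (2 * (\<gamma>1 - \<gamma>2))\<^sup>2 = e * (\<gamma>1 - \<gamma>2)\<^sup>2 / (2 * G)"
      by (simp only: power_mult_distrib) simp
    then show ?thesis using that G by (simp add: divide_le_eq mult_ac)
  qed
  \<comment> \<open>For the clipped cases, with \<open>t\<close> the larger weight: a decrease
    linear in \<open>t\<close> becomes quadratic in the difference of the weights, as
    \<open>t\<close> lies between that difference and \<open>G\<close>.\<close>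
  have linear: "e * (\<gamma>1 - \<gamma>2)\<^sup>2 \<le> 2 * G * d"
    if "\<bar>\<gamma>1 - \<gamma>2\<bar> \<le> t" "t \<le> G" "3/4 * e * t \<le> d" for d t
  proof -
    have "(\<gamma>1 - \<gamma>2)\<^sup>2 = \<bar>\<gamma>1 - \<gamma>2\<bar> * \<bar>\<gamma>1 - \<gamma>2\<bar>" by (simp add: power2_eq_square)
    also have "\<dots> \<le> t * G" using that by (intro mult_mono) auto
    finally have "e * (\<gamma>1 - \<gamma>2)\<^sup>2 \<le> e * (t * G)" using e by simp
    also have "\<dots> = (4/3 * G) * (3/4 * e * t)" by simp
    also have "\<dots> \<le> (4/3 * G) * d" using that(3) G by (intro mult_left_mono) auto
    also have "\<dots> \<le> 2 * G * d"
    proof -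
      have "0 \<le> 3/4 * e * t" using e that by simp
      then show ?thesis using that(3) G by (intro mult_right_mono) auto
    qed
    finally show ?thesis .
  qed
  consider (zero) "\<gamma>1 = 0" "\<gamma>2 = 0" | (inf) "\<gamma>1 = 0" "\<gamma>2 > 0"
    | (small) "\<gamma>1 > 0" "\<gamma>2 / \<gamma>1 < \<sigma>D" | (large) "\<gamma>1 > 0" "\<not> \<gamma>2 / \<gamma>1 < \<sigma>D" "\<gamma>2 / \<gamma>1 > 1 / \<sigma>D"
    | (mid) "\<gamma>1 > 0" "\<not> \<gamma>2 / \<gamma>1 < \<sigma>D" "\<not> \<gamma>2 / \<gamma>1 > 1 / \<sigma>D"
    using \<gamma> by fastforce
  then have "?pos \<and> ?dec"
  proof cases
    case zero
    then show ?thesis by (simp add: D_scale_def)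
  next
    case inf
    then have x: "D_scale \<sigma>D \<gamma>1 \<gamma>2 = 2" by (simp add: D_scale_def)
    have 1: "e * \<gamma>2 \<le> 1 * \<gamma>2" using e inf by (intro mult_right_mono) auto
    have "e / (8 * G) * (2 * (\<gamma>1 - \<gamma>2))\<^sup>2 \<le> \<gamma>1 + \<gamma>2 - (4 * \<gamma>1 + \<gamma>2 / 4)"
      by (rule key, rule linear[of \<gamma>2]) (use 1 inf \<gamma> in linarith)+
    then show ?thesis unfolding x e_def[symmetric] by (simp add: power2_eq_square mult.commute)
  next
    case small
    then have x: "D_scale \<sigma>D \<gamma>1 \<gamma>2 = 1/2" by (simp add: D_scale_def)
    have 1: "\<gamma>2 \<le> \<sigma>D * \<gamma>1" using small by (simp add: field_simps)
    have 2: "\<sigma>D * \<gamma>1 \<le> 1 * \<gamma>1" using \<sigma> small by (intro mult_right_mono) auto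
    have 3: "3/4 * e * \<gamma>1 = 3/4 * \<gamma>1 - 3 * (\<sigma>D * \<gamma>1)" by (simp add: e_def field_simps)
    have "e / (8 * G) * (2 * (\<gamma>1 - \<gamma>2))\<^sup>2 \<le> \<gamma>1 + \<gamma>2 - (\<gamma>1 / 4 + 4 * \<gamma>2)"
      by (rule key, rule linear[of \<gamma>1]) (use 1 2 3 \<gamma> in linarith)+
    then show ?thesis unfolding x e_def[symmetric] by (simp add: power2_eq_square mult.commute)
  next
    case large
    then have x: "D_scale \<sigma>D \<gamma>1 \<gamma>2 = 2" by (simp add: D_scale_def Let_def)
    have 1: "\<gamma>1 \<le> \<sigma>D * \<gamma>2" using large \<sigma> by (simp add: field_simps)
    have 2: "\<sigma>D * \<gamma>2 \<le> 1 * \<gamma>2" using \<sigma> \<gamma> by (intro mult_right_mono) auto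
    have 3: "3/4 * e * \<gamma>2 = 3/4 * \<gamma>2 - 3 * (\<sigma>D * \<gamma>2)" by (simp add: e_def field_simps)
    have "e / (8 * G) * (2 * (\<gamma>1 - \<gamma>2))\<^sup>2 \<le> \<gamma>1 + \<gamma>2 - (4 * \<gamma>1 + \<gamma>2 / 4)"
      by (rule key, rule linear[of \<gamma>2]) (use 1 2 3 \<gamma> in linarith)+
    then show ?thesis unfolding x e_def[symmetric] by (simp add: power2_eq_square mult.commute)
  next
    case mid
    define q where "q = \<gamma>2 / \<gamma>1"
    have q: "0 < q" using mid \<sigma> by (simp add: q_def)
    have x: "D_scale \<sigma>D \<gamma>1 \<gamma>2 = root 4 q" using mid by (simp add: D_scale_def Let_def q_def)
    define y where "y = (root 4 q)\<^sup>2"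
    have y: "0 < y" using q by (simp add: y_def)
    have "y\<^sup>2 = root 4 q ^ 4" by (simp add: y_def flip: power_mult)
    then have "\<gamma>2 = \<gamma>1 * y\<^sup>2" using q mid by (simp add: q_def)
    then have g2: "\<gamma>2 / y = \<gamma>1 * y" and diff: "\<gamma>1 - \<gamma>2 = \<gamma>1 * ((1 - y) * (1 + y))" and s: "\<gamma>1 + \<gamma>2 = \<gamma>1 * (1 + y\<^sup>2)"
      using y by (simp_all add: power2_eq_square algebra_simps)
    \<comment> \<open>The squared difference of the weights is the decrease
      \<open>\<gamma>1 * (1 - y)\<^sup>2\<close> times this factor, so an upper bound of the factor
      is what is missing.\<close>
    have "\<gamma>1 * (1 + y)\<^sup>2 \<le> 2 * G"
    proof -
      have "(1 + y)\<^sup>2 \<le> 2 * (1 + y\<^sup>2)" using zero_le_power2[of "1 - y"] by (simp add: power2_eq_square algebra_simps)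
      then have "\<gamma>1 * (1 + y)\<^sup>2 \<le> \<gamma>1 * (2 * (1 + y\<^sup>2))" using mid by (intro mult_left_mono) auto
      also have "\<dots> = 2 * (\<gamma>1 + \<gamma>2)" unfolding s by simp
      finally show ?thesis using \<gamma> by simp
    qed
    then have "(\<gamma>1 * (1 + y)\<^sup>2) * (\<gamma>1 * (1 - y)\<^sup>2) \<le> (2 * G) * (\<gamma>1 * (1 - y)\<^sup>2)"
      using mid by (intro mult_right_mono) auto
    then have "(\<gamma>1 - \<gamma>2)\<^sup>2 \<le> 2 * G * (\<gamma>1 * (1 - y)\<^sup>2)"
      unfolding diff by (simp add: power_mult_distrib power2_eq_square mult_ac)
    moreover have "e * (\<gamma>1 - \<gamma>2)\<^sup>2 \<le> 1 * (\<gamma>1 - \<gamma>2)\<^sup>2" using e by (intro mult_right_mono) auto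
    ultimately have "e * (\<gamma>1 - \<gamma>2)\<^sup>2 \<le> 2 * G * (\<gamma>1 * (1 - y)\<^sup>2)" by linarith
    moreover have "\<gamma>1 * (1 - y)\<^sup>2 = \<gamma>1 + \<gamma>2 - (\<gamma>1 * y + \<gamma>2 / y)"
      unfolding g2 s by (simp add: power2_eq_square algebra_simps)
    ultimately have "e / (8 * G) * (2 * (\<gamma>1 - \<gamma>2))\<^sup>2 \<le> \<gamma>1 + \<gamma>2 - (\<gamma>1 * y + \<gamma>2 / y)"
      by (intro key) simp
    then show ?thesis using q unfolding x e_def[symmetric] y_def[symmetric] by simp
  qed
  then show ?pos ?dec by auto
qed

text \<open>The gradient at the identity is \<open>(2 * (\<gamma>1 - \<gamma>2), 0)\<close>, the
  quantity squared in \<open>D_scale_descent\<close>. The cost bounds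
  \<open>\<gamma>1 + \<gamma>2\<close> because its constant part \<open>C\<close> is
  nonnegative.\<close>

lemma D_descent:
  fixes A :: "nat \<Rightarrow> complex^'n^'n" and X :: "complex^'m^'m"
  assumes ij: "i \<noteq> j" and G: "cost S L A (Y, X) \<le> G" "0 < G" and \<sigma>: "0 < \<sigma>D" "\<sigma>D < 1/4"
    and choice: "elem_choice S L A \<sigma>D \<sigma>Q Y X i j TD \<Psi>"
  shows "(1 - 4 * \<sigma>D) / (8 * G) * (elem_grad_norm (\<lambda>Z. cost S L A (Y, Z)) X i j TD)\<^sup>2
    \<le> cost S L A (Y, X) - cost S L A (Y, X ** elem_mat i j \<Psi>)"
proof -
  define W where "W = (\<lambda>l. star S X ** star S Y ** A l ** Y ** X)"
  define \<gamma>1 where "\<gamma>1 = gamma L W i j i"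
  define \<gamma>2 where "\<gamma>2 = gamma L W i j j"
  obtain C where C: "C \<ge> 0" "\<And>z. z \<noteq> 0 \<Longrightarrow> cost S L A (Y, X ** elem_mat i j (mat2 z 0 0 (1 / z))) =
    C + \<gamma>1 * (cmod z)\<^sup>2 + \<gamma>2 / (cmod z)\<^sup>2"
    using cost_diag_scaling[OF ij] unfolding \<gamma>1_def \<gamma>2_def W_def by metis
  have \<gamma>: "0 \<le> \<gamma>1" "0 \<le> \<gamma>2" by (simp_all add: \<gamma>1_def \<gamma>2_def gamma_nonneg)
  have cost1: "cost S L A (Y, X) = C + \<gamma>1 + \<gamma>2" using C(2)[of 1] by (simp add: elem_mat_1[OF ij])
  let ?h = "(\<lambda>\<Psi>. cost S L A (Y, X ** elem_mat i j \<Psi>)) \<circ> \<Psi>D"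
  let ?k = "\<lambda>p :: real \<times> real. C + \<gamma>1 * (p \<bullet> p) + \<gamma>2 / (p \<bullet> p)"
  have h: "?h p = ?k p" if "p \<noteq> 0" for p
  proof (cases p)
    case (Pair x y)
    with that have "Complex x y \<noteq> 0" by (auto simp: complex_eq_iff zero_prod_def)
    moreover have "(cmod (Complex x y))\<^sup>2 = p \<bullet> p" by (simp add: Pair cmod_power2 flip: power2_eq_square)
    ultimately show ?thesis using C(2)[of "Complex x y"] by (simp add: Pair \<Psi>D_def)
  qed
  have 1: "((\<lambda>p. p \<bullet> p) has_derivative (\<lambda>v. 2 * fst v)) (at (1 :: real, 0 :: real))"
    by (rule has_derivative_eq_rhs[OF has_derivative_inner[OF has_derivative_ident has_derivative_ident]])
       (simp add: fun_eq_iff)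
  have "((\<lambda>r. C + \<gamma>1 * r + \<gamma>2 / r) has_real_derivative \<gamma>1 - \<gamma>2) (at 1)"
    by (auto intro!: derivative_eq_intros)
  then have 2: "((\<lambda>r. C + \<gamma>1 * r + \<gamma>2 / r) has_derivative (\<lambda>s. (\<gamma>1 - \<gamma>2) * s)) (at ((1 :: real, 0 :: real) \<bullet> (1, 0)))"
    by (simp add: has_field_derivative_def)
  have "(?k has_derivative (\<lambda>v. v \<bullet> (2 * (\<gamma>1 - \<gamma>2), 0))) (at (1, 0))"
    by (rule has_derivative_eq_rhs[OF has_derivative_compose[OF 1 2]])
       (auto simp: fun_eq_iff)
  \<comment> \<open>The formula \<open>?k\<close> describes \<open>?h\<close> away from the
    parameter 0, which is enough near \<open>(1, 0)\<close>.\<close>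
  then have "(?h has_derivative (\<lambda>v. v \<bullet> (2 * (\<gamma>1 - \<gamma>2), 0))) (at (1, 0))"
  proof (rule has_derivative_transform_within_open)
    show "open (- {0 :: real \<times> real})" by (simp add: open_Compl)
    show "(1, 0) \<in> - {0 :: real \<times> real}" by (simp add: zero_prod_def)
    show "?k p = ?h p" if "p \<in> - {0}" for p using h that by simp
  qed
  then have "nabla ?h (1, 0) = (2 * (\<gamma>1 - \<gamma>2), 0)"
    by (intro nabla_eqI) (simp add: gderiv_def)
  then have grad: "(elem_grad_norm (\<lambda>Z. cost S L A (Y, Z)) X i j TD)\<^sup>2 = (2 * (\<gamma>1 - \<gamma>2))\<^sup>2"
    by (simp add: elem_grad_norm_def Let_def)
  define x where "x = D_scale \<sigma>D \<gamma>1 \<gamma>2"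
  have "\<Psi> = \<Psi>D (x, 0)"
    using choice by (simp add: elem_choice_def Let_def x_def \<gamma>1_def \<gamma>2_def W_def)
  moreover have "\<gamma>1 + \<gamma>2 \<le> G" using G(1) cost1 C(1) by simp
  note D = D_scale_descent[OF \<gamma> this G(2) \<sigma>, folded x_def]
  moreover have "?h (x, 0) = C + \<gamma>1 * x\<^sup>2 + \<gamma>2 / x\<^sup>2"
    using h[of "(x, 0)"] D(1) by (simp add: zero_prod_def power2_eq_square)
  ultimately show ?thesis unfolding grad cost1 using D(2) by simp
qed

section \<open>Rotations\<close>

lemma cmod_rotate:
  fixes c :: real and s x y :: complex
  assumes "c\<^sup>2 + (cmod s)\<^sup>2 = 1"
  shows "(cmod (of_real c * x + s * y))\<^sup>2 + (cmod (- cnj s * x + of_real c * y))\<^sup>2 = (cmod x)\<^sup>2 + (cmod y)\<^sup>2"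
proof -
  have "(cmod (of_real c * x + s * y))\<^sup>2 + (cmod (- cnj s * x + of_real c * y))\<^sup>2
    = (c\<^sup>2 + (cmod s)\<^sup>2) * ((cmod x)\<^sup>2 + (cmod y)\<^sup>2)"
    unfolding cmod_power2 by (simp add: power2_eq_square algebra_simps)
  then show ?thesis using assms by simp
qed

lemma parallelogram: "(cmod x)\<^sup>2 + (cmod y)\<^sup>2 = ((cmod (x + y))\<^sup>2 + (cmod (x - y))\<^sup>2) / 2"
  unfolding cmod_power2 by (simp add: power2_eq_square algebra_simps)

lemma quadform_3:
  fixes G :: "real^3^3"
  assumes "transpose G = G"
  shows "r_vec \<theta> \<phi> \<bullet> (G *v r_vec \<theta> \<phi>) =
    (cos (2 * \<theta>))\<^sup>2 * G $ 1 $ 1 - 2 * cos (2 * \<theta>) * sin (2 * \<theta>) * (G $ 1 $ 2 * cos \<phi> + G $ 1 $ 3 * sin \<phi>)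
    + (sin (2 * \<theta>))\<^sup>2 * (G $ 2 $ 2 * (cos \<phi>)\<^sup>2 + 2 * G $ 2 $ 3 * (cos \<phi> * sin \<phi>) + G $ 3 $ 3 * (sin \<phi>)\<^sup>2)"
proof -
  have "G $ b $ a = G $ a $ b" for a b
    using arg_cong[OF assms, of "\<lambda>M. M $ a $ b"] by (simp add: transpose_def)
  then have "G $ 2 $ 1 = G $ 1 $ 2" "G $ 3 $ 1 = G $ 1 $ 3" "G $ 3 $ 2 = G $ 2 $ 3" by auto
  then show ?thesis
    by (simp add: inner_vec_def matrix_vector_mult_def sum_3 r_vec_def power2_eq_square algebra_simps)
qed

lemma norm_r_vec: "norm (r_vec \<theta> \<phi>) = 1"
proof -
  have aux: "C * C + (S * c) * (S * c) + (S * s) * (S * s) = C\<^sup>2 + S\<^sup>2 * (c\<^sup>2 + s\<^sup>2)" for C S c s :: real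
    by (simp add: power2_eq_square algebra_simps)
  have "r_vec \<theta> \<phi> \<bullet> r_vec \<theta> \<phi> = 1"
    using aux[of "cos (2 * \<theta>)" "sin (2 * \<theta>)" "cos \<phi>" "sin \<phi>"]
    by (simp add: inner_vec_def sum_3 r_vec_def)
  then show ?thesis by (simp add: norm_eq_sqrt_inner)
qed

lemma transpose_Q_matrix: "transpose (Q_matrix S L W i j) = Q_matrix S L W i j"
  by (simp add: Q_matrix_def transpose_def vec_eq_iff mult.commute)

lemma quadform_Q_matrix:
  "r \<bullet> (Q_matrix S L W i j *v r) = Q_sign S / 2 *
    (\<Sum>l=1..L. (cmod (\<Sum>a\<in>UNIV. of_real (r $ a) * Q_vec S i j (W l) $ a))\<^sup>2)"
proof -
  have "(cmod (\<Sum>a\<in>UNIV. of_real (r $ a) * z $ a))\<^sup>2 =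
    (\<Sum>a\<in>UNIV. \<Sum>b\<in>UNIV. r $ a * Re (z $ a * cnj (z $ b)) * r $ b)" for z :: "complex^3"
    unfolding cmod_power2 sum_3 by (simp add: power2_eq_square algebra_simps)
  then have "(\<Sum>l=1..L. (cmod (\<Sum>a\<in>UNIV. of_real (r $ a) * Q_vec S i j (W l) $ a))\<^sup>2) =
     (\<Sum>a\<in>UNIV. \<Sum>b\<in>UNIV. \<Sum>l=1..L. r $ a * Re (Q_vec S i j (W l) $ a * cnj (Q_vec S i j (W l) $ b)) * r $ b)"
    by (simp add: sum_3 sum.distrib)
  moreover have "r \<bullet> (Q_matrix S L W i j *v r) = Q_sign S / 2 *
    (\<Sum>a\<in>UNIV. \<Sum>b\<in>UNIV. \<Sum>l=1..L. r $ a * Re (Q_vec S i j (W l) $ a * cnj (Q_vec S i j (W l) $ b)) * r $ b)"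
    by (simp add: inner_vec_def matrix_vector_mult_def Q_matrix_def sum_distrib_left sum_distrib_right mult_ac
        del: complex_cnj_mult times_complex.sel)
  ultimately show ?thesis by simp
qed

lemma Q_matrix_11: "Q_matrix S L W i j $ 1 $ 1 = Q_sign S / 2 * (\<Sum>l=1..L. (cmod (Q_vec S i j (W l) $ 1))\<^sup>2)"
  by (simp add: Q_matrix_def cmod_power2) (simp add: power2_eq_square)

definition rotation_block :: "real \<Rightarrow> complex \<Rightarrow> complex^2^2" where
  "rotation_block c s = mat2 (of_real c) (- s) (cnj s) (of_real c)"

lemma \<Psi>Q_sphere_coords:
  "\<Psi>Q (sphere_coords \<theta> \<phi>) = rotation_block (cos \<theta>) (of_real (sin \<theta>) * cis \<phi>)"
proof -
  have "Complex (sin \<theta> * cos \<phi>) (sin \<theta> * sin \<phi>) = of_real (sin \<theta>) * cis \<phi>"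
    and "Complex (sin \<theta> * cos \<phi>) (- (sin \<theta> * sin \<phi>)) = cnj (of_real (sin \<theta>) * cis \<phi>)"
    by (simp_all add: complex_eq_iff)
  then show ?thesis by (simp add: \<Psi>Q_def sphere_coords_def rotation_block_def)
qed

text \<open>Rows and columns meeting \<open>{i, j}\<close> once keep their joint norm, so only the 2
  by 2 block counts. For \<open>Trans\<close> the difference of its off-diagonal entries is
  invariant; for \<open>Herm\<close> its Frobenius norm and its trace are. The parallelogram
  identity then leaves the first component of \<open>Q_vec\<close>.\<close>

lemma norm_offdiag_rotation:
  fixes W :: "complex^'m^'m" and S :: star_kind and c :: real and s :: complex
  assumes ij: "i \<noteq> j" and "c\<^sup>2 + (cmod s)\<^sup>2 = 1"
  defines "V \<equiv> star S (elem_mat i j (rotation_block c s)) ** W ** elem_mat i j (rotation_block c s)"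
  shows "(norm (offdiag V))\<^sup>2 - (norm (offdiag W))\<^sup>2 =
    - (Q_sign S / 2) * ((cmod (Q_vec S i j V $ 1))\<^sup>2 - (cmod (Q_vec S i j W $ 1))\<^sup>2)"
proof -
  note V = V_def rotation_block_def mult_elem_mat[OF ij] star_elem_mat_mult[OF ij]
  have rot: "(cmod (of_real c * x + s * y))\<^sup>2 + (cmod (- cnj s * x + of_real c * y))\<^sup>2 = (cmod x)\<^sup>2 + (cmod y)\<^sup>2"
    "(cmod (of_real c * x + cnj s * y))\<^sup>2 + (cmod (- s * x + of_real c * y))\<^sup>2 = (cmod x)\<^sup>2 + (cmod y)\<^sup>2" for x y
    using cmod_rotate[of c s x y] cmod_rotate[of c "cnj s" x y] assms(2) by simp_all
  have 1: "(cmod (V $ p $ i))\<^sup>2 + (cmod (V $ p $ j))\<^sup>2 = (cmod (W $ p $ i))\<^sup>2 + (cmod (W $ p $ j))\<^sup>2"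
    if "p \<noteq> i" "p \<noteq> j" for p
    using ij that rot(2)[of "W $ p $ i" "W $ p $ j"] by (simp add: V mult.commute)
  have 2: "(cmod (V $ i $ p))\<^sup>2 + (cmod (V $ j $ p))\<^sup>2 = (cmod (W $ i $ p))\<^sup>2 + (cmod (W $ j $ p))\<^sup>2"
    if "p \<noteq> i" "p \<noteq> j" for p
    using ij that rot[of "W $ i $ p" "W $ j $ p"] by (cases S) (simp_all add: V)
  have "(\<Sum>p\<in>UNIV - {i, j}. (cmod (V $ p $ i))\<^sup>2 + (cmod (V $ p $ j))\<^sup>2) =
    (\<Sum>p\<in>UNIV - {i, j}. (cmod (W $ p $ i))\<^sup>2 + (cmod (W $ p $ j))\<^sup>2)"
    "(\<Sum>p\<in>UNIV - {i, j}. (cmod (V $ i $ p))\<^sup>2 + (cmod (V $ j $ p))\<^sup>2) =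
    (\<Sum>p\<in>UNIV - {i, j}. (cmod (W $ i $ p))\<^sup>2 + (cmod (W $ j $ p))\<^sup>2)"
    by (rule sum.cong[OF refl 1] sum.cong[OF refl 2]; simp)+
  then have diff: "(norm (offdiag V))\<^sup>2 - (norm (offdiag W))\<^sup>2 =
     ((cmod (V $ i $ j))\<^sup>2 + (cmod (V $ j $ i))\<^sup>2) - ((cmod (W $ i $ j))\<^sup>2 + (cmod (W $ j $ i))\<^sup>2)"
    unfolding norm_offdiag_split[OF ij]
    using rest_offdiag_elem_mat[OF ij, of S "rotation_block c s" W] by (simp add: V_def)
  have cs: "of_real c * of_real c + s * cnj s = 1"
  proof -
    have "complex_of_real (c\<^sup>2 + (cmod s)\<^sup>2) = 1" using assms(2) by simp
    then show ?thesis unfolding of_real_add complex_norm_square by (simp add: power2_eq_square)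
  qed
  show ?thesis
  proof (cases S)
    case Trans
    have "V $ i $ j - V $ j $ i = (of_real c * of_real c + s * cnj s) * (W $ i $ j - W $ j $ i)"
      using ij by (simp add: V Trans algebra_simps)
    then have skew: "V $ i $ j - V $ j $ i = W $ i $ j - W $ j $ i" by (simp only: cs mult_1)
    show ?thesis
      unfolding diff parallelogram[of "V $ i $ j"] parallelogram[of "W $ i $ j"] skew
      by (simp add: Q_sign_def Q_vec_def Trans field_simps)
  next
    case Herm
    define U where "U = W ** elem_mat i j (rotation_block c s)"
    have V': "V = star S (elem_mat i j (rotation_block c s)) ** U" by (simp add: V_def U_def matrix_mul_assoc)
    have "(cmod (V $ i $ q))\<^sup>2 + (cmod (V $ j $ q))\<^sup>2 = (cmod (U $ i $ q))\<^sup>2 + (cmod (U $ j $ q))\<^sup>2" for q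
      using rot(1)[of "U $ i $ q" "U $ j $ q"] ij
      by (simp add: V' star_elem_mat_mult[OF ij] rotation_block_def Herm)
    moreover have "(cmod (U $ p $ i))\<^sup>2 + (cmod (U $ p $ j))\<^sup>2 = (cmod (W $ p $ i))\<^sup>2 + (cmod (W $ p $ j))\<^sup>2" for p
      using rot(2)[of "W $ p $ i" "W $ p $ j"] ij
      by (simp add: U_def mult_elem_mat[OF ij] rotation_block_def mult.commute)
    ultimately have frob: "(cmod (V $ i $ i))\<^sup>2 + (cmod (V $ j $ i))\<^sup>2 + ((cmod (V $ i $ j))\<^sup>2 + (cmod (V $ j $ j))\<^sup>2) =
      (cmod (W $ i $ i))\<^sup>2 + (cmod (W $ i $ j))\<^sup>2 + ((cmod (W $ j $ i))\<^sup>2 + (cmod (W $ j $ j))\<^sup>2)"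
      by (smt (verit))
    have "V $ j $ j + V $ i $ i = (of_real c * of_real c + s * cnj s) * (W $ j $ j + W $ i $ i)"
      using ij by (simp add: V Herm algebra_simps)
    then have tr: "V $ j $ j + V $ i $ i = W $ j $ j + W $ i $ i" by (simp add: cs)
    have "((cmod (V $ j $ j))\<^sup>2 + (cmod (V $ i $ i))\<^sup>2) - ((cmod (W $ j $ j))\<^sup>2 + (cmod (W $ i $ i))\<^sup>2) =
      ((cmod (V $ j $ j - V $ i $ i))\<^sup>2 - (cmod (W $ j $ j - W $ i $ i))\<^sup>2) / 2"
      unfolding parallelogram[of "V $ j $ j"] parallelogram[of "W $ j $ j"] tr by (simp add: field_simps)
    moreover have "((cmod (V $ i $ j))\<^sup>2 + (cmod (V $ j $ i))\<^sup>2) - ((cmod (W $ i $ j))\<^sup>2 + (cmod (W $ j $ i))\<^sup>2)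
      = - (((cmod (V $ j $ j))\<^sup>2 + (cmod (V $ i $ i))\<^sup>2) - ((cmod (W $ j $ j))\<^sup>2 + (cmod (W $ i $ i))\<^sup>2))"
      using frob by argo
    moreover have Q: "Q_sign S = 1" "Q_vec S i j M $ 1 = M $ j $ j - M $ i $ i" for M :: "complex^'m^'m"
      by (simp_all add: Q_sign_def Q_vec_def Herm)
    ultimately show ?thesis unfolding diff Q by argo
  qed
qed

text \<open>Congruence by a unitary block of determinant 1 acts on \<open>Q_vec\<close> as a
  rotation of three-space, through the double cover of SO(3) by SU(2); hence the doubled angles.
  \<open>r_vec\<close> is the first row of that rotation.\<close>

lemma Q_vec_rotation:
  assumes ij: "i \<noteq> j"
  shows "Q_vec S i j (star S (elem_mat i j (\<Psi>Q (sphere_coords \<theta> \<phi>))) ** W ** elem_mat i j (\<Psi>Q (sphere_coords \<theta> \<phi>))) $ 1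
    = (\<Sum>a\<in>UNIV. of_real (r_vec \<theta> \<phi> $ a) * Q_vec S i j W $ a)"
proof -
  \<comment> \<open>With the phases as symbols \<open>u\<close> and \<open>w\<close>, both sides
    become polynomials that agree modulo \<open>u * w = 1\<close> and the equations for
    \<open>r2\<close> and \<open>r3 * I\<close>.\<close>
  define c where "c = complex_of_real (cos \<theta>)"
  define s where "s = complex_of_real (sin \<theta>)"
  define r2 where "r2 = complex_of_real (r_vec \<theta> \<phi> $ 2)"
  define r3 where "r3 = complex_of_real (r_vec \<theta> \<phi> $ 3)"
  define I where "I = \<i>"
  define u where "u = cis \<phi>"
  define w where "w = cis (- \<phi>)"
  have cn: "cnj c = c" "cnj s = s" "cnj u = w" "cnj w = u" by (simp_all add: c_def s_def u_def w_def cis_cnj)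
  have r1: "complex_of_real (r_vec \<theta> \<phi> $ 1) = c * c - s * s"
    by (simp add: r_vec_def c_def s_def cos_double power2_eq_square)
  have uw: "u * w = 1" by (simp add: u_def w_def cis_mult)
  have r2: "r2 = - (s * c * (u + w))"
    by (simp add: r2_def r_vec_def c_def s_def u_def w_def sin_double complex_eq_iff)
  have r3: "r3 * I = - (s * c * (u - w))"
    by (simp add: r3_def r_vec_def c_def s_def u_def w_def I_def sin_double complex_eq_iff)
  show ?thesis
  proof (cases S)
    case Trans
    have 1: "Q_vec S i j (star S (elem_mat i j (\<Psi>Q (sphere_coords \<theta> \<phi>))) ** W ** elem_mat i j (\<Psi>Q (sphere_coords \<theta> \<phi>))) $ 1
      = (c * W$i$j + s * w * W$j$j) * c - (c * W$i$i + s * w * W$j$i) * (s * u) +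
        ((c * W$j$i - s * u * W$i$i) * c + (c * W$j$j - s * u * W$i$j) * (s * w))"
      using ij unfolding \<Psi>Q_sphere_coords
      by (simp add: Q_vec_def Trans mult_elem_mat[OF ij] star_elem_mat_mult[OF ij] rotation_block_def cis_cnj
          cn flip: c_def s_def u_def w_def)
    have 2: "(\<Sum>a\<in>UNIV. of_real (r_vec \<theta> \<phi> $ a) * Q_vec S i j W $ a)
      = (c * c - s * s) * (W$i$j + W$j$i) + r2 * (W$i$i - W$j$j) + r3 * (I * (W$i$i + W$j$j))"
      unfolding sum_3 by (simp add: r1 Q_vec_def Trans flip: r2_def r3_def I_def)
    show ?thesis unfolding 1 2 using uw r2 r3 by algebra
  next
    case Herm
    have 1: "Q_vec S i j (star S (elem_mat i j (\<Psi>Q (sphere_coords \<theta> \<phi>))) ** W ** elem_mat i j (\<Psi>Q (sphere_coords \<theta> \<phi>))) $ 1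
      = (c * W$j$j - s * w * W$i$j) * c - (c * W$j$i - s * w * W$i$i) * (s * u) -
        ((c * W$i$i + s * u * W$j$i) * c + (c * W$i$j + s * u * W$j$j) * (s * w))"
      using ij unfolding \<Psi>Q_sphere_coords
      by (simp add: Q_vec_def Herm mult_elem_mat[OF ij] star_elem_mat_mult[OF ij] rotation_block_def cis_cnj
          cn flip: c_def s_def u_def w_def)
    have 2: "(\<Sum>a\<in>UNIV. of_real (r_vec \<theta> \<phi> $ a) * Q_vec S i j W $ a)
      = (c * c - s * s) * (W$j$j - W$i$i) + r2 * (W$i$j + W$j$i) + r3 * (- I * (W$i$j - W$j$i))"
      unfolding sum_3 by (simp add: r1 Q_vec_def Herm flip: r2_def r3_def I_def)
    show ?thesis unfolding 1 2 using uw r2 r3 by algebra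
  qed
qed

lemma cost_rotation:
  fixes A :: "nat \<Rightarrow> complex^'n^'n" and X :: "complex^'m^'m" and Y :: "complex^'m^'n"
    and S :: star_kind and L :: nat
  assumes ij: "i \<noteq> j"
  defines "G \<equiv> Q_matrix S L (\<lambda>l. star S X ** star S Y ** A l ** Y ** X) i j"
  shows "cost S L A (Y, X ** elem_mat i j (\<Psi>Q (sphere_coords \<theta> \<phi>))) =
    cost S L A (Y, X) - (r_vec \<theta> \<phi> \<bullet> (G *v r_vec \<theta> \<phi>) - G $ 1 $ 1)"
proof -
  define W where "W l = star S X ** star S Y ** A l ** Y ** X" for l
  let ?E = "elem_mat i j (\<Psi>Q (sphere_coords \<theta> \<phi>))"
  have cs: "(cos \<theta>)\<^sup>2 + (cmod (of_real (sin \<theta>) * cis \<phi>))\<^sup>2 = 1" by (simp add: norm_mult)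
  have cost: "cost S L A (Y, X) = (\<Sum>l=1..L. (norm (offdiag (W l)))\<^sup>2)"
    by (simp add: cost_def W_def star_mult matrix_mul_assoc)
  have "cost S L A (Y, X ** ?E) - cost S L A (Y, X) =
    (\<Sum>l=1..L. (norm (offdiag (star S ?E ** W l ** ?E)))\<^sup>2 - (norm (offdiag (W l)))\<^sup>2)"
    by (simp add: cost cost_elem_mat W_def sum_subtractf)
  also have "\<dots> = (\<Sum>l=1..L. - (Q_sign S / 2) *
     ((cmod (\<Sum>a\<in>UNIV. of_real (r_vec \<theta> \<phi> $ a) * Q_vec S i j (W l) $ a))\<^sup>2 - (cmod (Q_vec S i j (W l) $ 1))\<^sup>2))"
    unfolding Q_vec_rotation[OF ij, symmetric] \<Psi>Q_sphere_coords
    by (intro sum.cong refl norm_offdiag_rotation[OF ij cs])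
  also have "\<dots> = - (r_vec \<theta> \<phi> \<bullet> (G *v r_vec \<theta> \<phi>) - G $ 1 $ 1)"
    unfolding G_def quadform_Q_matrix Q_matrix_11 W_def
    by (simp add: sum_distrib_left sum_subtractf algebra_simps sum_negf)
  finally show ?thesis by simp
qed

text \<open>By compactness the form has a maximizer \<open>q\<close> on the sphere, with value
  \<open>m\<close>. Then \<open>B = m I - G\<close> is positive semidefinite with
  \<open>q \<bullet> B q = 0\<close>, and moving \<open>q\<close> against \<open>B q\<close> shows
  \<open>B q = 0\<close>. So \<open>m\<close> is an eigenvalue and is dominated by the one of
  \<open>u\<close>.\<close>

lemma top_unit_eigvec_Rayleigh:
  fixes G :: "real^'a^'a"
  assumes sym: "transpose G = G" and u: "top_unit_eigvec G u" and r: "norm r = 1"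
  shows "r \<bullet> (G *v r) \<le> u \<bullet> (G *v u)"
proof -
  have "continuous_on (sphere 0 1) (\<lambda>x. x \<bullet> (G *v x))"
    by (intro continuous_on_inner continuous_on_id linear_continuous_on matrix_vector_mul_bounded_linear)
  moreover have "r \<in> sphere 0 1" using r by simp
  ultimately obtain q where q: "norm q = 1" "\<And>x. norm x = 1 \<Longrightarrow> x \<bullet> (G *v x) \<le> q \<bullet> (G *v q)"
    using continuous_attains_sup[of "sphere 0 1" "\<lambda>x. x \<bullet> (G *v x)"] compact_sphere[of 0 1] by auto
  define m where "m = q \<bullet> (G *v q)"
  define B where "B x = m *\<^sub>R x - G *v x" for x
  have B_lin: "B (x + y) = B x + B y" "B (c *\<^sub>R x) = c *\<^sub>R B x" for x y c
    by (simp_all add: B_def matrix_vector_right_distrib algebra_simps matrix_vector_mult_scaleR)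
  have symB: "x \<bullet> B y = y \<bullet> B x" for x y
    using dot_lmul_matrix[of x G y] sym
    by (simp add: B_def inner_diff_right inner_commute vector_transpose_matrix flip: transpose_matrix_vector)
  have pos: "0 \<le> x \<bullet> B x" for x
  proof (cases "x = 0")
    case False
    define y where "y = (1 / norm x) *\<^sub>R x"
    have "norm y = 1" using False by (simp add: y_def)
    then have "0 \<le> y \<bullet> B y"
      using q(2)[of y] by (simp add: B_def m_def inner_diff_right power2_norm_eq_inner[symmetric])
    also have "y \<bullet> B y = (1 / norm x)\<^sup>2 * (x \<bullet> B x)" by (simp add: y_def B_lin power2_eq_square)
    finally show ?thesis using False by (simp add: zero_le_mult_iff)
  qed (simp add: B_def)
  have qBq: "q \<bullet> B q = 0" using q(1) by (simp add: B_def m_def inner_diff_right power2_norm_eq_inner[symmetric])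
  define w where "w = B q"
  have "2 * (w \<bullet> w) \<le> t * (w \<bullet> B w)" if "t > 0" for t
  proof -
    have "0 \<le> (q + (- t) *\<^sub>R w) \<bullet> B (q + (- t) *\<^sub>R w)" by (rule pos)
    also have "\<dots> = t * (t * (w \<bullet> B w) - 2 * (w \<bullet> w))"
      unfolding B_lin by (simp add: inner_add_left inner_add_right qBq[folded w_def] symB[of q w] algebra_simps flip: w_def)
    finally show ?thesis using that by (simp add: zero_le_mult_iff)
  qed
  note small = this
  have "w \<bullet> w \<le> 0"
  proof (rule ccontr)
    assume "\<not> w \<bullet> w \<le> 0"
    then have ww: "w \<bullet> w > 0" by linarith
    \<comment> \<open>\<open>t = 1\<close> makes \<open>w \<bullet> B w\<close> positive; the
      quotient chosen next as \<open>t\<close> then gives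
      \<open>2 * (w \<bullet> w) \<le> w \<bullet> w\<close>.\<close>
    have "2 * (w \<bullet> w) \<le> w \<bullet> B w" using small[of 1] by simp
    with ww have "w \<bullet> B w > 0" by linarith
    then show False using small[of "(w \<bullet> w) / (w \<bullet> B w)"] ww by simp
  qed
  then have "w = 0" by (metis inner_gt_zero_iff not_le)
  then have "G *v q = m *\<^sub>R q" by (simp add: w_def B_def)
  then have "eigval G m" using q(1) by (auto simp: eigval_def intro!: exI[of _ q])
  then obtain \<mu> where "m \<le> \<mu>" "G *v u = \<mu> *\<^sub>R u" "norm u = 1"
    using u unfolding top_unit_eigvec_def by blast
  then show ?thesis using q(2)[OF r] by (simp add: m_def power2_norm_eq_inner[symmetric])
qed

text \<open>The angle \<psi> is the direction of \<open>v\<close>, in which the quadratic form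
  changes fastest at the first axis. In the eigenvector branch it has to be constructed and the
  Rayleigh bound applies; in the other branch it is \<phi>.\<close>

lemma Q_choice_maximal:
  assumes sym: "transpose G = G" and choice: "Q_choice \<sigma>Q G \<theta> \<phi>"
  obtains \<psi> where
    "(cos \<psi>, sin \<psi>) = (1 / norm (G $ 1 $ 2, G $ 1 $ 3)) *\<^sub>R (G $ 1 $ 2, G $ 1 $ 3) \<or> (G $ 1 $ 2, G $ 1 $ 3) = 0"
    "\<And>t. t \<in> {-pi/4..pi/4} \<Longrightarrow> r_vec t \<psi> \<bullet> (G *v r_vec t \<psi>) \<le> r_vec \<theta> \<phi> \<bullet> (G *v r_vec \<theta> \<phi>)"
proof -
  define v where "v = (G $ 1 $ 2, G $ 1 $ 3)"
  obtain u where u: "top_unit_eigvec G u"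
    and cases: "if \<bar>v \<bullet> (u $ 2, u $ 3)\<bar> \<ge> \<sigma>Q * norm v * norm (u $ 2, u $ 3)
        then r_vec \<theta> \<phi> = u
        else (cos \<phi>, sin \<phi>) = (1 / norm v) *\<^sub>R v \<and>
             is_arg_max (\<lambda>t. r_vec t \<phi> \<bullet> (G *v r_vec t \<phi>)) (\<lambda>t. t \<in> {-pi/4..pi/4}) \<theta>"
    using choice unfolding Q_choice_def Let_def v_def by blast
  show ?thesis
  \<comment> \<open>Where this equality fails, the second branch of the choice must have been
    taken.\<close>
  proof (cases "r_vec \<theta> \<phi> = u")
    case True
    have "\<exists>\<psi>. v = 0 \<or> (cos \<psi>, sin \<psi>) = (1 / norm v) *\<^sub>R v"
    proof (cases "v = 0")
      case False
      define w where "w = (1 / norm v) *\<^sub>R v"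
      have "norm w = 1" using False by (simp add: w_def)
      then have "(fst w)\<^sup>2 + (snd w)\<^sup>2 = 1" by (simp add: norm_prod_def)
      then show ?thesis unfolding w_def[symmetric] using sincos_total_2pi by (metis prod.collapse)
    qed simp
    then show ?thesis
      using that top_unit_eigvec_Rayleigh[OF sym u norm_r_vec] True unfolding v_def by blast
  next
    case False
    then have "(cos \<phi>, sin \<phi>) = (1 / norm v) *\<^sub>R v"
      and "is_arg_max (\<lambda>t. r_vec t \<phi> \<bullet> (G *v r_vec t \<phi>)) (\<lambda>t. t \<in> {-pi/4..pi/4}) \<theta>"
      using cases by (auto split: if_splits)
    then show ?thesis
      using that[of \<phi>] by (auto simp: v_def is_arg_max_def not_less)
  qed
qed

text \<open>A trial angle \<open>t\<close> with \<open>sin (2 * t) = - a\<close> gains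
  \<open>2 * cos (2 * t) * a * v\<close> to first order, with \<open>v\<close> the norm on the left.
  Bounded entries limit the second-order loss to \<open>5 * g * a\<^sup>2\<close>.\<close>

lemma Q_choice_descent:
  assumes sym: "transpose G = G" and choice: "Q_choice \<sigma>Q G \<theta> \<phi>"
    and bound: "\<And>a b. \<bar>G $ a $ b\<bar> \<le> g" and g: "0 < g"
  shows "(norm (G $ 1 $ 2, G $ 1 $ 3))\<^sup>2 / (20 * g) \<le> r_vec \<theta> \<phi> \<bullet> (G *v r_vec \<theta> \<phi>) - G $ 1 $ 1"
proof -
  define v where "v = norm (G $ 1 $ 2, G $ 1 $ 3)"
  obtain \<psi> where \<psi>: "(cos \<psi>, sin \<psi>) = (1 / v) *\<^sub>R (G $ 1 $ 2, G $ 1 $ 3) \<or> (G $ 1 $ 2, G $ 1 $ 3) = 0"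
    and max: "\<And>t. t \<in> {-pi/4..pi/4} \<Longrightarrow> r_vec t \<psi> \<bullet> (G *v r_vec t \<psi>) \<le> r_vec \<theta> \<phi> \<bullet> (G *v r_vec \<theta> \<phi>)"
    using Q_choice_maximal[OF sym choice] unfolding v_def by metis
  have "v \<le> 2 * g"
    using norm_Pair_le[of "G $ 1 $ 2" "G $ 1 $ 3"] bound[of 1 2] bound[of 1 3] by (simp add: v_def)
  have v2: "v\<^sup>2 = (G $ 1 $ 2)\<^sup>2 + (G $ 1 $ 3)\<^sup>2" by (simp add: v_def norm_prod_def)
  have dir: "G $ 1 $ 2 * cos \<psi> + G $ 1 $ 3 * sin \<psi> = v"
  proof (cases "v = 0")
    case True
    then show ?thesis using v2 by simp
  next
    case False
    then have "cos \<psi> = G $ 1 $ 2 / v" "sin \<psi> = G $ 1 $ 3 / v" using \<psi> by (auto simp: v_def)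
    then have "G $ 1 $ 2 * cos \<psi> + G $ 1 $ 3 * sin \<psi> = v\<^sup>2 / v"
      unfolding v2 by (simp add: add_divide_distrib power2_eq_square)
    then show ?thesis by (simp add: power2_eq_square)
  qed
  \<comment> \<open>Maximizes \<open>a * v - 5 * g * a\<^sup>2\<close>, with value
    \<open>v\<^sup>2 / (20 * g)\<close>. As \<open>a \<le> 1/5\<close>, the cosine stays above 1/2
    and the trial angle is allowed.\<close>
  define a where "a = v / (10 * g)"
  have a: "0 \<le> a" "a \<le> 1/5" using \<open>v \<le> 2 * g\<close> g by (simp_all add: a_def v_def)
  define t where "t = - arcsin a / 2"
  have "arcsin a \<le> arcsin 1" and "0 \<le> arcsin a"
    using a arcsin_le_arcsin[of a 1] arcsin_le_arcsin[of 0 a] by auto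
  then have t: "t \<in> {-pi/4..pi/4}" using pi_gt_zero by (simp add: t_def)
  have s: "sin (2 * t) = - a" and c: "cos (2 * t) = sqrt (1 - a\<^sup>2)"
    using a by (simp_all add: t_def cos_arcsin)
  have "a\<^sup>2 \<le> (1/5)\<^sup>2" using a by (intro power_mono) auto
  then have "1/2 \<le> cos (2 * t)" unfolding c by (intro real_le_rsqrt) (simp add: power2_eq_square)
  have c2: "(cos (2 * t))\<^sup>2 = 1 - a\<^sup>2" using sin_cos_squared_add[of "2 * t"] by (simp add: s)
  let ?N = "G $ 2 $ 2 * (cos \<psi>)\<^sup>2 + 2 * G $ 2 $ 3 * (cos \<psi> * sin \<psi>) + G $ 3 $ 3 * (sin \<psi>)\<^sup>2"
  have "\<bar>?N\<bar> \<le> \<bar>G $ 2 $ 2\<bar> * (cos \<psi>)\<^sup>2 + 2 * (\<bar>G $ 2 $ 3\<bar> * (\<bar>cos \<psi>\<bar> * \<bar>sin \<psi>\<bar>)) + \<bar>G $ 3 $ 3\<bar> * (sin \<psi>)\<^sup>2"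
    by (intro order_trans[OF abs_triangle_ineq] add_mono) (simp_all add: abs_mult)
  also have "\<dots> \<le> g * 1 + 2 * (g * (1 * 1)) + g * 1"
    using bound g by (intro add_mono mult_mono order_refl) (auto simp: abs_square_le_1 power_le_one_iff)
  finally have N: "\<bar>?N\<bar> \<le> 4 * g" by simp
  have "v\<^sup>2 / (20 * g) = a * v - 5 * g * a\<^sup>2"
    using g by (simp add: a_def power2_eq_square field_simps)
  also have "\<dots> \<le> 2 * cos (2 * t) * a * v - a\<^sup>2 * G $ 1 $ 1 + a\<^sup>2 * ?N"
  proof -
    have "1 * (a * v) \<le> (2 * cos (2 * t)) * (a * v)"
      using \<open>1/2 \<le> cos (2 * t)\<close> a by (intro mult_right_mono mult_nonneg_nonneg) (auto simp: v_def)
    moreover have "a\<^sup>2 * (G $ 1 $ 1 - ?N) \<le> a\<^sup>2 * (5 * g)"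
      using N bound[of 1 1] by (intro mult_left_mono) auto
    ultimately show ?thesis by (simp add: algebra_simps)
  qed
  also have "\<dots> = r_vec t \<psi> \<bullet> (G *v r_vec t \<psi>) - G $ 1 $ 1"
    unfolding quadform_3[OF sym] dir c2 s by (simp add: algebra_simps)
  also have "\<dots> \<le> r_vec \<theta> \<phi> \<bullet> (G *v r_vec \<theta> \<phi>) - G $ 1 $ 1" using max[OF t] by simp
  finally show ?thesis unfolding v_def .
qed

lemma GDERIV_nabla:
  fixes h :: "'a::euclidean_space \<Rightarrow> real"
  assumes "(h has_derivative h') (at z)"
  shows "GDERIV h z :> nabla h z"
proof -
  have "GDERIV h z :> adjoint h' 1"
    using assms by (simp add: gderiv_def adjoint_works[OF has_derivative_linear[OF assms]])
  then show ?thesis using nabla_eqI by metis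
qed

text \<open>The matrix is affine in the three real parameters, also off the sphere; \<open>D\<close>
  is its linear part. The extension needed by \<open>sphere_grad\<close> is therefore
  smooth.\<close>

lemma elem_mat_\<Psi>Q_has_derivative:
  assumes "i \<noteq> j"
  obtains D where "((\<lambda>q. elem_mat i j (\<Psi>Q q)) has_derivative D) (at q)"
proof -
  define D :: "real \<times> real \<times> real \<Rightarrow> complex^'a^'a" where
    "D = (\<lambda>q. elem_mat i j (\<Psi>Q q) - elem_mat i j (\<Psi>Q (0, 0, 0)))"
  have Z: "Complex 0 0 = 0" by (simp add: complex_eq_iff)
  have D: "D (c, s1, s2) $ a $ b = (if a = i \<and> b = i then of_real c else if a = i \<and> b = j then - Complex s1 s2
      else if a = j \<and> b = i then Complex s1 (- s2) else if a = j \<and> b = j then of_real c else 0)" for c s1 s2 a b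
    using assms by (simp add: D_def elem_mat_def \<Psi>Q_def Z)
  have "linear D"
  proof (rule linearI)
    fix p q :: "real \<times> real \<times> real" and r :: real
    obtain c s1 s2 c' s1' s2' where pq: "p = (c, s1, s2)" "q = (c', s1', s2')"
      by (metis prod.collapse)
    have "D (p + q) $ a $ b = D p $ a $ b + D q $ a $ b \<and> D (r *\<^sub>R p) $ a $ b = r *\<^sub>R D p $ a $ b" for a b
    proof -
      consider "a = i" "b = i" | "a = i" "b = j" | "a = j" "b = i" | "a = j" "b = j"
        | "a \<noteq> i" "a \<noteq> j" | "b \<noteq> i" "b \<noteq> j" by blast
      then show ?thesis by cases (use assms in \<open>simp_all add: pq D complex_eq_iff\<close>)
    qed
    then show "D (p + q) = D p + D q" "D (r *\<^sub>R p) = r *\<^sub>R D p"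
      by (simp_all add: vec_eq_iff)
  qed
  then have "((\<lambda>q. D q + elem_mat i j (\<Psi>Q (0, 0, 0))) has_derivative (\<lambda>q. D q + 0)) (at q)"
    by (intro has_derivative_add linear_imp_has_derivative has_derivative_const)
  then show ?thesis using that by (simp add: D_def)
qed

text \<open>Meridians through \<open>(1, 0, 0)\<close> span the tangent plane there, and the cost
  along each is explicit by \<open>cost_rotation\<close>. The 4 combines the cross term of the
  quadratic form with the doubled angle.\<close>

lemma rotation_elem_grad_norm:
  fixes A :: "nat \<Rightarrow> complex^'n^'n" and X :: "complex^'m^'m" and Y :: "complex^'m^'n"
    and S :: star_kind and L :: nat
  assumes ij: "i \<noteq> j"
  defines "G \<equiv> Q_matrix S L (\<lambda>l. star S X ** star S Y ** A l ** Y ** X) i j"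
  shows "elem_grad_norm (\<lambda>Z. cost S L A (Y, Z)) X i j TQ = 4 * norm (G $ 1 $ 2, G $ 1 $ 3)"
proof -
  let ?h = "(\<lambda>\<Psi>. cost S L A (Y, X ** elem_mat i j \<Psi>)) \<circ> \<Psi>Q"
  have sym: "transpose G = G" by (simp add: G_def transpose_Q_matrix)
  obtain D where D: "((\<lambda>q. elem_mat i j (\<Psi>Q q)) has_derivative D) (at (1, 0, 0))"
    by (rule elem_mat_\<Psi>Q_has_derivative[OF ij])
  have "((\<lambda>q. quartic S L A ((Y ** X) ** elem_mat i j (\<Psi>Q q))) has_derivative
      (\<lambda>q. quartic_deriv S L A ((Y ** X) ** elem_mat i j (\<Psi>Q (1, 0, 0))) ((Y ** X) ** D q))) (at (1, 0, 0))"
    by (rule has_derivative_compose[OF _ has_derivative_quartic]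
        bounded_linear.has_derivative[OF matmul.bounded_linear_right D])+
  then have "GDERIV ?h (1, 0, 0) :> nabla ?h (1, 0, 0)"
    by (intro GDERIV_nabla) (simp add: o_def cost_eq_quartic matrix_mul_assoc)
  then have h: "(?h has_derivative (\<lambda>q. q \<bullet> nabla ?h (1, 0, 0))) (at (sphere_coords 0 \<phi>))" for \<phi>
    by (simp add: gderiv_def sphere_coords_def)
  have deriv: "(0, cos \<phi>, sin \<phi>) \<bullet> nabla ?h (1, 0, 0) = 4 * (G $ 1 $ 2 * cos \<phi> + G $ 1 $ 3 * sin \<phi>)" for \<phi>
  proof -
    have "((\<lambda>\<theta>. sphere_coords \<theta> \<phi>) has_derivative (\<lambda>t. t *\<^sub>R (0, cos \<phi>, sin \<phi>))) (at 0)"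
      unfolding sphere_coords_def
      by (auto intro!: derivative_eq_intros has_derivative_Pair simp: fun_eq_iff)
    from has_derivative_compose[OF this h]
    have "((\<lambda>\<theta>. ?h (sphere_coords \<theta> \<phi>)) has_real_derivative (0, cos \<phi>, sin \<phi>) \<bullet> nabla ?h (1, 0, 0)) (at 0)"
      by (simp only: has_field_derivative_def inner_scaleR_left mult_commute_abs)
    moreover have "((\<lambda>\<theta>. ?h (sphere_coords \<theta> \<phi>)) has_real_derivative 4 * (G $ 1 $ 2 * cos \<phi> + G $ 1 $ 3 * sin \<phi>)) (at 0)"
      unfolding o_apply cost_rotation[OF ij] G_def[symmetric] quadform_3[OF sym]
      by (auto intro!: derivative_eq_intros)
    ultimately show ?thesis by (rule DERIV_unique)
  qed
  have "snd (nabla ?h (1, 0, 0)) = 4 *\<^sub>R (G $ 1 $ 2, G $ 1 $ 3)"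
    using deriv[of 0] deriv[of "pi / 2"] by (cases "nabla ?h (1, 0, 0)") simp
  then have "sphere_grad ?h (1, 0, 0) = (0, 4 *\<^sub>R (G $ 1 $ 2, G $ 1 $ 3))"
    by (cases "nabla ?h (1, 0, 0)") (auto simp: sphere_grad_def)
  then have "norm (sphere_grad ?h (1, 0, 0)) = 4 * norm (G $ 1 $ 2, G $ 1 $ 3)"
    by (simp add: norm_Pair2 del: scaleR_Pair)
  then show ?thesis by (simp add: elem_grad_norm_def Let_def)
qed

lemma Q_matrix_bound:
  assumes W: "\<And>l. norm (W l) \<le> b l"
  shows "\<bar>Q_matrix S L W i j $ a $ c\<bar> \<le> 2 * (\<Sum>l=1..L. (b l)\<^sup>2)"
proof -
  have entry: "cmod (W l $ p $ q) \<le> b l" for l p q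
    using W[of l] Finite_Cartesian_Product.norm_nth_le[of "W l" p] Finite_Cartesian_Product.norm_nth_le[of "W l $ p" q] by linarith
  have z: "cmod (Q_vec S i j (W l) $ a) \<le> 2 * b l" for l and a :: 3
  proof -
    have "cmod (x + y) \<le> 2 * b l" "cmod (x - y) \<le> 2 * b l" if "cmod x \<le> b l" "cmod y \<le> b l" for x y
      using norm_triangle_ineq[of x y] norm_triangle_ineq4[of x y] that by linarith+
    then show ?thesis
      using exhaust_3[of a] entry by (cases S) (auto simp: Q_vec_def norm_mult)
  qed
  have "\<bar>Re (Q_vec S i j (W l) $ a * cnj (Q_vec S i j (W l) $ c))\<bar> \<le> 4 * (b l)\<^sup>2" for l
  proof -
    have "\<bar>Re (Q_vec S i j (W l) $ a * cnj (Q_vec S i j (W l) $ c))\<bar> \<le> cmod (Q_vec S i j (W l) $ a) * cmod (Q_vec S i j (W l) $ c)"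
      by (rule order_trans[OF abs_Re_le_cmod]) (simp add: norm_mult)
    also have "\<dots> \<le> (2 * b l) * (2 * b l)"
      by (intro mult_mono z) (use order_trans[OF norm_ge_zero W[of l]] in auto)
    finally show ?thesis by (simp add: power2_eq_square)
  qed
  then have "\<bar>\<Sum>l=1..L. Re (Q_vec S i j (W l) $ a * cnj (Q_vec S i j (W l) $ c))\<bar> \<le> (\<Sum>l=1..L. 4 * (b l)\<^sup>2)"
    by (intro order_trans[OF sum_abs] sum_mono)
  also have "\<dots> = 4 * (\<Sum>l=1..L. (b l)\<^sup>2)" by (simp add: sum_distrib_left)
  finally show ?thesis
    by (cases S) (simp_all add: Q_matrix_def Q_sign_def abs_mult)
qed

lemma Q_descent:
  fixes A :: "nat \<Rightarrow> complex^'n^'n"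
  assumes R: "0 \<le> R"
  obtains \<kappa> where "\<kappa> > 0"
    "\<And>(X :: complex^'m^'m) (Y :: complex^'m^'n) i j \<Psi>. norm (Y ** X) \<le> R \<Longrightarrow> i \<noteq> j \<Longrightarrow>
      elem_choice S L A \<sigma>D \<sigma>Q Y X i j TQ \<Psi> \<Longrightarrow>
      \<kappa> * (elem_grad_norm (\<lambda>Z. cost S L A (Y, Z)) X i j TQ)\<^sup>2
        \<le> cost S L A (Y, X) - cost S L A (Y, X ** elem_mat i j \<Psi>)"
proof -
  define g where "g = 2 * (\<Sum>l=1..L. (R * norm (A l) * R)\<^sup>2) + 1"
  have g: "0 < g" unfolding g_def by (intro add_nonneg_pos mult_nonneg_nonneg sum_nonneg) auto
  show ?thesis
  \<comment> \<open>320 is 20 times the square of the 4 in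
    \<open>rotation_elem_grad_norm\<close>.\<close>
  proof (rule that[of "1 / (320 * g)"])
    show "1 / (320 * g) > 0" using g by simp
    fix X :: "complex^'m^'m" and Y :: "complex^'m^'n" and i j \<Psi>
    assume YX: "norm (Y ** X) \<le> R" and ij: "i \<noteq> j" and choice: "elem_choice S L A \<sigma>D \<sigma>Q Y X i j TQ \<Psi>"
    define W where "W = (\<lambda>l. star S X ** star S Y ** A l ** Y ** X)"
    define G where "G = Q_matrix S L W i j"
    obtain \<theta> \<phi> where ch: "Q_choice \<sigma>Q G \<theta> \<phi>" and \<Psi>: "\<Psi> = \<Psi>Q (sphere_coords \<theta> \<phi>)"
      using choice by (auto simp: elem_choice_def Let_def G_def W_def)
    have "W l = star S (Y ** X) ** A l ** (Y ** X)" for l by (simp add: W_def star_mult matrix_mul_assoc)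
    then have "norm (W l) \<le> R * norm (A l) * R" for l
      using YX R by (auto intro!: order_trans[OF norm_matrix_mult_le] mult_mono)
    then have "\<bar>G $ a $ b\<bar> \<le> g" for a b
      using Q_matrix_bound[of W "\<lambda>l. R * norm (A l) * R" S L i j a b] unfolding G_def g_def by simp
    then have "(norm (G $ 1 $ 2, G $ 1 $ 3))\<^sup>2 / (20 * g) \<le> r_vec \<theta> \<phi> \<bullet> (G *v r_vec \<theta> \<phi>) - G $ 1 $ 1"
      by (intro Q_choice_descent[OF _ ch _ g]) (simp_all add: G_def transpose_Q_matrix)
    then show "1 / (320 * g) * (elem_grad_norm (\<lambda>Z. cost S L A (Y, Z)) X i j TQ)\<^sup>2
        \<le> cost S L A (Y, X) - cost S L A (Y, X ** elem_mat i j \<Psi>)"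
      unfolding \<Psi> cost_rotation[OF ij] rotation_elem_grad_norm[OF ij] W_def[symmetric] G_def[symmetric]
      by (simp add: power_mult_distrib)
  qed
qed

section \<open>Convergence\<close>

text \<open>In the Leibniz sum only the identity and the transposition of \<open>i\<close> and
  \<open>j\<close> survive: any other permutation moves some \<open>k\<close> outside
  \<open>{i, j}\<close>, where row \<open>k\<close> is that of the identity matrix.\<close>

lemma det_elem_mat:
  fixes \<Psi> :: "complex^2^2"
  assumes ij: "i \<noteq> (j :: 'm::finite)"
  shows "det (elem_mat i j \<Psi> :: complex^'m^'m) = \<Psi> $ 1 $ 1 * \<Psi> $ 2 $ 2 - \<Psi> $ 1 $ 2 * \<Psi> $ 2 $ 1"
proof -
  let ?E = "elem_mat i j \<Psi> :: complex^'m^'m"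
  let ?\<tau> = "Transposition.transpose i j"
  let ?f = "\<lambda>p. of_int (sign p) * (\<Prod>k\<in>UNIV. ?E $ k $ p k)"
  have split: "prod g UNIV = g i * (g j * prod g (UNIV - {i, j}))" for g :: "'m \<Rightarrow> complex"
  proof -
    have "prod g UNIV = prod g (insert i (insert j (UNIV - {i, j})))"
      by (rule arg_cong[where f = "prod g"]) auto
    then show ?thesis using ij by simp
  qed
  have sum_doubleton: "sum g {x, y} = g x + g y" if "x \<noteq> y" for g :: "('m \<Rightarrow> 'm) \<Rightarrow> complex" and x y
    using that by simp
  have "det ?E = sum ?f {p. p permutes UNIV}" by (simp add: det_def)
  also have "\<dots> = sum ?f {id, ?\<tau>}"
  proof (rule sum.mono_neutral_right)
    show "finite {p. p permutes (UNIV :: 'm set)}" by (rule finite_permutations) simp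
    show "{id, ?\<tau>} \<subseteq> {p. p permutes UNIV}" by (auto simp: permutes_id permutes_swap_id)
    show "\<forall>p\<in>{p. p permutes UNIV} - {id, ?\<tau>}. ?f p = 0"
    proof
      fix p assume p: "p \<in> {p. p permutes UNIV} - {id, ?\<tau>}"
      then have "\<not> p permutes {i, j}" by (simp add: permutes_doubleton_iff)
      then obtain k where "k \<noteq> i" "k \<noteq> j" "p k \<noteq> k"
        using p permutes_superset[of p UNIV "{i, j}"] by auto
      then have "?E $ k $ p k = 0" by (auto simp: elem_mat_def)
      then have "(\<Prod>k\<in>UNIV. ?E $ k $ p k) = 0" by (intro prod_zero) auto
      then show "?f p = 0" by simp
    qed
  qed
  also have "\<dots> = ?f id + ?f ?\<tau>"
  proof -
    have "id i \<noteq> ?\<tau> i" using ij by simp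
    then have "id \<noteq> ?\<tau>" by metis
    then show ?thesis by (rule sum_doubleton)
  qed
  also have "?f id = \<Psi> $ 1 $ 1 * \<Psi> $ 2 $ 2"
  proof -
    have "(\<Prod>k\<in>UNIV - {i, j}. ?E $ k $ id k) = 1"
      by (rule prod.neutral) (auto simp: elem_mat_def)
    then show ?thesis using ij by (simp add: split sign_id) (simp add: elem_mat_def)
  qed
  also have "?f ?\<tau> = - (\<Psi> $ 1 $ 2 * \<Psi> $ 2 $ 1)"
  proof -
    have "(\<Prod>k\<in>UNIV - {i, j}. ?E $ k $ ?\<tau> k) = 1"
      by (rule prod.neutral) (auto simp: elem_mat_def)
    then show ?thesis using ij by (simp add: split sign_swap_id) (simp add: elem_mat_def)
  qed
  finally show ?thesis by simp
qed

section \<open>Triangular matrices and the gradient steering the algorithm\<close>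

lemma upper_tri_mult:
  assumes "upper_tri M" "upper_tri N"
  shows "upper_tri (M ** N)"
  unfolding upper_tri_def
proof (intro allI impI)
  fix i j :: 'a assume "j < i"
  have "M $ i $ k * N $ k $ j = 0" for k
  proof (cases "k < i")
    case False
    with \<open>j < i\<close> have "j < k" by simp
    then show ?thesis using assms(2) by (simp add: upper_tri_def)
  qed (use assms(1) in \<open>simp add: upper_tri_def\<close>)
  then have "(\<Sum>k\<in>UNIV. M $ i $ k * N $ k $ j) = 0" by (intro sum.neutral) blast
  then show "(M ** N) $ i $ j = 0" by (simp add: matrix_matrix_mult_def)
qed

lemma upper_tri_elem_mat:
  fixes i j :: "'m::{finite,wellorder}"
  assumes ij: "i < j" and \<Psi>: "\<Psi> $ 2 $ 1 = 0"
  shows "upper_tri (elem_mat i j \<Psi>)"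
  unfolding upper_tri_def
proof (intro allI impI)
  fix a b :: 'm assume "b < a"
  with ij have "\<not> (a = i \<and> b = i)" "\<not> (a = i \<and> b = j)" "\<not> (a = j \<and> b = j)" "a \<noteq> b" by auto
  then show "elem_mat i j \<Psi> $ a $ b = 0" using \<Psi> by (simp only: elem_mat_def vec_lambda_beta if_False if_cancel)
qed

definition upper_part :: "complex^'m::{finite,wellorder}^'m::{finite,wellorder} \<Rightarrow> complex^'m::{finite,wellorder}^'m::{finite,wellorder}" where
  "upper_part M = (\<chi> i j. if j < i then 0 else M $ i $ j)"

definition mean_diag :: "complex^'m^'m \<Rightarrow> complex^'m^'m" where
  "mean_diag M = mat (trace M / of_nat CARD('m))"

lemma mean_diag_nth: "mean_diag (M :: complex^'m^'m) $ i $ j = (if i = j then trace M / of_nat CARD('m) else 0)"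
  by (simp add: mean_diag_def mat_def)

lemma trace_mean_diag: "trace (mean_diag M) = trace M"
  by (simp add: trace_def[of "mean_diag M"] mean_diag_nth)

text \<open>The residual is the strictly lower part plus a multiple of the identity, and both are
  orthogonal to traceless upper triangular matrices. Testing two candidates on their difference
  gives uniqueness.\<close>

lemma orth_proj_traceless_upper_tri:
  "orth_proj traceless_upper_tri M = upper_part M - mean_diag M"
  unfolding orth_proj_def
proof (rule the_equality)
  let ?P = "upper_part M - mean_diag M"
  have "trace (upper_part M) = trace M" by (simp add: trace_def upper_part_def)
  then have P: "?P \<in> traceless_upper_tri"
    by (auto simp: traceless_upper_tri_def trace_sub trace_mean_diag upper_tri_def upper_part_def mean_diag_nth)
  have orth: "orthogonal (M - ?P) V" if V: "V \<in> traceless_upper_tri" for V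
  proof -
    let ?t = "trace M / of_nat CARD('a)"
    have "(M - ?P) \<bullet> V = (\<Sum>i\<in>UNIV. \<Sum>j\<in>UNIV. if j = i then ?t \<bullet> V $ i $ i else 0)"
      unfolding inner_vec_def using V
      by (intro sum.cong refl) (auto simp: upper_part_def mean_diag_nth traceless_upper_tri_def upper_tri_def not_less)
    also have "\<dots> = ?t \<bullet> trace V" by (simp add: trace_def inner_sum_right)
    finally show ?thesis using V by (simp add: orthogonal_def traceless_upper_tri_def)
  qed
  show "?P \<in> traceless_upper_tri \<and> (\<forall>V\<in>traceless_upper_tri. orthogonal (M - ?P) V)"
    using P orth by blast
  fix Q assume Q: "Q \<in> traceless_upper_tri \<and> (\<forall>V\<in>traceless_upper_tri. orthogonal (M - Q) V)"
  have "Q - ?P \<in> traceless_upper_tri"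
    using Q P by (auto simp: traceless_upper_tri_def upper_tri_def trace_sub)
  then have "(M - ?P) \<bullet> (Q - ?P) = 0" "(M - Q) \<bullet> (Q - ?P) = 0"
    using orth Q by (auto simp: orthogonal_def)
  note zero = this
  have diff: "(a - b) - (a - c) = c - b" for a b c :: "complex^'a::{finite,wellorder}^'a::{finite,wellorder}" by simp
  have "(Q - ?P) \<bullet> (Q - ?P) = ((M - ?P) - (M - Q)) \<bullet> (Q - ?P)"
    by (simp only: diff)
  also have "\<dots> = 0" by (simp only: inner_diff_left[of "M - ?P" "M - Q"] zero diff_self)
  finally show "Q = ?P" by simp
qed

text \<open>One bounded linear map per variant, which makes \<Lambda> a continuous function of the
  iterate in all cases at once.\<close>

definition Lambda_part ::
  "variant \<Rightarrow> complex^'m::{finite,wellorder}^'m::{finite,wellorder} \<Rightarrow> complex^'m::{finite,wellorder}^'m::{finite,wellorder}" where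
  "Lambda_part alg M = (case alg of GU \<Rightarrow> upper_part M | _ \<Rightarrow> M) - mean_diag M"

lemma alg_Lambda_eq: "alg_Lambda alg g X = Lambda_part alg (ctranspose X ** nabla g X)"
  by (cases alg)
     (simp_all add: alg_Lambda_def Lambda_part_def EUT_Lambda_def orth_proj_traceless_upper_tri SL_Lambda_def mean_diag_def)

lemma linear_mean_diag: "linear mean_diag"
  by (rule linearI)
     (simp_all add: vec_eq_iff mean_diag_nth trace_add add_divide_distrib,
      simp add: trace_def divide_inverse flip: scaleR_sum_right)

lemma linear_upper_part: "linear upper_part"
  by (rule linearI) (simp_all add: vec_eq_iff upper_part_def)

lemma bounded_linear_Lambda_part: "bounded_linear (Lambda_part alg)"
proof (rule linear_conv_bounded_linear[THEN iffD1])
  show "linear (Lambda_part alg)"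
    unfolding Lambda_part_def[abs_def]
    by (cases alg) (auto intro!: linear_compose_sub linear_mean_diag linear_upper_part linear_id[unfolded id_def])
qed

lemma alg_grad_cost:
  "alg_grad alg (cost S L A) (Y, X) =
    (let G = quartic_grad S L A (Y ** X); N = G ** ctranspose X in
     (N - (1/2) *\<^sub>R (Y ** (ctranspose Y ** N + ctranspose N ** Y)),
      X ** Lambda_part alg (ctranspose X ** (ctranspose Y ** G))))"
  by (simp add: alg_grad_def Let_def St_grad_def alg_Lambda_eq nabla_cost_fst nabla_cost_snd)

lemma tendsto_alg_grad:
  assumes "(w \<longlongrightarrow> v) F"
  shows "((\<lambda>k. alg_grad alg (cost S L A) (w k)) \<longlongrightarrow> alg_grad alg (cost S L A) v) F"
proof -
  have fs: "((\<lambda>k. fst (w k)) \<longlongrightarrow> fst v) F" "((\<lambda>k. snd (w k)) \<longlongrightarrow> snd v) F"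
    using assms by (auto intro: tendsto_intros)
  have eq: "alg_grad alg (cost S L A) u =
    (let G = quartic_grad S L A (fst u ** snd u); N = G ** ctranspose (snd u) in
     (N - (1/2) *\<^sub>R (fst u ** (ctranspose (fst u) ** N + ctranspose N ** fst u)),
      snd u ** Lambda_part alg (ctranspose (snd u) ** (ctranspose (fst u) ** G))))" for u
    by (cases u) (simp add: alg_grad_cost)
  note ct = bounded_linear.tendsto[OF bounded_linear_ctranspose]
  note G = isCont_tendsto_compose[OF isCont_quartic_grad matmul.tendsto[OF fs]]
  note N = matmul.tendsto[OF G ct[OF fs(2)]]
  note sym = tendsto_add[OF matmul.tendsto[OF ct[OF fs(1)] N] matmul.tendsto[OF ct[OF N] fs(1)]]
  note 1 = tendsto_diff[OF N tendsto_scaleR[OF tendsto_const matmul.tendsto[OF fs(1) sym]]]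
  note 2 = matmul.tendsto[OF fs(2) bounded_linear.tendsto[OF bounded_linear_Lambda_part
        matmul.tendsto[OF ct[OF fs(2)] matmul.tendsto[OF ct[OF fs(1)] G]]]]
  show ?thesis
    unfolding eq Let_def by (rule tendsto_Pair[OF 1 2])
qed

lemma mat_commute:
  fixes M :: "complex^'m^'m"
  shows "M ** mat t = mat t ** M"
proof -
  have "(\<Sum>k\<in>UNIV. M $ a $ k * mat t $ k $ b) = (\<Sum>k\<in>UNIV. if k = b then M $ a $ b * t else 0)"
    "(\<Sum>k\<in>UNIV. mat t $ a $ k * M $ k $ b) = (\<Sum>k\<in>UNIV. if k = a then t * M $ a $ b else 0)" for a b
    by (rule sum.cong; auto simp: mat_def)+
  then show ?thesis by (simp add: vec_eq_iff matrix_matrix_mult_def mult.commute)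
qed

text \<open>
  Stationarity in \<open>Y\<close> makes \<open>K = Y\<^sup>H \<nabla>p\<close> Hermitian, and stationarity in \<open>EUT\<close> makes \<open>M = X\<^sup>H \<nabla>g\<close> lower triangular
  with constant diagonal. As \<open>X\<^sup>H K = M X\<^sup>H\<close> with \<open>X\<^sup>H\<close> lower triangular, \<open>K\<close> is lower triangular as well,
  hence diagonal, hence a multiple of the identity, and so is \<open>M\<close>.
\<close>

lemma stationary_of_EUT:
  fixes X :: "complex^'m::{finite,wellorder}^'m::{finite,wellorder}" and Y :: "complex^'m::{finite,wellorder}^'n"
  assumes X: "X \<in> EUT" and Y: "Y \<in> St" and zero: "alg_grad GU (cost S L A) (Y, X) = 0"
  shows "riem_grad (cost S L A) (Y, X) = 0"
proof -
  define G where "G = quartic_grad S L A (Y ** X)"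
  define N where "N = G ** ctranspose X"
  define M where "M = ctranspose X ** (ctranspose Y ** G)"
  define t where "t = trace M / of_nat CARD('m)"
  define K where "K = ctranspose Y ** N"
  have N: "N = (1/2) *\<^sub>R (Y ** (K + ctranspose K))" and XL: "X ** Lambda_part GU M = 0"
    using zero by (simp_all add: alg_grad_cost Let_def zero_prod_def K_def N_def M_def G_def ctranspose_mult)
  have YY: "ctranspose Y ** (Y ** H) = H" for H :: "complex^'m::{finite,wellorder}^'m::{finite,wellorder}"
    using Y by (simp add: St_def matrix_mul_assoc)
  have "K = (1/2) *\<^sub>R (K + ctranspose K)"
    using arg_cong[OF N, of "\<lambda>H. ctranspose Y ** H"] by (simp add: K_def[symmetric] matmul.scaleR_right YY)
  then have "2 *\<^sub>R K = K + ctranspose K"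
    by (metis (no_types) scaleR_half_double scaleR_right_distrib scaleR_2)
  then have herm: "ctranspose K = K" by (simp add: scaleR_2)
  have BK: "ctranspose X ** K = M ** ctranspose X"
    by (simp add: K_def N_def M_def matrix_mul_assoc)
  have dX: "det X = 1" and up: "\<And>a b. b < a \<Longrightarrow> X $ a $ b = 0"
    using X by (auto simp: EUT_def SL_def upper_tri_def)
  have "invertible X" using dX by (simp add: invertible_det_nz)
  then obtain X' where X': "X' ** X = mat 1" "X ** X' = mat 1" unfolding invertible_def by blast
  have "Lambda_part GU M = X' ** (X ** Lambda_part GU M)" by (simp add: matrix_mul_assoc X')
  then have "upper_part M = mean_diag M" using XL by (simp add: Lambda_part_def)
  then have M: "M $ a $ b = (if a = b then t else 0)" if "a \<le> b" for a b
  proof -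
    have "upper_part M $ a $ b = mean_diag M $ a $ b" using \<open>upper_part M = mean_diag M\<close> by simp
    then show ?thesis using that by (auto simp: mean_diag_nth t_def upper_part_def split: if_splits)
  qed
  have diag: "X $ a $ a \<noteq> 0" for a
  proof
    assume "X $ a $ a = 0"
    then have "(\<Prod>k\<in>UNIV. X $ k $ k) = 0" by (intro prod_zero) auto
    then have "det X = 0" by (simp only: det_upperdiagonal[OF up])
    then show False using dX by simp
  qed
  have BKe: "(\<Sum>k\<in>UNIV. cnj (X $ k $ a) * K $ k $ b) = (\<Sum>k\<in>UNIV. M $ a $ k * cnj (X $ b $ k))" for a b
    using arg_cong[OF BK, of "\<lambda>H. H $ a $ b"] by (simp add: matrix_matrix_mult_def)
  \<comment> \<open>Forward substitution down the rows: right of the diagonal, row \<open>a\<close>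
    of the right-hand side vanishes and the earlier rows of \<open>K\<close> are already 0, so only
    the term with the nonzero \<open>X $ a $ a\<close> is left.\<close>
  have K0: "a < b \<Longrightarrow> K $ a $ b = 0" for a b
  proof (induction a rule: less_induct)
    case (less a)
    have "M $ a $ k * cnj (X $ b $ k) = 0" for k
    proof (cases "a < k")
      case True
      then show ?thesis using M[of a k] by simp
    next
      case False
      then have "k < b" using less.prems by simp
      then show ?thesis using up by simp
    qed
    then have "(\<Sum>k\<in>UNIV. cnj (X $ k $ a) * K $ k $ b) = 0"
      unfolding BKe by (intro sum.neutral) blast
    moreover have "(\<Sum>k\<in>UNIV. cnj (X $ k $ a) * K $ k $ b) = (\<Sum>k\<in>UNIV. if k = a then cnj (X $ a $ a) * K $ a $ b else 0)"
    proof (rule sum.cong[OF refl])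
      fix k
      show "cnj (X $ k $ a) * K $ k $ b = (if k = a then cnj (X $ a $ a) * K $ a $ b else 0)"
        using less.IH[of k] less.prems up[of a k] by (cases k a rule: linorder_cases) auto
    qed
    ultimately show ?case using diag[of a] by simp
  qed
  have K: "K $ a $ b = (if a = b then t else 0)" for a b
  proof (cases a b rule: linorder_cases)
    case less
    then show ?thesis using K0 by simp
  next
    case greater
    then have "cnj (K $ b $ a) = 0" using K0 by simp
    then show ?thesis using greater arg_cong[OF herm, of "\<lambda>H. H $ a $ b"] by simp
  next
    case equal
    have off: "K $ k $ a = 0" if "k \<noteq> a" for k
    proof (cases "k < a")
      case False
      with that have "K $ a $ k = 0" using K0 by simp
      then show ?thesis using arg_cong[OF herm, of "\<lambda>H. H $ k $ a"] by simp
    qed (use K0 in simp)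
    have "(\<Sum>k\<in>UNIV. cnj (X $ k $ a) * K $ k $ a) = (\<Sum>k\<in>UNIV. if k = a then cnj (X $ a $ a) * K $ a $ a else 0)"
      by (rule sum.cong[OF refl]) (auto simp: off)
    moreover have "(\<Sum>k\<in>UNIV. M $ a $ k * cnj (X $ a $ k)) = (\<Sum>k\<in>UNIV. if k = a then t * cnj (X $ a $ a) else 0)"
    proof (rule sum.cong[OF refl])
      fix k
      show "M $ a $ k * cnj (X $ a $ k) = (if k = a then t * cnj (X $ a $ a) else 0)"
        using M[of a k] up[of k a] by (cases k a rule: linorder_cases) auto
    qed
    ultimately have "X $ a $ a = 0 \<or> t = K $ a $ a" using BKe[of a a] by simp
    then show ?thesis using diag[of a] equal by auto
  qed
  have "M ** ctranspose X = mat t ** ctranspose X"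
  proof -
    have "K = mat t" by (simp add: vec_eq_iff K mat_def)
    then show ?thesis by (simp add: mat_commute flip: BK)
  qed
  then have "M ** (ctranspose X ** ctranspose X') = mat t ** (ctranspose X ** ctranspose X')"
    by (simp only: matrix_mul_assoc)
  then have "M = mat t" by (simp add: X' flip: ctranspose_mult)
  \<comment> \<open>\<open>GLU\<close> stands for the full projection on \<open>SL\<close>, with
    which \<open>riem_grad\<close> is an instance of \<open>alg_grad\<close>.\<close>
  then have "Lambda_part GLU M = 0" by (simp add: Lambda_part_def mean_diag_def t_def)
  moreover have "riem_grad (cost S L A) (Y, X) = alg_grad GLU (cost S L A) (Y, X)"
    by (simp add: riem_grad_def alg_grad_def alg_Lambda_def)
  ultimately show ?thesis
    using zero by (simp add: alg_grad_cost Let_def zero_prod_def M_def G_def)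
qed

text \<open>Keeps iterates feasible: the determinant condition serves every variant, the vanishing
  lower left entry serves \<open>GU\<close>.\<close>

lemma elem_choice_det:
  assumes ij: "i \<noteq> j" and \<sigma>: "0 < \<sigma>D" "\<sigma>D < 1/4" and "elem_choice S L A \<sigma>D \<sigma>Q Y X i j ty \<Psi>"
  shows "det (elem_mat i j \<Psi>) = 1" and "ty \<in> {TU, TD} \<Longrightarrow> \<Psi> $ 2 $ 1 = 0"
proof -
  have "det (elem_mat i j \<Psi>) = 1 \<and> (ty \<in> {TU, TD} \<longrightarrow> \<Psi> $ 2 $ 1 = 0)"
  proof (cases ty)
    case TU
    then show ?thesis using assms by (auto simp: elem_choice_def Let_def det_elem_mat[OF ij] \<Psi>U_def)
  next
    case TL
    then show ?thesis using assms by (auto simp: elem_choice_def Let_def det_elem_mat[OF ij] \<Psi>L_def)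
  next
    case TD
    define x where "x = D_scale \<sigma>D (gamma L (\<lambda>l. star S X ** star S Y ** A l ** Y ** X) i j i) (gamma L (\<lambda>l. star S X ** star S Y ** A l ** Y ** X) i j j)"
    \<comment> \<open>Only positivity of the scale is wanted, so the bound \<open>G\<close> in
      \<open>D_scale_descent\<close> is taken as the sum of the weights plus 1.\<close>
    have "x > 0"
      unfolding x_def
      by (rule D_scale_descent(1)[OF gamma_nonneg gamma_nonneg less_imp_le[OF less_add_one] _ \<sigma>])
         (intro add_nonneg_pos add_nonneg_nonneg gamma_nonneg, simp)
    then have "Complex x 0 \<noteq> 0" by (simp add: complex_eq_iff)
    moreover have "\<Psi> = \<Psi>D (x, 0)" using assms(4) by (simp add: TD elem_choice_def Let_def x_def)
    ultimately show ?thesis by (simp add: det_elem_mat[OF ij] \<Psi>D_def)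
  next
    case TQ
    then obtain \<theta> \<phi> where "\<Psi> = \<Psi>Q (sphere_coords \<theta> \<phi>)"
      using assms(4) by (auto simp: elem_choice_def Let_def)
    moreover have cis: "cis \<phi> * (cis (- \<phi>) * z) = z" for z
      by (simp only: mult.assoc[symmetric] cis_mult) simp
    moreover have "complex_of_real ((cos \<theta>)\<^sup>2 + (sin \<theta>)\<^sup>2) = 1" by (simp only: sin_cos_squared_add2 of_real_1)
    then have "complex_of_real (cos \<theta>) * of_real (cos \<theta>) + of_real (sin \<theta>) * of_real (sin \<theta>) = 1"
      by (simp only: of_real_add of_real_mult power2_eq_square)
    ultimately show ?thesis
      by (simp add: TQ det_elem_mat[OF ij] \<Psi>Q_sphere_coords rotation_block_def cis_cnj mult_ac cis)
  qed
  then show "det (elem_mat i j \<Psi>) = 1" "ty \<in> {TU, TD} \<Longrightarrow> \<Psi> $ 2 $ 1 = 0" by blast+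
qed

text \<open>Taylor estimate at 0, where the form and its derivative vanish.\<close>

lemma quartic_bounded:
  fixes A :: "nat \<Rightarrow> complex^'n^'n"
  assumes "0 \<le> R"
  obtains G where "0 < G" "\<And>Z :: complex^'m^'n. norm Z \<le> R \<Longrightarrow> quartic S L A Z \<le> G"
proof -
  obtain K where K: "K > 0" "\<And>Z H :: complex^'m^'n. norm Z \<le> R \<Longrightarrow> norm H \<le> R \<Longrightarrow>
    quartic S L A (Z + H) \<le> quartic S L A Z + quartic_deriv S L A Z H + K * (norm H)\<^sup>2"
    using quartic_taylor[OF assms] by blast
  have "quartic S L A Z \<le> K * R\<^sup>2 + 1" if "norm Z \<le> R" for Z :: "complex^'m^'n"
  proof -
    have "quartic S L A Z \<le> K * (norm Z)\<^sup>2"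
      using K(2)[of 0 Z] that assms by (simp add: quartic_def cost_form.zero_left)
    also have "\<dots> \<le> K * R\<^sup>2" using that K(1) by (intro mult_left_mono power_mono) auto
    finally show ?thesis by simp
  qed
  moreover have "0 < K * R\<^sup>2 + 1" using K(1) by (intro add_nonneg_pos) auto
  ultimately show ?thesis using that by blast
qed

text \<open>The selection rule bounds the elementary gradient below by \<epsilon> times the norm of
  \<Lambda>, whence the factor \<open>\<epsilon>\<^sup>2\<close> on the smallest of the constants
  for the types.\<close>

lemma elem_update_descent:
  fixes A :: "nat \<Rightarrow> complex^'n^'n"
  assumes R: "0 \<le> R" and \<sigma>: "0 < \<sigma>D" "\<sigma>D < 1/4" and \<epsilon>: "0 < \<epsilon>"
  obtains \<kappa> where "\<kappa> > 0"
    "\<And>(X :: complex^'m::{finite,wellorder}^'m::{finite,wellorder}) (Y :: complex^'m::{finite,wellorder}^'n) X'. norm (Y ** X) \<le> R \<Longrightarrow>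
      elem_update alg S L A \<epsilon> \<sigma>D \<sigma>Q Y X X' \<Longrightarrow>
      \<kappa> * (norm (alg_Lambda alg (\<lambda>Z. cost S L A (Y, Z)) X))\<^sup>2 \<le> cost S L A (Y, X) - cost S L A (Y, X')"
proof -
  obtain G where G: "0 < G" "\<And>Z :: complex^'m::{finite,wellorder}^'n. norm Z \<le> R \<Longrightarrow> quartic S L A Z \<le> G"
    using quartic_bounded[OF R] by blast
  obtain \<kappa>1 where \<kappa>1: "\<kappa>1 > 0"
    "\<And>(X :: complex^'m::{finite,wellorder}^'m::{finite,wellorder}) (Y :: complex^'m::{finite,wellorder}^'n) i j ty \<Psi>. norm (Y ** X) \<le> R \<Longrightarrow> i \<noteq> j \<Longrightarrow> ty \<in> {TU, TL} \<Longrightarrow>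
      elem_choice S L A \<sigma>D \<sigma>Q Y X i j ty \<Psi> \<Longrightarrow>
      \<kappa>1 * (elem_grad_norm (\<lambda>Z. cost S L A (Y, Z)) X i j ty)\<^sup>2
        \<le> cost S L A (Y, X) - cost S L A (Y, X ** elem_mat i j \<Psi>)"
    using UL_descent[OF R] by blast
  obtain \<kappa>2 where \<kappa>2: "\<kappa>2 > 0"
    "\<And>(X :: complex^'m::{finite,wellorder}^'m::{finite,wellorder}) (Y :: complex^'m::{finite,wellorder}^'n) i j \<Psi>. norm (Y ** X) \<le> R \<Longrightarrow> i \<noteq> j \<Longrightarrow>
      elem_choice S L A \<sigma>D \<sigma>Q Y X i j TQ \<Psi> \<Longrightarrow>
      \<kappa>2 * (elem_grad_norm (\<lambda>Z. cost S L A (Y, Z)) X i j TQ)\<^sup>2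
        \<le> cost S L A (Y, X) - cost S L A (Y, X ** elem_mat i j \<Psi>)"
    using Q_descent[OF R] by blast
  define \<kappa>3 where "\<kappa>3 = (1 - 4 * \<sigma>D) / (8 * G)"
  have \<kappa>3: "\<kappa>3 > 0" using G(1) \<sigma> by (simp add: \<kappa>3_def)
  define \<kappa> where "\<kappa> = min \<kappa>1 (min \<kappa>2 \<kappa>3)"
  have \<kappa>: "\<kappa> > 0" "\<kappa> \<le> \<kappa>1" "\<kappa> \<le> \<kappa>2" "\<kappa> \<le> \<kappa>3" using \<kappa>1(1) \<kappa>2(1) \<kappa>3 by (auto simp: \<kappa>_def)
  show ?thesis
  proof (rule that[of "\<kappa> * \<epsilon>\<^sup>2"])
    show "\<kappa> * \<epsilon>\<^sup>2 > 0" using \<kappa>(1) \<epsilon> by simp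
    fix X X' :: "complex^'m::{finite,wellorder}^'m::{finite,wellorder}" and Y :: "complex^'m::{finite,wellorder}^'n"
    let ?g = "\<lambda>Z. cost S L A (Y, Z)"
    assume YX: "norm (Y ** X) \<le> R" and upd: "elem_update alg S L A \<epsilon> \<sigma>D \<sigma>Q Y X X'"
    obtain i j ty \<Psi> where "i < j" and big: "elem_grad_norm ?g X i j ty \<ge> \<epsilon> * norm (alg_Lambda alg ?g X)"
      and choice: "elem_choice S L A \<sigma>D \<sigma>Q Y X i j ty \<Psi>" and X': "X' = X ** elem_mat i j \<Psi>"
      using upd unfolding elem_update_def Let_def by blast
    have ij: "i \<noteq> j" using \<open>i < j\<close> by simp
    have cost: "cost S L A (Y, X) \<le> G" using G(2)[OF YX] by (simp add: cost_eq_quartic)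
    have "\<exists>\<kappa>'\<ge>\<kappa>. \<kappa>' * (elem_grad_norm ?g X i j ty)\<^sup>2 \<le> ?g X - ?g X'"
    proof (cases ty)
      case TD
      then show ?thesis
        using D_descent[OF ij cost G(1) \<sigma>, of \<sigma>Q \<Psi>] choice \<kappa>(4) unfolding X' \<kappa>3_def by blast
    next
      case TQ
      then show ?thesis using \<kappa>2(2)[OF YX ij] choice \<kappa>(3) unfolding X' by blast
    qed (use \<kappa>1(2)[OF YX ij] choice \<kappa>(2) X' in blast)+
    then obtain \<kappa>' where \<kappa>': "\<kappa> \<le> \<kappa>'" "\<kappa>' * (elem_grad_norm ?g X i j ty)\<^sup>2 \<le> ?g X - ?g X'" by blast
    have "\<kappa> * \<epsilon>\<^sup>2 * (norm (alg_Lambda alg ?g X))\<^sup>2 = \<kappa> * (\<epsilon> * norm (alg_Lambda alg ?g X))\<^sup>2"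
      by (simp add: power_mult_distrib)
    also have "\<dots> \<le> \<kappa>' * (elem_grad_norm ?g X i j ty)\<^sup>2"
      using \<kappa>(1) \<kappa>'(1) \<epsilon> by (intro mult_mono power_mono big) auto
    finally show "\<kappa> * \<epsilon>\<^sup>2 * (norm (alg_Lambda alg ?g X))\<^sup>2 \<le> ?g X - ?g X'" using \<kappa>'(2) by linarith
  qed
qed

lemma elem_update_feasible:
  assumes \<sigma>: "0 < \<sigma>D" "\<sigma>D < 1/4" and upd: "elem_update alg S L A \<epsilon> \<sigma>D \<sigma>Q Y X X'"
    and start: "(Y, X) \<in> bcd_start alg"
  shows "(Y, X') \<in> bcd_start alg"
proof -
  obtain i j ty \<Psi> where "i < j" and ty: "ty \<in> allowed_types alg"
    and choice: "elem_choice S L A \<sigma>D \<sigma>Q Y X i j ty \<Psi>" and X': "X' = X ** elem_mat i j \<Psi>"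
    using upd unfolding elem_update_def Let_def by blast
  have ij: "i \<noteq> j" using \<open>i < j\<close> by simp
  note el = elem_choice_det[OF ij \<sigma> choice]
  have "det X' = det X" by (simp add: X' det_mul el(1))
  moreover have "upper_tri X'" if "alg = GU" "upper_tri X"
    unfolding X' using that ty el(2) \<open>i < j\<close>
    by (intro upper_tri_mult upper_tri_elem_mat) (auto simp: allowed_types_def)
  ultimately show ?thesis
    using start by (cases alg) (auto simp: bcd_start_def SL_def EUT_def)
qed

text \<open>The updated block carries at least the fraction \<upsilon> of the gradient. For the
  second block, \<open>X ** \<Lambda>\<close> has norm at most \<open>R\<close> times that of
  \<Lambda>, hence the division by \<open>R\<^sup>2\<close>. Feasibility of \<open>w'\<close> is
  included so that the estimate can be iterated.\<close>

lemma bcd_step_descent: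
  fixes A :: "nat \<Rightarrow> complex^'n^'n"
  assumes R: "0 < R" and const: "0 < \<upsilon>" "0 < \<delta>s" "0 < \<delta>w" "\<delta>c < 1" "0 < \<sigma>D" "\<sigma>D < 1/4" "0 < \<epsilon>"
  obtains \<kappa> where "\<kappa> > 0"
    "\<And>w w' :: (complex^'m::{finite,wellorder}^'n) \<times> (complex^'m::{finite,wellorder}^'m::{finite,wellorder}).
      w \<in> bcd_start alg \<Longrightarrow> norm w \<le> R \<Longrightarrow> bcd_step alg S L A \<upsilon> \<delta>s \<delta>w \<delta>c \<epsilon> \<sigma>D \<sigma>Q w w' \<Longrightarrow>
      w' \<in> bcd_start alg \<and> \<kappa> * (norm (alg_grad alg (cost S L A) w))\<^sup>2 \<le> cost S L A w - cost S L A w'"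
proof -
  obtain \<kappa>1 where \<kappa>1: "\<kappa>1 > 0"
    "\<And>(X :: complex^'m::{finite,wellorder}^'m::{finite,wellorder}) Y Y'. norm X \<le> R \<Longrightarrow> Y \<in> St \<Longrightarrow>
      line_search \<delta>s \<delta>w \<delta>c (\<lambda>Z. cost S L A (Z, X)) Y Y' \<Longrightarrow>
      Y' \<in> St \<and> \<kappa>1 * (norm (St_grad (\<lambda>Z. cost S L A (Z, X)) Y))\<^sup>2 \<le> cost S L A (Y, X) - cost S L A (Y', X)"
    using line_search_descent[of R \<delta>s \<delta>w \<delta>c] R const by (metis less_imp_le)
  obtain \<kappa>2 where \<kappa>2: "\<kappa>2 > 0"
    "\<And>(X :: complex^'m::{finite,wellorder}^'m::{finite,wellorder}) (Y :: complex^'m::{finite,wellorder}^'n) X'. norm (Y ** X) \<le> R * R \<Longrightarrow>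
      elem_update alg S L A \<epsilon> \<sigma>D \<sigma>Q Y X X' \<Longrightarrow>
      \<kappa>2 * (norm (alg_Lambda alg (\<lambda>Z. cost S L A (Y, Z)) X))\<^sup>2 \<le> cost S L A (Y, X) - cost S L A (Y, X')"
    using elem_update_descent[of "R * R" \<sigma>D \<epsilon>] R const by (metis less_imp_le mult_pos_pos)
  define \<kappa> where "\<kappa> = min (\<kappa>1 * \<upsilon>\<^sup>2) (\<kappa>2 / R\<^sup>2 * \<upsilon>\<^sup>2)"
  have \<kappa>: "0 < \<kappa>" "\<kappa> \<le> \<kappa>1 * \<upsilon>\<^sup>2" "\<kappa> \<le> \<kappa>2 / R\<^sup>2 * \<upsilon>\<^sup>2"
    using \<kappa>1(1) \<kappa>2(1) R const(1) by (auto simp: \<kappa>_def)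
  have scale: "\<kappa> * g\<^sup>2 \<le> c * b\<^sup>2" if "\<kappa> \<le> c * \<upsilon>\<^sup>2" "\<upsilon> * g \<le> b" "0 \<le> g" "0 \<le> c" for b c g
  proof -
    have "\<kappa> * g\<^sup>2 \<le> c * \<upsilon>\<^sup>2 * g\<^sup>2" by (rule mult_right_mono[OF that(1)]) simp
    also have "\<dots> = c * (\<upsilon> * g)\<^sup>2" by (simp add: power_mult_distrib)
    also have "\<dots> \<le> c * b\<^sup>2" using that const(1) by (intro mult_left_mono power_mono) auto
    finally show ?thesis .
  qed
  show ?thesis
  proof (rule that[OF \<kappa>(1)])
    fix w w' :: "(complex^'m::{finite,wellorder}^'n) \<times> (complex^'m::{finite,wellorder}^'m::{finite,wellorder})"
    let ?f = "cost S L A"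
    assume start: "w \<in> bcd_start alg" and nw: "norm w \<le> R"
      and step: "bcd_step alg S L A \<upsilon> \<delta>s \<delta>w \<delta>c \<epsilon> \<sigma>D \<sigma>Q w w'"
    obtain Y X where w: "w = (Y, X)" by (cases w)
    obtain Y' X' where w': "w' = (Y', X')" by (cases w')
    define G where "G = alg_grad alg ?f w"
    have nY: "norm Y \<le> R" and nX: "norm X \<le> R"
      using nw norm_fst_le[of Y X] norm_snd_le[of X Y] by (simp_all add: w)
    have YX: "norm (Y ** X) \<le> R * R"
      by (rule order_trans[OF norm_matrix_mult_le mult_mono[OF nY nX]]) (use R in auto)
    have fstG: "fst G = St_grad (\<lambda>Z. ?f (Z, X)) Y" and sndG: "snd G = X ** alg_Lambda alg (\<lambda>Z. ?f (Y, Z)) X"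
      by (simp_all add: G_def alg_grad_def w)
    consider (zero) "G = 0" "w' = w"
      | (line) "\<upsilon> * norm G \<le> norm (fst G)" "X' = X" "line_search \<delta>s \<delta>w \<delta>c (\<lambda>Z. ?f (Z, X)) Y Y'"
      | (elem) "\<upsilon> * norm G \<le> norm (snd G)" "Y' = Y" "elem_update alg S L A \<epsilon> \<sigma>D \<sigma>Q Y X X'"
      using step unfolding bcd_step_def Let_def by (auto simp: w w' G_def split: if_splits)
    then have "w' \<in> bcd_start alg \<and> \<kappa> * (norm G)\<^sup>2 \<le> ?f w - ?f w'"
    proof cases
      case zero
      then show ?thesis using start by simp
    next
      case line
      have "Y \<in> St" using start by (simp add: w bcd_start_def)
      note ls = \<kappa>1(2)[OF nX this line(3)]
      have "\<kappa> * (norm G)\<^sup>2 \<le> \<kappa>1 * (norm (fst G))\<^sup>2"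
        using line(1) \<kappa>(2) \<kappa>1(1) by (intro scale) auto
      then show ?thesis using ls start unfolding w w' line(2) fstG by (auto simp: bcd_start_def)
    next
      case elem
      let ?\<Lambda> = "alg_Lambda alg (\<lambda>Z. ?f (Y, Z)) X"
      have "(norm (snd G))\<^sup>2 \<le> (R * norm ?\<Lambda>)\<^sup>2"
        unfolding sndG
        by (intro power_mono order_trans[OF norm_matrix_mult_le] mult_right_mono nX) auto
      then have "\<kappa>2 / R\<^sup>2 * (norm (snd G))\<^sup>2 \<le> \<kappa>2 / R\<^sup>2 * (R * norm ?\<Lambda>)\<^sup>2"
        using \<kappa>2(1) by (intro mult_left_mono) auto
      also have "\<dots> = \<kappa>2 * (norm ?\<Lambda>)\<^sup>2" using R by (simp add: power_mult_distrib)
      also have "\<dots> \<le> ?f w - ?f w'"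
        using \<kappa>2(2)[OF YX elem(3)] by (simp add: w w' elem(2))
      finally have "\<kappa>2 / R\<^sup>2 * (norm (snd G))\<^sup>2 \<le> ?f w - ?f w'" .
      moreover have "\<kappa> * (norm G)\<^sup>2 \<le> \<kappa>2 / R\<^sup>2 * (norm (snd G))\<^sup>2"
        using elem(1) \<kappa>(3) \<kappa>2(1) by (intro scale) auto
      moreover have "w' \<in> bcd_start alg"
        using elem_update_feasible[OF const(5,6) elem(3)] start by (simp add: w w' elem(2))
      ultimately show ?thesis by linarith
    qed
    then show "w' \<in> bcd_start alg \<and> \<kappa> * (norm (alg_grad alg ?f w))\<^sup>2 \<le> ?f w - ?f w'"
      by (simp add: G_def)
  qed
qed

section \<open>Closedness of the constraints and passage to the limit\<close>

lemma closed_St: "closed St"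
  unfolding St_def
  by (intro closed_Collect_eq matmul.continuous_on linear_continuous_on bounded_linear_ctranspose
      continuous_on_id continuous_on_const)

lemma closed_SL: "closed SL"
  unfolding SL_def det_def by (intro closed_Collect_eq continuous_intros)

lemma closed_EUT: "closed (EUT :: (complex^'m::{finite,wellorder}^'m::{finite,wellorder}) set)"
proof -
  have "closed {X :: complex^'m::{finite,wellorder}^'m::{finite,wellorder}. upper_tri X}"
    unfolding upper_tri_def
    by (intro closed_Collect_all closed_Collect_imp open_Collect_const closed_Collect_eq continuous_intros)
  moreover have "(EUT :: (complex^'m::{finite,wellorder}^'m::{finite,wellorder}) set) = SL \<inter> {X. upper_tri X}" by (auto simp: EUT_def)
  ultimately show ?thesis by (metis closed_Int closed_SL)
qed

lemma closed_bcd_start: "closed (bcd_start alg)"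
  unfolding bcd_start_def
  by (cases alg) (auto intro!: closed_Times closed_St closed_SL closed_EUT)

theorem theorem8p2:
  fixes A :: "nat \<Rightarrow> complex^'n^'n" and L :: nat and S :: star_kind and alg :: variant
    and \<upsilon> \<delta>s \<delta>w \<delta>c \<epsilon> \<sigma>D \<sigma>Q :: real
    and \<omega> :: "nat \<Rightarrow> (complex^'m::{finite,wellorder}^'n) \<times> (complex^'m::{finite,wellorder}^'m::{finite,wellorder})"
    and \<omega>_star :: "(complex^'m::{finite,wellorder}^'n) \<times> (complex^'m::{finite,wellorder}^'m::{finite,wellorder})"
  assumes "2 \<le> CARD('m)" and "CARD('m) \<le> CARD('n)" and "L \<ge> 1"
    and "0 < \<upsilon>" and "\<upsilon> < sqrt 2 / 2"
    and "0 < \<delta>s" and "\<delta>s < 1"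
    and "0 < \<delta>w" and "\<delta>w < \<delta>c" and "\<delta>c < 1"
    and "0 < \<sigma>D" and "\<sigma>D < 1/4"
    and "0 < \<sigma>Q" and "\<sigma>Q \<le> 1"
    and "0 < \<epsilon>" and "\<epsilon> < eps_bound alg (real CARD('m))"
    and "bcd_iterates alg S L A \<upsilon> \<delta>s \<delta>w \<delta>c \<epsilon> \<sigma>D \<sigma>Q \<omega>"
    and "\<exists>M>0. \<forall>k\<ge>1. norm (\<omega> k) \<le> M"
    and "accumulation_point (\<lambda>k. \<omega> (k + 1)) \<omega>_star"
  shows "stationary_point (cost S L A) \<omega>_star"
proof -
  let ?f = "cost S L A" and ?G = "alg_grad alg (cost S L A)"
  obtain M where M: "M > 0" "\<And>k. k \<ge> 1 \<Longrightarrow> norm (\<omega> k) \<le> M" using assms(18) by blast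
  \<comment> \<open>The assumed bound starts at index 1, while the first step leaves from
    \<open>\<omega> 0\<close>.\<close>
  define R where "R = max M (norm (\<omega> 0))"
  have R: "0 < R" "norm (\<omega> k) \<le> R" for k
    using M(1) M(2)[of k] by (cases k; auto simp: R_def le_max_iff_disj)+
  obtain \<kappa> where \<kappa>: "\<kappa> > 0"
    "\<And>w w' :: (complex^'m::{finite,wellorder}^'n) \<times> (complex^'m::{finite,wellorder}^'m::{finite,wellorder}).
      w \<in> bcd_start alg \<Longrightarrow> norm w \<le> R \<Longrightarrow> bcd_step alg S L A \<upsilon> \<delta>s \<delta>w \<delta>c \<epsilon> \<sigma>D \<sigma>Q w w' \<Longrightarrow>
      w' \<in> bcd_start alg \<and> \<kappa> * (norm (?G w))\<^sup>2 \<le> ?f w - ?f w'"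
    using bcd_step_descent[OF R(1) assms(4,6,8,10,11,12,15), where alg = alg and S = S and L = L and A = A and \<sigma>Q = \<sigma>Q]
    by blast
  have step: "bcd_step alg S L A \<upsilon> \<delta>s \<delta>w \<delta>c \<epsilon> \<sigma>D \<sigma>Q (\<omega> k) (\<omega> (Suc k))" for k
    using assms(17) unfolding bcd_iterates_def by (metis diff_Suc_1 le_add1 plus_1_eq_Suc)
  have start: "\<omega> k \<in> bcd_start alg" for k
  proof (induction k)
    case 0
    then show ?case using assms(17) by (simp add: bcd_iterates_def)
  next
    case (Suc k)
    then show ?case using \<kappa>(2)[OF _ R(2) step] by blast
  qed
  have descent: "\<kappa> * (norm (?G (\<omega> k)))\<^sup>2 \<le> ?f (\<omega> k) - ?f (\<omega> (Suc k))" for k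
    using \<kappa>(2)[OF start R(2) step] by blast
  have "decseq (\<lambda>k. ?f (\<omega> k))"
  proof (rule decseq_SucI)
    fix k
    have "0 \<le> \<kappa> * (norm (?G (\<omega> k)))\<^sup>2" using \<kappa>(1) by simp
    then show "?f (\<omega> (Suc k)) \<le> ?f (\<omega> k)" using descent[of k] by linarith
  qed
  moreover have "0 \<le> ?f w" for w :: "(complex^'m::{finite,wellorder}^'n) \<times> (complex^'m::{finite,wellorder}^'m::{finite,wellorder})"
    by (cases w) (simp add: cost_eq_quartic quartic_nonneg)
  ultimately obtain l where l: "(\<lambda>k. ?f (\<omega> k)) \<longlonglongrightarrow> l"
    using decseq_convergent by metis
  have "(\<lambda>k. ?f (\<omega> k) - ?f (\<omega> (Suc k))) \<longlonglongrightarrow> l - l"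
    by (intro tendsto_diff l LIMSEQ_Suc)
  then have "(\<lambda>k. (?f (\<omega> k) - ?f (\<omega> (Suc k))) / \<kappa>) \<longlonglongrightarrow> 0"
    using tendsto_divide[OF _ tendsto_const[of \<kappa>]] \<kappa>(1) by fastforce
  then have "(\<lambda>k. (norm (?G (\<omega> k)))\<^sup>2) \<longlonglongrightarrow> 0"
    by (rule tendsto_sandwich[OF _ _ tendsto_const, rotated -1])
       (use descent \<kappa>(1) in \<open>auto simp: field_simps\<close>)
  then have "(\<lambda>k. sqrt ((norm (?G (\<omega> k)))\<^sup>2)) \<longlonglongrightarrow> sqrt 0" by (rule tendsto_real_sqrt)
  then have "(\<lambda>k. norm (?G (\<omega> k))) \<longlonglongrightarrow> 0" by simp
  then have grad: "(\<lambda>k. ?G (\<omega> k)) \<longlonglongrightarrow> 0" by (rule tendsto_norm_zero_cancel)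
  obtain r where r: "strict_mono r" "(\<lambda>k. \<omega> (r k + 1)) \<longlonglongrightarrow> \<omega>_star"
    using assms(19) by (auto simp: accumulation_point_def o_def)
  \<comment> \<open>The accumulation point refers to the sequence shifted by one; these indices
    select the same subsequence from the unshifted one.\<close>
  have "strict_mono (\<lambda>k. r k + 1)" using r(1) by (simp add: strict_mono_def)
  then have "(\<lambda>k. ?G (\<omega> (r k + 1))) \<longlonglongrightarrow> 0"
    using LIMSEQ_subseq_LIMSEQ[OF grad] by (simp add: o_def)
  then have zero: "?G \<omega>_star = 0"
    using LIMSEQ_unique tendsto_alg_grad[OF r(2)] by blast
  have star: "\<omega>_star \<in> bcd_start alg"
    by (rule closed_sequentially[OF closed_bcd_start _ r(2)]) (rule start)
  obtain Y X where YX: "\<omega>_star = (Y, X)" by (cases \<omega>_star)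
  have "riem_grad ?f (Y, X) = 0"
  proof (cases "alg = GU")
    case True
    then show ?thesis
      using stationary_of_EUT[of X Y S L A] zero star by (simp add: YX bcd_start_def)
  next
    case False
    then have "riem_grad ?f (Y, X) = ?G (Y, X)"
      by (cases alg) (simp_all add: riem_grad_def alg_grad_def alg_Lambda_def)
    then show ?thesis using zero by (simp add: YX)
  qed
  moreover have "(Y, X) \<in> St \<times> SL"
    using star unfolding YX bcd_start_def by (cases alg) (auto simp: EUT_def)
  ultimately show ?thesis by (simp add: stationary_point_def YX)
qed

end
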